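(* Let $d\ge1$ and let $\Pi$ be an LCL on $\mathbb{Z}^d$. Then $\Pi$ is in the class $\mathsf{LAZY\;RTOAST}$ if and only if $\Pi$ is in the class $\mathsf{ffiid}$.
   Context: Grid and LCLs. $\mathbb{Z}^d$ denotes the infinite grid: the Cayley graph of the group $\mathbb{Z}^d$ with respect to the standard generators, each edge being oriented and labelled by its generator (isomorphisms preserve this structure). $d(\cdot,\cdot)$ is graph distance and $\mathcal B(v,r)$ the ball of radius $r$ around $v$. A locally checkable problem (LCL) on $\mathbb{Z}^d$ is $\Pi=(\Sigma_{in},\Sigma_{out},t,\mathcal P)$, where $\Sigma_{in},\Sigma_{out}$ are finite sets, $t\in\mathbb N$, and $\mathcal P$ is a set of (isomorphism types of) rooted grids of radius $t$ with each vertex labelled by one label of $\Sigma_{in}$ and one of $\Sigma_{out}$. A labelling of the vertices by $\Sigma_{in}\times\Sigma_{out}$ is a $\Pi$-coloring if the $t$-hop neighborhood of every vertex is in $\mathcal P$. Class $\mathsf{ffiid}$. A uniform local algorithm is a pair $\mathcal A=(\mathcal C,f)$, where $\mathcal C$ is a collection of rooted finite-radius neighborhoods in $\mathbb{Z}^d$ with vertices labelled by $\Sigma_{in}$ and by reals in $[0,1]$, and $f:\mathcal C\to\Sigma_{out}$ is measurable. It is run on $\Sigma_{in}$-labelled $\mathbb{Z}^d$ whose vertices carry independent uniform labels from $[0,1]$: each vertex explores balls of radius $0,1,2,\dots$ around itself until the labelled ball lies in $\mathcal C$, and then outputs the value of $f$. The coding radius $R_{\mathcal A}$ is the minimal radius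 needed; $\mathrm P(R_{\mathcal A}>r)$ denotes the supremum over all $\Sigma_{in}$-labellings of $\mathcal B(v,r)$ of the probability that $v$ has to look further than $r$. $\mathcal A$ solves $\Pi$ if for every $\Sigma_{in}$-labelling it produces a $\Pi$-coloring with probability $1$. $\mathcal A$ has uniform complexity $t(\varepsilon)$ if $\mathrm P(R_{\mathcal A}>t(\varepsilon))\le\varepsilon$ for all sufficiently small $\varepsilon>0$. $\mathsf{ffiid}$ is the class of LCLs that are solved by some uniform local algorithm of uniform complexity $t(\varepsilon)$ for some (finite-valued) function $t$. Toasts. For $q>0$, a $q$-toast on $\mathbb{Z}^d$ is a collection $\mathcal D$ of finite connected subsets (pieces) of $\mathbb{Z}^d$ such that (i) for all $g,h\in\mathbb{Z}^d$ there is $D\in\mathcal D$ with $g,h\in D$, and (ii) if $D,E\in\mathcal D$ and $d(\partial D,\partial E)\le q$ then $D=E$, where $\partial D$ is the boundary of $D$ (vertices of $D$ with a neighbor outside $D$). Class $\mathsf{LAZY\;RTOAST}$. A randomized $\mathsf{TOAST}$ algorithm for $\Pi$ is a (measurable) function $\mathcal A$ whose inputs are pairs $(A,c)$ together with a labelling of $A$ by reals from $[0,1]$, where $A$ is a finite connected $\Sigma_{in}$-labelled subset of $\mathbb{Z}^d$ and $c$ is a partial map from $A$ to $\Sigma_{out}$, and whose output is a partial map from $A$ to $\Sigma_{out}$ extending $c$ (not necessarily defined on all of $A$) that depends only on the isomorphism type of the input (not on its position in $\mathbb{Z}^d$). Given a $q$-toast $\mathcal D$ on $\Sigma_{in}$-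 and $[0,1]$-labelled $\mathbb{Z}^d$, one defines inductively along inclusion $\mathcal A(D)=\mathcal A\big(D,\bigcup\{\mathcal A(E):E\subsetneq D,\ E\in\mathcal D\}\big)$ for $D\in\mathcal D$ (with the empty partial map if there is no such $E$), and $\mathcal A(\mathcal D)=\bigcup_{D\in\mathcal D}\mathcal A(D)$. $\Pi\in\mathsf{LAZY\;RTOAST}$ if there are $q\in\mathbb N$, $q>0$, and a randomized $\mathsf{TOAST}$ algorithm $\mathcal A$ such that, for every fixed $\Sigma_{in}$-labelling of $\mathbb{Z}^d$, with probability $1$ an assignment of independent uniform reals from $[0,1]$ to the vertices of $\mathbb{Z}^d$ is such that $\mathcal A(\mathcal D)$ is (everywhere defined and) a $\Pi$-coloring for all $q$-toasts $\mathcal D$ simultaneously. *)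

theory Defs
  imports "HOL-Probability.Probability"
begin

section \<open>The grid\<close>

text \<open>
  The vertex set of the grid is \<open>int ^ 'd\<close> with \<open>d = CARD('d)\<close>, which is at least 1 because index
  types are non-empty; the edge from \<open>u\<close> to \<open>u + axis i 1\<close> is labelled by the generator \<open>i\<close>.
\<close>

definition grid_edge :: "'d::finite \<Rightarrow> int ^ 'd \<Rightarrow> int ^ 'd \<Rightarrow> bool" where
  "grid_edge i u v \<longleftrightarrow> v = u + axis i 1"

definition grid_adj :: "int ^ 'd::finite \<Rightarrow> int ^ 'd \<Rightarrow> bool" where
  "grid_adj u v \<longleftrightarrow> (\<exists>i. grid_edge i u v \<or> grid_edge i v u)"

definition grid_dist :: "int ^ 'd::finite \<Rightarrow> int ^ 'd \<Rightarrow> nat" where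
  "grid_dist u v = (LEAST n. (grid_adj ^^ n) u v)"

definition grid_ball :: "int ^ 'd::finite \<Rightarrow> nat \<Rightarrow> (int ^ 'd) set" where
  "grid_ball v r = {u. grid_dist v u \<le> r}"

definition grid_setdist :: "(int ^ 'd::finite) set \<Rightarrow> (int ^ 'd) set \<Rightarrow> enat" where
  "grid_setdist S T = (INF u\<in>S. INF v\<in>T. enat (grid_dist u v))"

definition grid_boundary :: "(int ^ 'd::finite) set \<Rightarrow> (int ^ 'd) set" where
  "grid_boundary D = {v \<in> D. \<exists>u. grid_adj v u \<and> u \<notin> D}"

definition grid_connected :: "(int ^ 'd::finite) set \<Rightarrow> bool" where
  "grid_connected A \<longleftrightarrow> A \<noteq> {} \<and>
     (\<forall>u\<in>A. \<forall>v\<in>A. (\<lambda>a b. a \<in> A \<and> b \<in> A \<and> grid_adj a b)\<^sup>*\<^sup>* u v)"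

text \<open>Isomorphisms of induced subgraphs; orientation and generator labels are preserved.\<close>

definition grid_iso ::
    "(int ^ 'd::finite \<Rightarrow> int ^ 'd) \<Rightarrow> (int ^ 'd) set \<Rightarrow> (int ^ 'd) set \<Rightarrow> bool" where
  "grid_iso \<phi> A B \<longleftrightarrow> bij_betw \<phi> A B \<and>
     (\<forall>a\<in>A. \<forall>b\<in>A. \<forall>i. grid_edge i a b \<longleftrightarrow> grid_edge i (\<phi> a) (\<phi> b))"

text \<open>
  On connected sets the isomorphisms are exactly the translations. In particular a rooted labelled
  ball has exactly one isomorphic copy centred at the origin, and below that copy (an extensional
  function on \<open>grid_ball 0 r\<close>) represents the isomorphism type.
\<close>

lemma grid_iso_translation:
  assumes iso: "grid_iso \<phi> A B" and con: "grid_connected A"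
  shows "\<exists>g. \<forall>a\<in>A. \<phi> a = g + a"
proof -
  obtain a0 where a0: "a0 \<in> A"
    using con by (auto simp: grid_connected_def)
  have "\<phi> a = (\<phi> a0 - a0) + a" if "a \<in> A" for a
  proof -
    have "(\<lambda>a b. a \<in> A \<and> b \<in> A \<and> grid_adj a b)\<^sup>*\<^sup>* a0 a"
      using con a0 that by (auto simp: grid_connected_def)
    then show ?thesis
    proof induction
      case (step b c)
      then obtain i where "grid_edge i b c \<or> grid_edge i c b"
        by (auto simp: grid_adj_def)
      moreover have "grid_edge i b c \<longleftrightarrow> grid_edge i (\<phi> b) (\<phi> c)"
          "grid_edge i c b \<longleftrightarrow> grid_edge i (\<phi> c) (\<phi> b)"
        using iso step.hyps by (auto simp: grid_iso_def)
      ultimately show ?case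
        using step.IH by (auto simp: grid_edge_def algebra_simps)
    qed simp
  qed
  then show ?thesis by blast
qed

lemma grid_iso_translate: "grid_iso (\<lambda>a. g + a) A ((\<lambda>a. g + a) ` A)"
  by (auto simp: grid_iso_def grid_edge_def bij_betw_def inj_on_def algebra_simps)

definition view :: "(int ^ 'd::finite \<Rightarrow> 'a) \<Rightarrow> int ^ 'd \<Rightarrow> nat \<Rightarrow> (int ^ 'd \<Rightarrow> 'a)" where
  "view l v r = (\<lambda>u\<in>grid_ball 0 r. l (v + u))"

section \<open>Locally checkable problems\<close>

record ('d, 'i, 'o) lcl =
  in_labels :: "'i set"
  out_labels :: "'o set"
  check_radius :: nat
  allowed :: "(int ^ 'd::finite \<Rightarrow> 'i \<times> 'o) set"

definition is_lcl :: "('d::finite, 'i, 'o) lcl \<Rightarrow> bool" where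
  "is_lcl \<P> \<longleftrightarrow> finite (in_labels \<P>) \<and> finite (out_labels \<P>) \<and>
     allowed \<P> \<subseteq> (grid_ball 0 (check_radius \<P>) \<rightarrow>\<^sub>E in_labels \<P> \<times> out_labels \<P>)"

definition is_coloring ::
    "('d::finite, 'i, 'o) lcl \<Rightarrow> (int ^ 'd \<Rightarrow> 'i) \<Rightarrow> (int ^ 'd \<Rightarrow> 'o) \<Rightarrow> bool" where
  "is_coloring \<P> \<sigma> \<tau> \<longleftrightarrow>
     (\<forall>v. \<sigma> v \<in> in_labels \<P> \<and> \<tau> v \<in> out_labels \<P>) \<and>
     (\<forall>v. view (\<lambda>u. (\<sigma> u, \<tau> u)) v (check_radius \<P>) \<in> allowed \<P>)"

section \<open>Random labels\<close>

definition unit_uniform :: "real measure" where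
  "unit_uniform = restrict_space lborel {0..1}"

definition random_labels :: "(int ^ 'd::finite \<Rightarrow> real) measure" where
  "random_labels = PiM UNIV (\<lambda>_. unit_uniform)"

section \<open>Uniform local algorithms and the class ffiid\<close>

text \<open>
  The collection of neighbourhoods and the output function are split by radius:
  \<open>stops r\<close> contains the radius-\<open>r\<close> neighbourhoods of the collection and \<open>out_fun r\<close> is the output
  function on them.
\<close>

record ('d, 'i, 'o) local_algorithm =
  stops :: "nat \<Rightarrow> (int ^ 'd::finite \<Rightarrow> 'i \<times> real) set"
  out_fun :: "nat \<Rightarrow> (int ^ 'd::finite \<Rightarrow> 'i \<times> real) \<Rightarrow> 'o"

text \<open>Only the measurable structure of this space is used, not its measure.\<close>

definition nbhd_space :: "'i set \<Rightarrow> nat \<Rightarrow> (int ^ 'd::finite \<Rightarrow> 'i \<times> real) measure" where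
  "nbhd_space I r = PiM (grid_ball 0 r) (\<lambda>_. count_space I \<Otimes>\<^sub>M unit_uniform)"

definition is_local_algorithm ::
    "('d::finite, 'i, 'o) lcl \<Rightarrow> ('d, 'i, 'o) local_algorithm \<Rightarrow> bool" where
  "is_local_algorithm \<P> \<A> \<longleftrightarrow>
     (\<forall>r. stops \<A> r \<in> sets (nbhd_space (in_labels \<P>) r) \<and>
          out_fun \<A> r \<in> restrict_space (nbhd_space (in_labels \<P>) r) (stops \<A> r)
                         \<rightarrow>\<^sub>M count_space (out_labels \<P>))"

text \<open>The infimum of the empty set is \<open>\<infinity>\<close>: the vertex never stops exploring.\<close>

definition coding_radius ::
    "('d::finite, 'i, 'o) local_algorithm \<Rightarrow> (int ^ 'd \<Rightarrow> 'i) \<Rightarrow> (int ^ 'd \<Rightarrow> real) \<Rightarrow>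
     int ^ 'd \<Rightarrow> enat" where
  "coding_radius \<A> \<sigma> x v =
     (INF r\<in>{r. view (\<lambda>u. (\<sigma> u, x u)) v r \<in> stops \<A> r}. enat r)"

definition local_output ::
    "('d::finite, 'i, 'o) local_algorithm \<Rightarrow> (int ^ 'd \<Rightarrow> 'i) \<Rightarrow> (int ^ 'd \<Rightarrow> real) \<Rightarrow>
     int ^ 'd \<Rightarrow> 'o" where
  "local_output \<A> \<sigma> x v =
     (let r = the_enat (coding_radius \<A> \<sigma> x v)
      in out_fun \<A> r (view (\<lambda>u. (\<sigma> u, x u)) v r))"

definition local_solves ::
    "('d::finite, 'i, 'o) lcl \<Rightarrow> ('d, 'i, 'o) local_algorithm \<Rightarrow> bool" where
  "local_solves \<P> \<A> \<longleftrightarrow>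
     (\<forall>\<sigma>. range \<sigma> \<subseteq> in_labels \<P> \<longrightarrow>
        (AE x in random_labels.
           (\<forall>v. coding_radius \<A> \<sigma> x v \<noteq> \<infinity>) \<and> is_coloring \<P> \<sigma> (local_output \<A> \<sigma> x)))"

text \<open>
  Whether the coding radius at \<open>v\<close> exceeds \<open>r\<close> depends only on the labels in \<open>grid_ball v r\<close>, so it
  does not matter that \<open>\<sigma>\<close> carries no meaningful labels outside of this ball.
\<close>

definition tail_prob ::
    "('d::finite, 'i, 'o) lcl \<Rightarrow> ('d, 'i, 'o) local_algorithm \<Rightarrow> int ^ 'd \<Rightarrow> nat \<Rightarrow> ennreal" where
  "tail_prob \<P> \<A> v r =
     (SUP \<sigma>\<in>grid_ball v r \<rightarrow>\<^sub>E in_labels \<P>.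
        emeasure random_labels {x \<in> space random_labels. enat r < coding_radius \<A> \<sigma> x v})"

definition has_uniform_complexity ::
    "('d::finite, 'i, 'o) lcl \<Rightarrow> ('d, 'i, 'o) local_algorithm \<Rightarrow> (real \<Rightarrow> nat) \<Rightarrow> bool" where
  "has_uniform_complexity \<P> \<A> t \<longleftrightarrow>
     (\<exists>\<epsilon>0>0. \<forall>\<epsilon>. 0 < \<epsilon> \<and> \<epsilon> < \<epsilon>0 \<longrightarrow> (\<forall>v. tail_prob \<P> \<A> v (t \<epsilon>) \<le> ennreal \<epsilon>))"

definition ffiid :: "('d::finite, 'i, 'o) lcl set" where
  "ffiid = {\<P>. is_lcl \<P> \<and>
     (\<exists>\<A> t. is_local_algorithm \<P> \<A> \<and> local_solves \<P> \<A> \<and> has_uniform_complexity \<P> \<A> t)}"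

section \<open>Toasts and the class LAZY RTOAST\<close>

definition is_toast :: "nat \<Rightarrow> (int ^ 'd::finite) set set \<Rightarrow> bool" where
  "is_toast q \<D> \<longleftrightarrow>
     (\<forall>D\<in>\<D>. finite D \<and> grid_connected D) \<and>
     (\<forall>g h. \<exists>D\<in>\<D>. g \<in> D \<and> h \<in> D) \<and>
     (\<forall>D\<in>\<D>. \<forall>E\<in>\<D>. grid_setdist (grid_boundary D) (grid_boundary E) \<le> enat q \<longrightarrow> D = E)"

text \<open>A toast algorithm takes a set, its input labels, its real labels and a partial map.\<close>

type_synonym ('d, 'i, 'o) toast_algorithm =
  "(int ^ 'd) set \<Rightarrow> (int ^ 'd \<Rightarrow> 'i) \<Rightarrow> (int ^ 'd \<Rightarrow> real) \<Rightarrow> (int ^ 'd \<rightharpoonup> 'o) \<Rightarrow> (int ^ 'd \<rightharpoonup> 'o)"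

definition toast_input ::
    "('d::finite, 'i, 'o) lcl \<Rightarrow> (int ^ 'd) set \<Rightarrow> (int ^ 'd \<Rightarrow> 'i) \<Rightarrow> (int ^ 'd \<rightharpoonup> 'o) \<Rightarrow> bool" where
  "toast_input \<P> A \<sigma> c \<longleftrightarrow>
     finite A \<and> grid_connected A \<and> \<sigma> \<in> A \<rightarrow>\<^sub>E in_labels \<P> \<and>
     dom c \<subseteq> A \<and> ran c \<subseteq> out_labels \<P>"

text \<open>
  The sets \<open>A\<close>, the labels \<open>\<sigma>\<close> and the maps \<open>c\<close> range over countable discrete sets, so measurability
  only concerns the real labels.
\<close>

definition is_toast_algorithm ::
    "('d::finite, 'i, 'o) lcl \<Rightarrow> ('d, 'i, 'o) toast_algorithm \<Rightarrow> bool" where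
  "is_toast_algorithm \<P> \<A> \<longleftrightarrow>
     (\<forall>A \<sigma> c. toast_input \<P> A \<sigma> c \<longrightarrow>
        (\<forall>x \<in> A \<rightarrow>\<^sub>E {0..1}.
           c \<subseteq>\<^sub>m \<A> A \<sigma> x c \<and> dom (\<A> A \<sigma> x c) \<subseteq> A \<and> ran (\<A> A \<sigma> x c) \<subseteq> out_labels \<P>) \<and>
        (\<lambda>x. \<A> A \<sigma> x c) \<in> PiM A (\<lambda>_. unit_uniform) \<rightarrow>\<^sub>M count_space UNIV) \<and>
     (\<forall>A \<sigma> c B \<sigma>' c' \<phi>. toast_input \<P> A \<sigma> c \<and> toast_input \<P> B \<sigma>' c' \<and> grid_iso \<phi> A B \<longrightarrow>
        (\<forall>x \<in> A \<rightarrow>\<^sub>E {0..1}. \<forall>x' \<in> B \<rightarrow>\<^sub>E {0..1}.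
           (\<forall>a\<in>A. \<sigma>' (\<phi> a) = \<sigma> a \<and> x' (\<phi> a) = x a \<and> c' (\<phi> a) = c a) \<longrightarrow>
           (\<forall>a\<in>A. \<A> B \<sigma>' x' c' (\<phi> a) = \<A> A \<sigma> x c a)))"

text \<open>
  Pieces of a toast may overlap without being nested, so the outputs of two pieces may contradict
  each other. The union below is undefined at the vertices where this happens; the choice is
  immaterial, since a contradiction anywhere prevents \<open>toast_result\<close> from being single-valued.
\<close>

definition map_Union :: "('a \<rightharpoonup> 'b) set \<Rightarrow> ('a \<rightharpoonup> 'b)" where
  "map_Union M = (\<lambda>a. if \<exists>!b. \<exists>m\<in>M. m a = Some b then Some (THE b. \<exists>m\<in>M. m a = Some b) else None)"

text \<open>The condition \<open>finite D\<close> holds for all pieces and only serves to make the recursion terminate.\<close>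

function toast_output ::
    "('d::finite, 'i, 'o) toast_algorithm \<Rightarrow> (int ^ 'd \<Rightarrow> 'i) \<Rightarrow> (int ^ 'd \<Rightarrow> real) \<Rightarrow>
     (int ^ 'd) set set \<Rightarrow> (int ^ 'd) set \<Rightarrow> (int ^ 'd \<rightharpoonup> 'o)" where
  "toast_output \<A> \<sigma> x \<D> D =
     \<A> D (restrict \<sigma> D) (restrict x D)
       (map_Union (toast_output \<A> \<sigma> x \<D> ` {E \<in> \<D>. E \<subset> D \<and> finite D}))"
  by auto
termination
  by (relation "inv_image finite_psubset (\<lambda>(\<A>, \<sigma>, x, \<D>, D). D)") auto

declare toast_output.simps [simp del]

definition toast_result ::
    "('d::finite, 'i, 'o) toast_algorithm \<Rightarrow> (int ^ 'd \<Rightarrow> 'i) \<Rightarrow> (int ^ 'd \<Rightarrow> real) \<Rightarrow>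
     (int ^ 'd) set set \<Rightarrow> ((int ^ 'd) \<times> 'o) set" where
  "toast_result \<A> \<sigma> x \<D> = (\<Union>D\<in>\<D>. Map.graph (toast_output \<A> \<sigma> x \<D> D))"

definition lazy_rtoast :: "('d::finite, 'i, 'o) lcl set" where
  "lazy_rtoast = {\<P>. is_lcl \<P> \<and>
     (\<exists>q>0. \<exists>\<A>. is_toast_algorithm \<P> \<A> \<and>
        (\<forall>\<sigma>. range \<sigma> \<subseteq> in_labels \<P> \<longrightarrow>
           (AE x in random_labels. \<forall>\<D>. is_toast q \<D> \<longrightarrow>
              (\<exists>\<tau>. toast_result \<A> \<sigma> x \<D> = {(v, \<tau> v) |v. True} \<and> is_coloring \<P> \<sigma> \<tau>))))}"

end

theory Submission
  imports Defs
begin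

text \<open>
  A local algorithm becomes a toast algorithm that colours a vertex once a piece contains the ball the
  vertex has to explore. Such a piece exists in every toast: infinitely many pieces contain the vertex,
  their boundaries are pairwise disjoint, so some boundary misses the ball.

  Conversely, the random labels themselves provide a toast in which membership of a piece is decided by
  a finite neighbourhood. At level \<open>n\<close> every vertex is marked with a small probability, and a marked
  vertex that is alone in a large cube becomes the center of a piece: a cube of radius \<open>r n\<close> that absorbs
  neighbourhoods of all lower pieces it touches. Marks are so sparse and the radii grow so fast that
  absorption does not spread, while Kolmogorov's 0-1 law shows that almost surely every finite set
  is covered. Since the toast algorithm succeeds on all toasts simultaneously, no independence between the
  toast and the labels used by the algorithm is needed. This gives coding radii that are almost surely
  finite for every fixed input; as the input alphabet is finite, compactness of the space of inputs makes
  the tail bound uniform.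
\<close>

section \<open>Sup-norm cubes and the grid metric\<close>

text \<open>Two obstacles shape the random toast. Every level reads the same single label of a
  vertex, so events of different levels at a common vertex are dependent. Independence returns when
  marks of level \<open>Suc n\<close> are sought only in the shell between two consecutive cubes: a
  lone mark appears there with probability bounded below uniformly in \<open>n\<close>, while marks
  of that level in the inner cube have summable probability. The second obstacle is that absorption
  is recursive although a piece must be readable from a finite window. Radii growing at least
  sevenfold and centers isolated up to five times their radius ensure that a chain of absorptions
  below level \<open>n\<close> moves by less than \<open>r n\<close>; a piece then lies within
  \<open>2 * r n\<close> of its center, and all that it consults is visible within
  \<open>5 * r n\<close>. Compactness is called for because the null set of labels on which
  exploration never ends depends on the input, and there may be uncountably many inputs. At a fixed
  radius, however, the tail probability depends on finitely many input labels, so the inputs with a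
  heavy tail form a closed set.\<close>

definition cube :: "int ^ 'd::finite \<Rightarrow> nat \<Rightarrow> (int ^ 'd) set" where
  "cube v k = {u. \<forall>i. \<bar>u $ i - v $ i\<bar> \<le> int k}"

lemma cube_refl [simp]: "v \<in> cube v k"
  by (simp add: cube_def)

lemma cube_sym: "u \<in> cube v k \<longleftrightarrow> v \<in> cube u k"
  by (simp add: cube_def abs_minus_commute)

lemma cube_trans:
  assumes "u \<in> cube v a" "w \<in> cube u b" "a + b \<le> c"
  shows "w \<in> cube v c"
proof -
  have "\<bar>w $ i - v $ i\<bar> \<le> int c" for i
  proof -
    have "\<bar>u $ i - v $ i\<bar> \<le> int a" "\<bar>w $ i - u $ i\<bar> \<le> int b"
      using assms by (auto simp: cube_def)
    then show ?thesis
      using assms(3) by linarith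
  qed
  then show ?thesis by (simp add: cube_def)
qed

lemma cube_mono: "a \<le> b \<Longrightarrow> cube v a \<subseteq> cube v b"
  using cube_trans[of v v 0] by auto

lemma cube_translate: "g + u \<in> cube (g + v) k \<longleftrightarrow> u \<in> cube v k"
  by (simp add: cube_def)

lemma cube_eq_image_PiE:
  "cube v k = (\<lambda>f. \<chi> i. f i) ` (\<Pi>\<^sub>E i\<in>UNIV. {v $ i - int k..v $ i + int k})"
proof -
  have "u \<in> (\<lambda>f. \<chi> i. f i) ` (\<Pi>\<^sub>E i\<in>UNIV. {v $ i - int k..v $ i + int k})" if "u \<in> cube v k" for u
  proof (rule image_eqI[of _ _ "\<lambda>i. u $ i"])
    show "(\<lambda>i. u $ i) \<in> (\<Pi>\<^sub>E i\<in>UNIV. {v $ i - int k..v $ i + int k})"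
      using that by (auto simp: cube_def abs_le_iff algebra_simps)
  qed (simp add: vec_eq_iff)
  moreover have "(\<chi> i. f i) \<in> cube v k" if "f \<in> (\<Pi>\<^sub>E i\<in>UNIV. {v $ i - int k..v $ i + int k})" for f
  proof -
    have "f i \<in> {v $ i - int k..v $ i + int k}" for i
      using that by (auto simp: PiE_iff)
    then show ?thesis
      by (auto simp: cube_def abs_le_iff algebra_simps)
  qed
  ultimately show ?thesis by blast
qed

lemma finite_cube [simp]: "finite (cube v k)"
  unfolding cube_eq_image_PiE by (intro finite_imageI finite_PiE) auto

lemma card_cube: "card (cube (v :: int ^ 'd::finite) k) = (2 * k + 1) ^ CARD('d)"
proof -
  have "inj_on (\<lambda>f. (\<chi> i. f i) :: int ^ 'd) A" for A :: "('d \<Rightarrow> int) set"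
    by (auto simp: inj_on_def vec_eq_iff fun_eq_iff)
  then have "card (cube v k) = card (\<Pi>\<^sub>E i\<in>(UNIV::'d set). {v $ i - int k..v $ i + int k})"
    unfolding cube_eq_image_PiE by (rule card_image)
  also have "\<dots> = (\<Prod>i\<in>(UNIV::'d set). card {v $ i - int k..v $ i + int k})"
    by (simp add: card_PiE)
  also have "\<dots> = (2 * k + 1) ^ CARD('d)"
    by (simp add: nat_add_distrib nat_mult_distrib)
  finally show ?thesis .
qed

lemma infinite_grid: "infinite (UNIV :: (int ^ 'd::finite) set)"
proof
  assume fin: "finite (UNIV :: (int ^ 'd::finite) set)"
  have "inj (\<lambda>k::int. (\<chi> i. k) :: int ^ 'd)"
    by (auto simp: inj_on_def vec_eq_iff)
  then have "finite (UNIV :: int set)"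
    using finite_imageD[OF finite_subset[OF subset_UNIV fin]] by blast
  then show False by simp
qed

section \<open>Paths and graph distance compared with cubes\<close>

lemma grid_adj_sym: "grid_adj u v \<Longrightarrow> grid_adj v u"
  by (auto simp: grid_adj_def)

lemma grid_adj_translate: "grid_adj (g + u) (g + v) \<longleftrightarrow> grid_adj u v"
  by (auto simp: grid_adj_def grid_edge_def algebra_simps)

lemma grid_adj_cube: "grid_adj u v \<Longrightarrow> v \<in> cube u 1"
  by (auto simp: grid_adj_def grid_edge_def cube_def axis_def)

text \<open>Moving one coordinate by one towards \<open>v\<close> lowers the l1 distance and never
  leaves the box spanned by the endpoints. Besides connectedness of cubes this yields a path between
  any two vertices, so the \<open>LEAST\<close> in \<open>grid_dist\<close> is attained.\<close>

lemma grid_path_in_hull: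
  assumes "\<And>w. (\<And>i. min (u $ i) (v $ i) \<le> w $ i \<and> w $ i \<le> max (u $ i) (v $ i)) \<Longrightarrow> w \<in> S"
  shows "(\<lambda>a b. a \<in> S \<and> b \<in> S \<and> grid_adj a b)\<^sup>*\<^sup>* u v"
  using assms
proof (induction "\<Sum>i\<in>UNIV. nat \<bar>u $ i - v $ i\<bar>" arbitrary: u rule: less_induct)
  case less
  show ?case
  proof (cases "u = v")
    case False
    then obtain i where i: "u $ i \<noteq> v $ i"
      by (auto simp: vec_eq_iff)
    define w where "w = (if u $ i < v $ i then u + axis i 1 else u - axis i 1)"
    have wi: "w $ i = (if u $ i < v $ i then u $ i + 1 else u $ i - 1)"
      by (simp add: w_def)
    have wj: "w $ j = u $ j" if "j \<noteq> i" for j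
      using that by (simp add: w_def axis_def)
    have adj: "grid_adj u w"
      by (auto simp: w_def grid_adj_def grid_edge_def)
    have le: "min (u $ j) (v $ j) \<le> w $ j \<and> w $ j \<le> max (u $ j) (v $ j)" for j
      using i wi wj[of j] by (cases "j = i") (auto split: if_splits)
    have mem: "u \<in> S" "w \<in> S"
      by (rule less.prems; simp add: le)+
    have "(\<Sum>j\<in>UNIV. nat \<bar>w $ j - v $ j\<bar>) < (\<Sum>j\<in>UNIV. nat \<bar>u $ j - v $ j\<bar>)"
    proof (rule sum_strict_mono_ex1)
      show "\<forall>j\<in>UNIV. nat \<bar>w $ j - v $ j\<bar> \<le> nat \<bar>u $ j - v $ j\<bar>"
      proof
        fix j show "nat \<bar>w $ j - v $ j\<bar> \<le> nat \<bar>u $ j - v $ j\<bar>"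
          using i wi wj[of j] by (cases "j = i") (auto split: if_splits)
      qed
      show "\<exists>j\<in>UNIV. nat \<bar>w $ j - v $ j\<bar> < nat \<bar>u $ j - v $ j\<bar>"
        using i wi by (intro bexI[of _ i]) (auto split: if_splits)
    qed simp
    moreover have "z \<in> S" if "\<And>j. min (w $ j) (v $ j) \<le> z $ j \<and> z $ j \<le> max (w $ j) (v $ j)" for z
    proof (rule less.prems)
      fix j show "min (u $ j) (v $ j) \<le> z $ j \<and> z $ j \<le> max (u $ j) (v $ j)"
        using that[of j] le[of j] by linarith
    qed
    ultimately have "(\<lambda>a b. a \<in> S \<and> b \<in> S \<and> grid_adj a b)\<^sup>*\<^sup>* w v"
      by (rule less.hyps)
    moreover have "u \<in> S \<and> w \<in> S \<and> grid_adj u w"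
      using mem adj by blast
    ultimately show ?thesis
      by (rule converse_rtranclp_into_rtranclp[rotated])
  qed simp
qed

lemma grid_connected_cube: "grid_connected (cube v k)"
  unfolding grid_connected_def
proof (intro conjI ballI grid_path_in_hull)
  show "cube v k \<noteq> {}"
    using cube_refl by blast
next
  fix a b w assume ab: "a \<in> cube v k" "b \<in> cube v k"
    and w: "\<And>i. min (a $ i) (b $ i) \<le> w $ i \<and> w $ i \<le> max (a $ i) (b $ i)"
  show "w \<in> cube v k"
    unfolding cube_def
  proof (intro CollectI allI)
    fix i
    have "\<bar>a $ i - v $ i\<bar> \<le> int k" "\<bar>b $ i - v $ i\<bar> \<le> int k"
      using ab by (auto simp: cube_def)
    then show "\<bar>w $ i - v $ i\<bar> \<le> int k"
      using w[of i] by linarith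
  qed
qed

lemma grid_relpow_dist: "(grid_adj ^^ grid_dist u v) u v"
proof -
  have "(\<lambda>a b. a \<in> UNIV \<and> b \<in> UNIV \<and> grid_adj a b)\<^sup>*\<^sup>* u v"
    by (rule grid_path_in_hull) simp
  then have "grid_adj\<^sup>*\<^sup>* u v"
    by simp
  then obtain n where "(grid_adj ^^ n) u v"
    by (auto dest: rtranclp_imp_relpowp)
  then show ?thesis
    unfolding grid_dist_def by (rule LeastI)
qed

lemma grid_dist_le: "(grid_adj ^^ n) u v \<Longrightarrow> grid_dist u v \<le> n"
  unfolding grid_dist_def by (rule Least_le)

lemma grid_dist_self [simp]: "grid_dist u u = 0"
  using grid_dist_le[of 0 u u] by simp

lemma relpow_adj_cube: "(grid_adj ^^ n) u v \<Longrightarrow> v \<in> cube u n"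
proof (induction n arbitrary: v)
  case (Suc n)
  then obtain w where "(grid_adj ^^ n) u w" "grid_adj w v"
    by auto
  then show ?case
    using Suc.IH grid_adj_cube cube_trans[of w u n v 1] by auto
qed simp

text \<open>The graph distance dominates the sup-norm. Hence separation shown with cubes, whose
  cardinality is explicit, gives the separation in the graph metric that a toast demands.\<close>

lemma grid_ball_subset_cube: "grid_ball v r \<subseteq> cube v r"
proof
  fix u assume "u \<in> grid_ball v r"
  then have "grid_dist v u \<le> r"
    by (simp add: grid_ball_def)
  then show "u \<in> cube v r"
    using relpow_adj_cube[OF grid_relpow_dist[of v u]] cube_mono by blast
qed

lemma finite_grid_ball [simp]: "finite (grid_ball v r)"
  using grid_ball_subset_cube finite_cube by (rule finite_subset)

lemma grid_dist_translate: "grid_dist (g + u) (g + v) = grid_dist u v"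
proof -
  have "(grid_adj ^^ n) (g + u) (g + v) \<longleftrightarrow> (grid_adj ^^ n) u v" for n
  proof (induction n arbitrary: v)
    case (Suc n)
    have "(grid_adj ^^ Suc n) (g + u) (g + v) \<longleftrightarrow>
        (\<exists>w. (grid_adj ^^ n) (g + u) (g + w) \<and> grid_adj (g + w) (g + v))"
      by (auto simp: relcompp_apply) (metis add_diff_cancel_left' diff_add_cancel)
    then show ?case
      using Suc.IH by (auto simp: grid_adj_translate relcompp_apply)
  qed simp
  then show ?thesis
    by (simp add: grid_dist_def)
qed

lemma grid_ball_translate: "g + u \<in> grid_ball (g + v) r \<longleftrightarrow> u \<in> grid_ball v r"
  by (simp add: grid_ball_def grid_dist_translate)

lemma grid_ball_translate_0: "v + u \<in> grid_ball v r \<longleftrightarrow> u \<in> grid_ball 0 r"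
  using grid_ball_translate[of v u 0] by simp

lemma grid_ball_image: "grid_ball v r = (+) v ` grid_ball 0 r"
proof -
  have "w \<in> (+) v ` grid_ball 0 r" if "w \<in> grid_ball v r" for w
    using that grid_ball_translate_0[of v "w - v"] by (intro image_eqI[of _ _ "w - v"]) auto
  then show ?thesis
    using grid_ball_translate_0 by auto
qed

lemma grid_ball_mono: "r \<le> s \<Longrightarrow> grid_ball v r \<subseteq> grid_ball v s"
  by (auto simp: grid_ball_def)

lemma center_in_grid_ball [simp]: "v \<in> grid_ball v r"
  by (simp add: grid_ball_def)

lemma finite_subset_grid_ball:
  assumes "finite S"
  shows "\<exists>r. S \<subseteq> grid_ball v r"
proof
  show "S \<subseteq> grid_ball v (Max (grid_dist v ` S))"
    using assms by (auto simp: grid_ball_def)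
qed

text \<open>A path from \<open>v\<close> that ends outside \<open>D\<close> has a vertex in
  \<open>D\<close> whose successor is outside; on a shortest path to a vertex of the ball it still
  lies in the ball.\<close>

lemma grid_ball_crosses_boundary:
  assumes "v \<in> D" "\<not> grid_ball v r \<subseteq> D"
  shows "grid_boundary D \<inter> grid_ball v r \<noteq> {}"
proof -
  have *: "\<exists>w\<in>grid_boundary D. \<exists>m\<le>n. (grid_adj ^^ m) v w" if "(grid_adj ^^ n) v u" "u \<notin> D" for n u
    using that
  proof (induction n arbitrary: u)
    case 0
    then show ?case using assms(1) by simp
  next
    case (Suc n)
    from Suc.prems(1) obtain w where w: "(grid_adj ^^ n) v w" "grid_adj w u"
      by auto
    show ?case
    proof (cases "w \<in> D")
      case True
      then have "w \<in> grid_boundary D"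
        using w Suc.prems by (auto simp: grid_boundary_def)
      then show ?thesis
        using w by (intro bexI[of _ w] exI[of _ n]) auto
    next
      case False
      then show ?thesis
        using Suc.IH[OF w(1)] le_SucI by blast
    qed
  qed
  obtain u where "u \<in> grid_ball v r" "u \<notin> D"
    using assms(2) by blast
  moreover from this obtain w m
    where "w \<in> grid_boundary D" "m \<le> grid_dist v u" "(grid_adj ^^ m) v w"
    using *[OF grid_relpow_dist] by blast
  ultimately show ?thesis
    using grid_dist_le[of m v w] by (auto simp: grid_ball_def)
qed

lemma grid_setdist_le_iff:
  "grid_setdist S T \<le> enat q \<longleftrightarrow> (\<exists>u\<in>S. \<exists>v\<in>T. grid_dist u v \<le> q)"
proof
  assume le: "grid_setdist S T \<le> enat q"
  show "\<exists>u\<in>S. \<exists>v\<in>T. grid_dist u v \<le> q"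
  proof (rule ccontr)
    assume "\<not> (\<exists>u\<in>S. \<exists>v\<in>T. grid_dist u v \<le> q)"
    then have "enat (Suc q) \<le> grid_setdist S T"
      unfolding grid_setdist_def by (intro INF_greatest) (auto simp: not_le Suc_le_eq)
    then have "enat (Suc q) \<le> enat q"
      using le by (rule order_trans)
    then show False by simp
  qed
next
  assume "\<exists>u\<in>S. \<exists>v\<in>T. grid_dist u v \<le> q"
  then obtain u v where uv: "u \<in> S" "v \<in> T" "grid_dist u v \<le> q"
    by blast
  have "grid_setdist S T \<le> (INF v\<in>T. enat (grid_dist u v))"
    unfolding grid_setdist_def by (rule INF_lower) (rule uv)
  also have "\<dots> \<le> enat (grid_dist u v)"
    by (rule INF_lower) (rule uv)
  also have "\<dots> \<le> enat q"
    using uv by simp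
  finally show "grid_setdist S T \<le> enat q" .
qed

lemma grid_connected_translate:
  assumes "grid_connected A"
  shows "grid_connected ((+) g ` A)"
  unfolding grid_connected_def
proof (intro conjI ballI)
  show "(+) g ` A \<noteq> {}"
    using assms by (auto simp: grid_connected_def)
next
  fix a b assume "a \<in> (+) g ` A" "b \<in> (+) g ` A"
  then obtain u v where uv: "u \<in> A" "v \<in> A" "a = g + u" "b = g + v"
    by blast
  have "(\<lambda>a b. a \<in> A \<and> b \<in> A \<and> grid_adj a b)\<^sup>*\<^sup>* u v"
    using assms uv by (auto simp: grid_connected_def)
  then have "(\<lambda>a b. a \<in> (+) g ` A \<and> b \<in> (+) g ` A \<and> grid_adj a b)\<^sup>*\<^sup>* (g + u) (g + v)"
  proof induction
    case (step y z)
    then show ?case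
      by (intro rtranclp.rtrancl_into_rtrancl[OF step.IH]) (simp add: grid_adj_translate)
  qed simp
  then show "(\<lambda>a b. a \<in> (+) g ` A \<and> b \<in> (+) g ` A \<and> grid_adj a b)\<^sup>*\<^sup>* a b"
    using uv by simp
qed

lemma toast_piece_contains_ball:
  assumes toast: "is_toast q \<D>"
  shows "\<exists>D\<in>\<D>. grid_ball v r \<subseteq> D"
proof -
  define \<S> where "\<S> = {D \<in> \<D>. v \<in> D}"
  \<comment> \<open>Finitely many pieces through \<open>v\<close> would have a finite union, but the
    covering axiom puts every vertex into a common piece with \<open>v\<close>.\<close>
  have inf: "infinite \<S>"
  proof
    assume "finite \<S>"
    then have "finite (\<Union>\<S>)"
      using toast by (auto simp: \<S>_def is_toast_def)
    moreover have "h \<in> \<Union>\<S>" for h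
    proof -
      obtain D where "D \<in> \<D>" "v \<in> D" "h \<in> D"
        using toast unfolding is_toast_def by blast
      then show ?thesis by (auto simp: \<S>_def)
    qed
    then have "\<Union>\<S> = UNIV"
      by blast
    ultimately show False
      using infinite_grid by metis
  qed
  define \<B> where "\<B> = {D \<in> \<S>. grid_boundary D \<inter> grid_ball v r \<noteq> {}}"
  \<comment> \<open>Choosing for each piece a boundary vertex in the ball is injective: a shared
    boundary vertex puts two boundaries at distance 0, which is at most \<open>q\<close>.\<close>
  have "finite \<B>"
  proof -
    have "\<forall>D\<in>\<B>. \<exists>w. w \<in> grid_boundary D \<inter> grid_ball v r"
      by (auto simp: \<B>_def)
    from bchoice[OF this]
    obtain w where w: "\<And>D. D \<in> \<B> \<Longrightarrow> w D \<in> grid_boundary D \<inter> grid_ball v r"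
      by blast
    have "D = E" if "D \<in> \<B>" "E \<in> \<B>" "w D = w E" for D E
    proof -
      have "w D \<in> grid_boundary D" "w D \<in> grid_boundary E" "D \<in> \<D>" "E \<in> \<D>"
        using w[OF that(1)] w[OF that(2)] that by (auto simp: \<S>_def \<B>_def)
      moreover have "grid_dist (w D) (w D) \<le> q"
        by simp
      ultimately have "grid_setdist (grid_boundary D) (grid_boundary E) \<le> enat q"
        unfolding grid_setdist_le_iff by blast
      then show ?thesis
        using toast \<open>D \<in> \<D>\<close> \<open>E \<in> \<D>\<close> by (auto simp: is_toast_def)
    qed
    then have "inj_on w \<B>"
      by (rule inj_onI)
    moreover have "w ` \<B> \<subseteq> grid_ball v r"
      using w by blast
    ultimately show ?thesis
      using finite_grid_ball by (meson finite_imageD finite_subset)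
  qed
  then have "infinite (\<S> - \<B>)"
    using inf by (rule Diff_infinite_finite)
  then have "\<S> - \<B> \<noteq> {}"
    by (metis finite.emptyI)
  then obtain D where "D \<in> \<S> - \<B>"
    by blast
  then have "D \<in> \<S>" "grid_boundary D \<inter> grid_ball v r = {}"
    by (auto simp: \<B>_def)
  then show ?thesis
    using grid_ball_crosses_boundary[of v D r] by (auto simp: \<S>_def)
qed

section \<open>Toasts built from sparse centers\<close>

text \<open>
  Absorbing the \<open>(q + 1)\<close>-neighbourhood of every set of \<open>L\<close> at distance at most \<open>q\<close> keeps the boundary of
  the result at distance more than \<open>q\<close> from the absorbed sets.
\<close>

inductive_set thicken :: "nat \<Rightarrow> (int ^ 'd::finite) set set \<Rightarrow> (int ^ 'd) set \<Rightarrow> (int ^ 'd) set"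
  for q L X where
  thicken_base: "u \<in> X \<Longrightarrow> u \<in> thicken q L X"
| thicken_step: "u \<in> thicken q L X \<Longrightarrow> E \<in> L \<Longrightarrow> e \<in> E \<Longrightarrow> u \<in> cube e q \<Longrightarrow> e' \<in> E \<Longrightarrow>
    z \<in> cube e' (Suc q) \<Longrightarrow> z \<in> thicken q L X"

text \<open>A pair \<open>(n, v)\<close> in \<open>C\<close> is a center \<open>v\<close> of level \<open>n\<close>, and \<open>r n\<close> is the radius of the cube its piece starts from.\<close>

primrec lower :: "nat \<Rightarrow> (nat \<Rightarrow> nat) \<Rightarrow> (nat \<times> (int ^ 'd::finite)) set \<Rightarrow> nat \<Rightarrow> (int ^ 'd) set set" where
  "lower q r C 0 = {}"
| "lower q r C (Suc n) = lower q r C n \<union> (\<lambda>v. thicken q (lower q r C n) (cube v (r n))) ` {v. (n, v) \<in> C}"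

definition piece :: "nat \<Rightarrow> (nat \<Rightarrow> nat) \<Rightarrow> (nat \<times> (int ^ 'd::finite)) set \<Rightarrow> nat \<Rightarrow> int ^ 'd \<Rightarrow> (int ^ 'd) set" where
  "piece q r C n v = thicken q (lower q r C n) (cube v (r n))"

definition pieces :: "nat \<Rightarrow> (nat \<Rightarrow> nat) \<Rightarrow> (nat \<times> (int ^ 'd::finite)) set \<Rightarrow> (int ^ 'd) set set" where
  "pieces q r C = {piece q r C n v |n v. (n, v) \<in> C}"

lemma lower_eq: "lower q r C n = {piece q r C m v |m v. m < n \<and> (m, v) \<in> C}"
proof (induction n)
  case (Suc n)
  have "lower q r C (Suc n) = lower q r C n \<union> {piece q r C n v |v. (n, v) \<in> C}"
    by (auto simp: piece_def)
  also have "\<dots> = {piece q r C m v |m v. m < Suc n \<and> (m, v) \<in> C}"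
    unfolding Suc less_Suc_eq by blast
  finally show ?case .
qed simp

text \<open>The radius \<open>5 * r n\<close> is the one on which \<open>marked_centers\<close>
  tests isolation, so these centers can be recognised from the labels in \<open>S\<close>.\<close>

definition confined :: "(nat \<Rightarrow> nat) \<Rightarrow> (nat \<times> (int ^ 'd::finite)) set \<Rightarrow> (int ^ 'd) set \<Rightarrow> (nat \<times> (int ^ 'd)) set" where
  "confined r C S = {(n, v) \<in> C. cube v (5 * r n) \<subseteq> S}"

text \<open>The 5: a piece stays within \<open>2 * r n\<close> of its center, so two pieces of level
  \<open>n\<close> at distance at most \<open>q\<close> have centers within
  \<open>4 * r n + q\<close>. The 7: absorption through levels up to \<open>n\<close> moves by at
  most \<open>6 * r n\<close>, and the remaining \<open>r n\<close> leaves room for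
  \<open>2 * q + 2\<close>.\<close>

locale sparse_centers =
  fixes q :: nat and r :: "nat \<Rightarrow> nat" and C :: "(nat \<times> (int ^ 'd::finite)) set"
  assumes r_0: "2 * q + 2 \<le> r 0"
    and r_Suc: "7 * r n \<le> r (Suc n)"
    and sparse: "(n, v) \<in> C \<Longrightarrow> (n, w) \<in> C \<Longrightarrow> w \<in> cube v (5 * r n) \<Longrightarrow> v = w"
begin

section \<open>Bounds on the spread of absorption\<close>

lemma r_ge_q: "2 * q + 2 \<le> r n"
proof (induction n)
  case (Suc n)
  then show ?case using r_Suc[of n] by linarith
qed (rule r_0)

lemma r_less: "m < n \<Longrightarrow> 7 * r m \<le> r n"
proof (induction n)
  case (Suc n)
  then show ?case using r_Suc[of n] by (cases "m = n") auto
qed simp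

text \<open>One absorption step without reference to the set being thickened, so that the length of
  a chain is a question about the lower levels alone.\<close>

definition jump :: "nat \<Rightarrow> int ^ 'd \<Rightarrow> int ^ 'd \<Rightarrow> bool" where
  "jump n u z \<longleftrightarrow> (\<exists>E\<in>lower q r C n. \<exists>e\<in>E. \<exists>e'\<in>E. u \<in> cube e q \<and> z \<in> cube e' (Suc q))"

text \<open>A chain meets the surroundings of at most one piece of the top level \<open>m\<close>.
  Crossing them costs twice \<open>r m + reach m + q + 1\<close>, and the chains through lower
  levels before and after cost \<open>reach m\<close> each; by \<open>reach_le\<close> the sum is at
  most \<open>6 * r m\<close>.\<close>

definition reach :: "nat \<Rightarrow> nat" where
  "reach n = (case n of 0 \<Rightarrow> 0 | Suc m \<Rightarrow> 6 * r m)"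

lemma reach_le: "reach n + 2 * q + 2 \<le> r n"
proof (cases n)
  case (Suc m)
  then show ?thesis using r_Suc[of m] r_ge_q[of m] by (simp add: reach_def)
qed (use r_0 in \<open>simp add: reach_def\<close>)

lemma thicken_jump:
  assumes "z \<in> thicken q (lower q r C n) X"
  shows "\<exists>u\<in>X. (jump n)\<^sup>*\<^sup>* u z"
  using assms
proof induction
  case (thicken_step u E e e' z)
  then have "jump n u z"
    by (auto simp: jump_def)
  then show ?case
    using thicken_step.IH by (meson rtranclp.rtrancl_into_rtrancl)
qed blast

text \<open>The bound on chains is a hypothesis because \<open>jump_reach\<close> uses this
  consequence at level \<open>n\<close> while proving its bound at level
  \<open>Suc n\<close>.\<close>

lemma piece_subset:
  assumes "\<And>u z. (jump n)\<^sup>*\<^sup>* u z \<Longrightarrow> z \<in> cube u (reach n)"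
  shows "piece q r C n v \<subseteq> cube v (r n + reach n)"
  using thicken_jump assms cube_trans unfolding piece_def by blast

text \<open>
  By sparsity a chain of jumps cannot visit two different pieces of the highest level, because the
  stretch between them would consist of jumps through lower pieces and be too short.
\<close>

lemma jump_reach: "(jump n)\<^sup>*\<^sup>* u z \<Longrightarrow> z \<in> cube u (reach n)"
proof (induction n arbitrary: u z)
  case 0
  have "\<not> jump 0 a b" for a b
    by (simp add: jump_def)
  with 0 show ?case
    by (induction rule: rtranclp_induct) auto
next
  case (Suc n)
  define near where "near v a \<longleftrightarrow> a \<in> cube v (r n + reach n + Suc q)" for v a :: "int ^ 'd"
  have jump_cases: "jump n a b \<or> (\<exists>v. (n, v) \<in> C \<and> near v a \<and> near v b)" if ab: "jump (Suc n) a b" for a b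
  proof -
    obtain E e e' where E: "E \<in> lower q r C (Suc n)" "e \<in> E" "e' \<in> E" "a \<in> cube e q" "b \<in> cube e' (Suc q)"
      using ab unfolding jump_def by blast
    show ?thesis
    proof (cases "E \<in> lower q r C n")
      case True
      then show ?thesis using E by (auto simp: jump_def)
    next
      case False
      then obtain v where v: "(n, v) \<in> C" "E = piece q r C n v"
        using E by (auto simp: piece_def)
      then have "e \<in> cube v (r n + reach n)" "e' \<in> cube v (r n + reach n)"
        using piece_subset[OF Suc.IH] E by auto
      then have "near v a" "near v b"
        using E cube_trans[of e v _ a q] cube_trans[of e' v _ b "Suc q"] by (auto simp: near_def)
      with v show ?thesis by blast
    qed
  qed
  \<comment> \<open>Invariant: either all jumps go through lower levels, or the chain consists of
    lower jumps, one transfer between two points near the same center of level \<open>n\<close>, and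
    lower jumps again.\<close>
  have "(jump n)\<^sup>*\<^sup>* u z \<or>
      (\<exists>v a b. (n, v) \<in> C \<and> (jump n)\<^sup>*\<^sup>* u a \<and> near v a \<and> near v b \<and> (jump n)\<^sup>*\<^sup>* b z)"
    using Suc.prems
  proof (induction rule: rtranclp_induct)
    case (step y z)
    consider "jump n y z" | v where "(n, v) \<in> C" "near v y" "near v z"
      using jump_cases[OF step.hyps(2)] by blast
    then show ?case
    proof cases
      case 1
      then show ?thesis using step.IH by (meson rtranclp.rtrancl_into_rtrancl)
    next
      case v: 2
      show ?thesis
        using step.IH
      proof
        assume "(jump n)\<^sup>*\<^sup>* u y"
        then show ?thesis using v by blast
      next
        assume "\<exists>v a b. (n, v) \<in> C \<and> (jump n)\<^sup>*\<^sup>* u a \<and> near v a \<and> near v b \<and> (jump n)\<^sup>*\<^sup>* b y"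
        then obtain w a b where w: "(n, w) \<in> C" "(jump n)\<^sup>*\<^sup>* u a" "near w a" "near w b" "(jump n)\<^sup>*\<^sup>* b y"
          by blast
        \<comment> \<open>The new center \<open>v\<close> and the earlier one \<open>w\<close> are
          linked by two approaches and a stretch of lower jumps, in total
          \<open>2 * r n + 3 * reach n + 2 * q + 2\<close>, at most \<open>5 * r n\<close>; sparsity
          identifies them and the two visits merge.\<close>
        have "y \<in> cube b (reach n)"
          using Suc.IH w by blast
        then have "y \<in> cube w (r n + reach n + Suc q + reach n)"
          using w by (intro cube_trans[of b w _ y "reach n"]) (auto simp: near_def)
        moreover have "v \<in> cube y (r n + reach n + Suc q)"
          using v by (simp add: near_def cube_sym)
        ultimately have "v \<in> cube w (5 * r n)"
          by (rule cube_trans) (use reach_le[of n] in linarith)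
        then have "w = v"
          using sparse v w by blast
        then show ?thesis using v w by blast
      qed
    qed
  qed simp
  then show ?case
  proof
    assume "(jump n)\<^sup>*\<^sup>* u z"
    then have "z \<in> cube u (reach n)"
      by (rule Suc.IH)
    then show ?thesis
      using cube_mono[of "reach n" "reach (Suc n)" u] reach_le[of n] by (auto simp: reach_def)
  next
    assume "\<exists>v a b. (n, v) \<in> C \<and> (jump n)\<^sup>*\<^sup>* u a \<and> near v a \<and> near v b \<and> (jump n)\<^sup>*\<^sup>* b z"
    then obtain v a b where *: "a \<in> cube u (reach n)" "near v a" "near v b" "z \<in> cube b (reach n)"
      using Suc.IH by blast
    have "v \<in> cube u (reach n + (r n + reach n + Suc q))"
      using * by (intro cube_trans[OF *(1)]) (auto simp: near_def cube_sym)
    moreover have "z \<in> cube v (r n + reach n + Suc q + reach n)"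
      using * by (intro cube_trans[of b v _ z "reach n"]) (auto simp: near_def)
    ultimately show ?thesis
      by (rule cube_trans) (use reach_le[of n] in \<open>simp add: reach_def\<close>)
  qed
qed

section \<open>Separation, nesting and connectedness of pieces\<close>

lemma piece_subset_cube: "piece q r C n v \<subseteq> cube v (2 * r n)"
  using piece_subset[OF jump_reach] cube_mono[of "r n + reach n" "2 * r n"] reach_le[of n] by fastforce

lemma cube_subset_piece: "cube v (r n) \<subseteq> piece q r C n v"
  by (auto simp: piece_def thicken_base)

lemma finite_piece: "finite (piece q r C n v)"
  using piece_subset_cube finite_cube by (rule finite_subset)

lemma pieces_same_level_far:
  assumes "(n, v) \<in> C" "(n, w) \<in> C" "a \<in> piece q r C n v" "b \<in> piece q r C n w" "a \<in> cube b q"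
  shows "v = w"
proof -
  have "a \<in> cube v (2 * r n)" "b \<in> cube w (2 * r n)"
    using assms piece_subset_cube by auto
  then have "b \<in> cube v (2 * r n + q)" "w \<in> cube b (2 * r n)"
    using assms(5) cube_trans[of a v "2 * r n" b q] by (auto simp: cube_sym)
  then have "w \<in> cube v (5 * r n)"
    by (rule cube_trans) (use r_ge_q[of n] in linarith)
  then show ?thesis
    using sparse assms by blast
qed

text \<open>The closure rule of \<open>thicken\<close>, read for finished pieces. Separation,
  nesting, connectedness and locality all rest on it.\<close>

lemma piece_absorbs:
  assumes "m < n" "(m, w) \<in> C" "a \<in> piece q r C n v" "b \<in> piece q r C m w" "a \<in> cube b q"
    and "b' \<in> piece q r C m w" "z \<in> cube b' (Suc q)"
  shows "z \<in> piece q r C n v"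
proof -
  have "piece q r C m w \<in> lower q r C n"
    using assms by (auto simp: lower_eq)
  then show ?thesis
    using assms unfolding piece_def[of q r C n v] by (blast intro: thicken_step)
qed

text \<open>Here the one in \<open>Suc q\<close> is spent: the outer neighbour of a boundary vertex
  at distance at most \<open>q\<close> from a lower piece is at distance at most
  \<open>q + 1\<close> from it, hence has been absorbed.\<close>

lemma near_boundaries_less:
  assumes "m < n" "(m, w) \<in> C"
    and "a \<in> grid_boundary (piece q r C n v)" "b \<in> piece q r C m w" "a \<in> cube b q"
  shows False
proof -
  obtain u where u: "grid_adj a u" "u \<notin> piece q r C n v" "a \<in> piece q r C n v"
    using assms by (auto simp: grid_boundary_def)
  then have "u \<in> cube b (Suc q)"
    using grid_adj_cube[OF u(1)] assms(5) cube_trans[of a b q u 1] by auto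
  then show False
    using piece_absorbs[OF assms(1,2) u(3) assms(4,5,4)] u(2) by blast
qed

lemma pieces_separated:
  assumes "D \<in> pieces q r C" "E \<in> pieces q r C"
    and "grid_setdist (grid_boundary D) (grid_boundary E) \<le> enat q"
  shows "D = E"
proof -
  obtain n v m w where D: "D = piece q r C n v" "(n, v) \<in> C" and E: "E = piece q r C m w" "(m, w) \<in> C"
    using assms by (auto simp: pieces_def)
  obtain a b where ab: "a \<in> grid_boundary D" "b \<in> grid_boundary E" "grid_dist a b \<le> q"
    using assms(3) by (auto simp: grid_setdist_le_iff)
  then have "b \<in> cube a q" "a \<in> D" "b \<in> E"
    using grid_ball_subset_cube[of a q] by (auto simp: grid_ball_def grid_boundary_def)
  moreover from this have "a \<in> cube b q"
    by (simp add: cube_sym)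
  ultimately show ?thesis
    using near_boundaries_less[of m n w a v b] near_boundaries_less[of n m v b w a]
      pieces_same_level_far[of n v w a b] D E ab
    by (cases m n rule: linorder_cases) auto
qed

text \<open>At equal levels, overlapping pieces have the same center and coincide; a piece of larger
  level that touches one of smaller level contains it. Thus the toast recursion at a piece descends
  only to lower levels.\<close>

lemma strict_subset_piece:
  assumes "(n, v) \<in> C" "(m, w) \<in> C" "piece q r C m w \<subset> piece q r C n v"
  shows "m < n"
proof (rule ccontr)
  assume "\<not> m < n"
  then consider "m = n" | "n < m" by linarith
  then show False
  proof cases
    case 1
    have "w \<in> piece q r C m w"
      using cube_subset_piece[of w m] cube_refl[of w "r m"] by blast
    then show ?thesis
      using 1 assms pieces_same_level_far[of n v w w w] by auto
  next
    case 2
    have w: "w \<in> piece q r C m w"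
      using cube_subset_piece[of w m] cube_refl[of w "r m"] by blast
    then have "w \<in> piece q r C n v"
      using assms by blast
    then have "piece q r C n v \<subseteq> piece q r C m w"
      using piece_absorbs[OF 2 assms(1) w, of w] by auto
    then show ?thesis
      using assms by blast
  qed
qed

text \<open>Each absorption step is realised by a path inside the piece: from \<open>u\<close> to
  \<open>e\<close> in a cube around \<open>e\<close>, from \<open>e\<close> to \<open>e'\<close>
  through the lower piece, connected by induction, and from \<open>e'\<close> to \<open>z\<close> in
  a cube around \<open>e'\<close>. Both cubes belong to the piece by absorption.\<close>

lemma grid_connected_pieces: "grid_connected (piece q r C n v)"
proof (induction n arbitrary: v rule: less_induct)
  case (less n)
  let ?D = "piece q r C n v"
  let ?R = "\<lambda>a b. a \<in> ?D \<and> b \<in> ?D \<and> grid_adj a b"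
  have mono: "?R\<^sup>*\<^sup>* a b" if "grid_connected S" "S \<subseteq> ?D" "a \<in> S" "b \<in> S" for S a b
  proof -
    have "(\<lambda>a b. a \<in> S \<and> b \<in> S \<and> grid_adj a b)\<^sup>*\<^sup>* a b"
      using that by (auto simp: grid_connected_def)
    then show ?thesis
      by (rule rtranclp_mono[THEN predicate2D, rotated]) (use that in auto)
  qed
  have from_center: "?R\<^sup>*\<^sup>* v z" if "z \<in> ?D" for z
    using that[unfolded piece_def]
  proof (induction rule: thicken.induct)
    case (thicken_base u)
    then show ?case
      using mono[OF grid_connected_cube cube_subset_piece] by auto
  next
    case (thicken_step u E e e' z)
    obtain m w where E: "E = piece q r C m w" "m < n" "(m, w) \<in> C"
      using thicken_step.hyps by (auto simp: lower_eq)
    have u: "u \<in> ?D"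
      using thicken_step.hyps by (simp add: piece_def)
    have sub: "cube b (Suc q) \<subseteq> ?D" if "b \<in> E" for b
      using piece_absorbs[OF E(2,3) u _ thicken_step.hyps(4)] E(1) thicken_step.hyps(3) that by blast
    then have ED: "E \<subseteq> ?D"
      using cube_refl by blast
    have "?R\<^sup>*\<^sup>* u e"
      using thicken_step.hyps cube_mono[of q "Suc q" e] by (intro mono[OF grid_connected_cube sub]) auto
    also have "?R\<^sup>*\<^sup>* e e'"
      using less[OF E(2)] E(1) ED thicken_step.hyps by (intro mono[of E]) auto
    also have "?R\<^sup>*\<^sup>* e' z"
      using thicken_step.hyps by (intro mono[OF grid_connected_cube sub]) auto
    finally show ?case
      using thicken_step.IH by (meson rtranclp_trans)
  qed
  have sym: "?R\<^sup>*\<^sup>* a b \<Longrightarrow> ?R\<^sup>*\<^sup>* b a" for a b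
    by (rule sympD[OF symp_rtranclp]) (auto intro!: sympI grid_adj_sym)
  show ?case
    unfolding grid_connected_def
  proof (intro conjI ballI)
    show "?D \<noteq> {}"
      using cube_subset_piece[of v n] cube_refl[of v "r n"] by blast
    show "?R\<^sup>*\<^sup>* a b" if "a \<in> ?D" "b \<in> ?D" for a b
      using sym[OF from_center[OF that(1)]] from_center[OF that(2)] by (rule rtranclp_trans)
  qed
qed

lemma is_toast_pieces:
  assumes "\<And>g h. \<exists>n v. (n, v) \<in> C \<and> g \<in> cube v (r n) \<and> h \<in> cube v (r n)"
  shows "is_toast q (pieces q r C)"
  unfolding is_toast_def
proof (intro conjI ballI allI impI)
  fix D assume "D \<in> pieces q r C"
  then show "finite D" "grid_connected D"
    using finite_piece grid_connected_pieces by (auto simp: pieces_def)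
next
  fix g h
  obtain n v where "(n, v) \<in> C" "g \<in> cube v (r n)" "h \<in> cube v (r n)"
    using assms by blast
  then show "\<exists>D\<in>pieces q r C. g \<in> D \<and> h \<in> D"
    using cube_subset_piece[of v n] by (auto simp: pieces_def)
next
  fix D E
  assume "D \<in> pieces q r C" "E \<in> pieces q r C"
    "grid_setdist (grid_boundary D) (grid_boundary E) \<le> enat q"
  then show "D = E"
    by (rule pieces_separated)
qed

lemma confined_subset: "confined r C S \<subseteq> C"
  by (auto simp: confined_def)

end

section \<open>Recognising pieces from a finite window\<close>

lemma sparse_centers_subset:
  assumes "sparse_centers q r C" "C' \<subseteq> C"
  shows "sparse_centers q r C'"
proof -
  interpret sparse_centers q r C by fact
  show ?thesis
    using r_0 r_Suc sparse assms(2) by unfold_locales blast+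
qed

context sparse_centers
begin

text \<open>The displacements from \<open>v\<close> add up to
  \<open>2 * r n + q + 2 * r m + 5 * r m\<close>, which is at most \<open>3 * r n + q\<close>
  because \<open>7 * r m \<le> r n\<close>.\<close>

lemma lower_participant_confined:
  assumes "m < n" "cube v (5 * r n) \<subseteq> S" "u \<in> cube v (2 * r n)" "e \<in> cube w (2 * r m)" "u \<in> cube e q"
  shows "cube w (5 * r m) \<subseteq> S"
proof -
  have "e \<in> cube v (2 * r n + q)"
    using assms(3,5) cube_trans[of u v _ e q] by (auto simp: cube_sym)
  then have "w \<in> cube v (2 * r n + q + 2 * r m)"
    using assms(4) cube_trans[of e v _ w "2 * r m"] by (auto simp: cube_sym)
  then have "cube w (5 * r m) \<subseteq> cube v (5 * r n)"
    using cube_trans[of w v _ _ "5 * r m" "5 * r n"] r_less[OF assms(1)] r_ge_q[of n] by auto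
  then show ?thesis
    using assms(2) by blast
qed

text \<open>Discarding centers outside the window cannot alter this piece: every lower piece that
  takes part in an absorption has its own test cube in the window and is unchanged by induction on
  the level.\<close>

lemma piece_confined:
  assumes "cube v (5 * r n) \<subseteq> S"
  shows "piece q r (confined r C S) n v = piece q r C n v"
  using assms
proof (induction n arbitrary: v rule: less_induct)
  case (less n)
  interpret S: sparse_centers q r "confined r C S"
    using sparse_centers_axioms confined_subset by (rule sparse_centers_subset)
  show ?case
  proof (intro equalityI subsetI)
    fix z assume "z \<in> piece q r (confined r C S) n v"
    then show "z \<in> piece q r C n v"
      unfolding piece_def[of q r "confined r C S" n v]
    proof (induction rule: thicken.induct)
      case (thicken_base u)
      then show ?case by (simp add: piece_def thicken.thicken_base)
    next
      case (thicken_step u E e e' z)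
      then obtain m w where E: "E = piece q r (confined r C S) m w" "m < n" "(m, w) \<in> confined r C S"
        by (auto simp: lower_eq)
      then have "E = piece q r C m w" "(m, w) \<in> C"
        using less.IH[of m w] by (auto simp: confined_def)
      then show ?case
        using thicken_step piece_absorbs[of m n w u v e e' z] E(2) by blast
    qed
  next
    fix z assume "z \<in> piece q r C n v"
    then show "z \<in> piece q r (confined r C S) n v"
      unfolding piece_def[of q r C n v]
    proof (induction rule: thicken.induct)
      case (thicken_base u)
      then show ?case by (simp add: piece_def thicken.thicken_base)
    next
      case (thicken_step u E e e' z)
      then obtain m w where E: "E = piece q r C m w" "m < n" "(m, w) \<in> C"
        by (auto simp: lower_eq)
      have "u \<in> piece q r C n v"
        using thicken_step by (simp add: piece_def)
      then have "u \<in> cube v (2 * r n)" "e \<in> cube w (2 * r m)"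
        using thicken_step.hyps E piece_subset_cube by blast+
      then have w: "cube w (5 * r m) \<subseteq> S"
        using lower_participant_confined[OF E(2) less.prems] thicken_step.hyps by blast
      then have "E = piece q r (confined r C S) m w" "(m, w) \<in> confined r C S"
        using E less.IH[of m w] by (auto simp: confined_def)
      then show ?case
        using thicken_step S.piece_absorbs[of m n w u v e e' z] E(2) by blast
    qed
  qed
qed

lemma pieces_confined: "pieces q r (confined r C S) = {piece q r C n v |n v. (n, v) \<in> C \<and> cube v (5 * r n) \<subseteq> S}"
proof -
  have "piece q r (confined r C S) n v = piece q r C n v" if "(n, v) \<in> confined r C S" for n v
    using that by (intro piece_confined) (auto simp: confined_def)
  then have "pieces q r (confined r C S) = {piece q r C n v |n v. (n, v) \<in> confined r C S}"
    unfolding pieces_def by blast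
  then show ?thesis
    by (simp add: confined_def)
qed

text \<open>Ensures that the toast recursion below a visible piece runs through the same pieces
  whether it is given the window or the whole grid.\<close>

lemma pieces_confined_downward:
  assumes "D \<in> pieces q r (confined r C S)" "E \<in> pieces q r C" "E \<subset> D"
  shows "E \<in> pieces q r (confined r C S)"
proof -
  obtain n v where D: "D = piece q r C n v" "(n, v) \<in> C" "cube v (5 * r n) \<subseteq> S"
    using assms by (auto simp: pieces_confined)
  obtain m w where E: "E = piece q r C m w" "(m, w) \<in> C"
    using assms by (auto simp: pieces_def)
  have mn: "m < n"
    using strict_subset_piece D E assms by blast
  have "w \<in> E"
    using cube_subset_piece[of w m] cube_refl[of w "r m"] E by blast
  then have "w \<in> cube v (2 * r n)"
    using assms(3) D piece_subset_cube by blast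
  then have "cube w (5 * r m) \<subseteq> S"
    by (rule lower_participant_confined[OF mn D(3), of w w]) (auto simp: cube_def)
  then show ?thesis
    using E by (auto simp: pieces_confined)
qed

lemma pieces_confined_subset: "pieces q r (confined r C S) \<subseteq> pieces q r C"
  unfolding pieces_confined by (auto simp: pieces_def)

lemma Union_pieces_confined_subset: "D \<in> pieces q r (confined r C S) \<Longrightarrow> D \<subseteq> S"
  using piece_subset_cube cube_mono[of "2 * r n" "5 * r n" for n] unfolding pieces_confined by fastforce

end

section \<open>Translation equivariance of pieces\<close>

lemma cube_image: "cube (g + v) k = (+) g ` cube v k"
proof -
  have "w \<in> (+) g ` cube v k" if "w \<in> cube (g + v) k" for w
    using that cube_translate[of g "w - g" v k] by (intro image_eqI[of _ _ "w - g"]) auto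
  moreover have "g + u \<in> cube (g + v) k" if "u \<in> cube v k" for u
    using that by (simp only: cube_translate)
  ultimately show ?thesis
    by blast
qed

lemma thicken_translate: "thicken q ((`) ((+) g) ` L) ((+) g ` X) = (+) g ` thicken q L X"
proof (intro equalityI subsetI)
  fix z assume "z \<in> thicken q ((`) ((+) g) ` L) ((+) g ` X)"
  then show "z \<in> (+) g ` thicken q L X"
  proof induction
    case (thicken_base u)
    then show ?case by (auto intro: thicken.thicken_base)
  next
    case (thicken_step u E e e' z)
    then obtain u0 E0 e0 e0' where *: "u = g + u0" "u0 \<in> thicken q L X" "E0 \<in> L" "e = g + e0" "e0 \<in> E0"
        "e' = g + e0'" "e0' \<in> E0"
      by blast
    moreover have "u0 \<in> cube e0 q" "z - g \<in> cube e0' (Suc q)"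
      using thicken_step.hyps cube_translate[of g "z - g" e0' "Suc q"] * by (auto simp: cube_translate)
    ultimately have "z - g \<in> thicken q L X"
      by (blast intro: thicken.thicken_step)
    then show ?case
      by (intro image_eqI[of _ _ "z - g"]) auto
  qed
next
  fix z assume "z \<in> (+) g ` thicken q L X"
  then obtain z0 where z: "z = g + z0" and "z0 \<in> thicken q L X"
    by blast
  from this(2) show "z \<in> thicken q ((`) ((+) g) ` L) ((+) g ` X)"
    unfolding z
  proof (induction z0)
    case (thicken_base u)
    then show ?case by (auto intro: thicken.thicken_base)
  next
    case (thicken_step u E e e' z0)
    show ?case
      by (rule thicken.thicken_step[of "g + u" q _ _ "(+) g ` E" "g + e" "g + e'"])
        (use thicken_step in \<open>auto simp: cube_translate\<close>)
  qed
qed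

definition translate_centers :: "int ^ 'd::finite \<Rightarrow> (nat \<times> (int ^ 'd)) set \<Rightarrow> (nat \<times> (int ^ 'd)) set" where
  "translate_centers g C = (\<lambda>(n, v). (n, g + v)) ` C"

lemma lower_translate: "lower q r (translate_centers g C) n = (`) ((+) g) ` lower q r C n"
proof (induction n)
  case (Suc n)
  have "{v. (n, v) \<in> translate_centers g C} = (+) g ` {v. (n, v) \<in> C}"
    by (auto simp: translate_centers_def)
  then show ?case
    by (simp add: Suc image_Un image_image cube_image thicken_translate)
qed simp

lemma piece_translate: "piece q r (translate_centers g C) n (g + v) = (+) g ` piece q r C n v"
  by (simp add: piece_def lower_translate cube_image thicken_translate)

lemma pieces_translate:
  fixes g :: "int ^ 'd::finite"
  shows "pieces q r (translate_centers g C) = (`) ((+) g) ` pieces q r C"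
proof -
  have image_centers: "f ` translate_centers g C = (\<lambda>c. f (fst c, g + snd c)) ` C"
    for f :: "nat \<times> (int ^ 'd) \<Rightarrow> (int ^ 'd) set"
    by (simp add: translate_centers_def image_image case_prod_unfold)
  have "pieces q r C' = (\<lambda>c. piece q r C' (fst c) (snd c)) ` C'" for C' :: "(nat \<times> (int ^ 'd)) set"
    unfolding pieces_def by force
  then show ?thesis
    by (simp add: image_image case_prod_unfold image_centers flip: piece_translate)
qed

section \<open>Random labels and views\<close>

lemma space_unit_uniform [simp]: "space unit_uniform = {0..1}"
  by (simp add: unit_uniform_def space_restrict_space)

lemma prob_space_unit_uniform: "prob_space unit_uniform"
  unfolding unit_uniform_def by (rule prob_space_restrict_space) auto

lemma unit_uniform_less [measurable]: "{x \<in> space unit_uniform. x < p} \<in> sets unit_uniform"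
proof -
  have "{x \<in> space unit_uniform. x < p} = {0..1} \<inter> {..<p}"
    by auto
  then show ?thesis
    by (auto simp: unit_uniform_def sets_restrict_space)
qed

lemma measure_unit_uniform_less:
  assumes "0 \<le> p" "p \<le> 1"
  shows "measure unit_uniform {x \<in> space unit_uniform. x < p} = p"
proof -
  have "{x \<in> space unit_uniform. x < p} = {0..<p}"
    using assms by auto
  moreover have "measure unit_uniform {0..<p} = measure lborel {0..<p}"
    unfolding unit_uniform_def using assms by (intro measure_restrict_space) auto
  ultimately show ?thesis
    using assms by simp
qed

lemma space_random_labels: "space random_labels = {x. \<forall>v. x v \<in> {0..1}}"
  by (auto simp: random_labels_def space_PiM PiE_def Pi_def)

lemma prob_space_random_labels: "prob_space random_labels"
  unfolding random_labels_def by (rule prob_space_PiM) (rule prob_space_unit_uniform)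

text \<open>Finitely many measurable events cut the space into finitely many measurable atoms, and
  \<open>f\<close> is constant on each. This gives measurability into discrete spaces of any size,
  such as families of pieces.\<close>

lemma measurable_finite_pattern:
  assumes fin: "finite F" and P: "\<And>a. a \<in> F \<Longrightarrow> {y \<in> space M. P a y} \<in> sets M"
    and g: "\<And>y. y \<in> space M \<Longrightarrow> f y = g {a \<in> F. P a y}"
  shows "f \<in> M \<rightarrow>\<^sub>M count_space UNIV"
proof -
  have "(\<lambda>y. {a \<in> F. P a y}) \<in> M \<rightarrow>\<^sub>M count_space (Pow F)"
    unfolding measurable_count_space_eq2[OF finite_Pow_iff[THEN iffD2, OF fin]]
  proof (intro conjI ballI)
    fix T assume "T \<in> Pow F"
    then have "(\<lambda>y. {a \<in> F. P a y}) -` {T} \<inter> space M =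
        {y \<in> space M. \<forall>a\<in>F. if a \<in> T then P a y else \<not> P a y}"
      by (auto split: if_splits)
    also have "\<dots> \<in> sets M"
    proof (rule sets.sets_Collect_finite_All[OF _ fin])
      fix a assume "a \<in> F"
      then show "{y \<in> space M. if a \<in> T then P a y else \<not> P a y} \<in> sets M"
        using P[of a] by (cases "a \<in> T") (auto intro: sets.sets_Collect_neg)
    qed
    finally show "(\<lambda>y. {a \<in> F. P a y}) -` {T} \<inter> space M \<in> sets M" .
  qed auto
  then have "(\<lambda>y. g {a \<in> F. P a y}) \<in> M \<rightarrow>\<^sub>M count_space UNIV"
    by (rule measurable_compose) simp
  then show ?thesis
    by (subst measurable_cong[OF g])
qed

text \<open>A partial map is recovered from its graph, here a subset of the finite set
  \<open>A \<times> O'\<close>; membership of a pair in the graph is the event of the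
  pattern.\<close>

lemma measurable_finite_map:
  assumes "finite A" "finite O'"
    and dom: "\<And>x. x \<in> space M \<Longrightarrow> dom (f x) \<subseteq> A" and ran: "\<And>x. x \<in> space M \<Longrightarrow> ran (f x) \<subseteq> O'"
    and meas: "\<And>v b. v \<in> A \<Longrightarrow> b \<in> O' \<Longrightarrow> {x \<in> space M. f x v = Some b} \<in> sets M"
  shows "f \<in> M \<rightarrow>\<^sub>M count_space UNIV"
proof (rule measurable_finite_pattern[where F = "A \<times> O'" and P = "\<lambda>a x. f x (fst a) = Some (snd a)"
      and g = "\<lambda>S v. if \<exists>b. (v, b) \<in> S then Some (THE b. (v, b) \<in> S) else None"])
  fix x assume x: "x \<in> space M"
  show "f x = (\<lambda>v. if \<exists>b. (v, b) \<in> {a \<in> A \<times> O'. f x (fst a) = Some (snd a)}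
      then Some (THE b. (v, b) \<in> {a \<in> A \<times> O'. f x (fst a) = Some (snd a)}) else None)"
  proof
    fix v
    show "f x v = (if \<exists>b. (v, b) \<in> {a \<in> A \<times> O'. f x (fst a) = Some (snd a)}
      then Some (THE b. (v, b) \<in> {a \<in> A \<times> O'. f x (fst a) = Some (snd a)}) else None)"
    proof (cases "f x v")
      case (Some b)
      then have "v \<in> A" "b \<in> O'"
        using dom[OF x] ran[OF x] by (auto intro: ranI)
      moreover from this have "(THE b. (v, b) \<in> {a \<in> A \<times> O'. f x (fst a) = Some (snd a)}) = b"
        using Some by (intro the_equality) auto
      ultimately show ?thesis
        using Some by auto
    next
      case None
      then show ?thesis by auto
    qed
  qed
qed (use assms in auto)

lemma measurable_view:
  assumes "\<And>u. u \<in> grid_ball v r \<Longrightarrow> \<sigma> u \<in> I" "grid_ball v r \<subseteq> A"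
  shows "(\<lambda>x. view (\<lambda>u. (\<sigma> u, x u)) v r) \<in> PiM A (\<lambda>_. unit_uniform) \<rightarrow>\<^sub>M nbhd_space I r"
  unfolding view_def nbhd_space_def
proof (rule measurable_restrict)
  fix u :: "int ^ 'a" assume "u \<in> grid_ball 0 r"
  then have u: "v + u \<in> grid_ball v r"
    by (simp add: grid_ball_translate_0)
  have "(\<lambda>x. x (v + u)) \<in> PiM A (\<lambda>_. unit_uniform) \<rightarrow>\<^sub>M unit_uniform"
    using u assms(2) by (intro measurable_component_singleton) auto
  moreover have "(\<lambda>x. \<sigma> (v + u)) \<in> PiM A (\<lambda>_. unit_uniform) \<rightarrow>\<^sub>M count_space I"
    using u assms(1) by (intro measurable_const) auto
  ultimately show "(\<lambda>x. (\<sigma> (v + u), x (v + u))) \<in> PiM A (\<lambda>_. unit_uniform) \<rightarrow>\<^sub>M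
      count_space I \<Otimes>\<^sub>M unit_uniform"
    by (rule measurable_Pair[rotated])
qed

lemma view_cong:
  assumes "\<And>u. u \<in> grid_ball v r \<Longrightarrow> l u = l' u"
  shows "view l v r = view l' v r"
  unfolding view_def using assms by (auto simp: restrict_def fun_eq_iff grid_ball_translate_0)

lemma view_translate:
  assumes "\<And>u. u \<in> grid_ball v r \<Longrightarrow> l' (g + u) = l u"
  shows "view l' (g + v) r = view l v r"
  unfolding view_def using assms[of "v + u" for u]
  by (auto simp: restrict_def fun_eq_iff grid_ball_translate_0 add.assoc)

text \<open>With this predicate the infimum in \<open>coding_radius\<close> becomes a
  \<open>LEAST\<close> over natural numbers.\<close>

definition stops_at ::
    "('d::finite, 'i, 'o) local_algorithm \<Rightarrow> (int ^ 'd \<Rightarrow> 'i) \<Rightarrow> (int ^ 'd \<Rightarrow> real) \<Rightarrow> int ^ 'd \<Rightarrow> nat \<Rightarrow> bool" where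
  "stops_at \<A> \<sigma> x v r \<longleftrightarrow> view (\<lambda>u. (\<sigma> u, x u)) v r \<in> stops \<A> r"

lemma stops_at_cong:
  assumes "\<And>u. u \<in> grid_ball v r \<Longrightarrow> \<sigma> u = \<sigma>' u \<and> x u = x' u"
  shows "stops_at \<A> \<sigma> x v r \<longleftrightarrow> stops_at \<A> \<sigma>' x' v r"
  unfolding stops_at_def using assms
  by (subst view_cong[of v r _ "\<lambda>u. (\<sigma>' u, x' u)"]) auto

lemma coding_radius_greater:
  "enat r < coding_radius \<A> \<sigma> x v \<longleftrightarrow> (\<forall>k\<le>r. \<not> stops_at \<A> \<sigma> x v k)"
proof
  assume less: "enat r < coding_radius \<A> \<sigma> x v"
  show "\<forall>k\<le>r. \<not> stops_at \<A> \<sigma> x v k"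
  proof (intro allI impI notI)
    fix k assume k: "k \<le> r" "stops_at \<A> \<sigma> x v k"
    then have "coding_radius \<A> \<sigma> x v \<le> enat k"
      unfolding coding_radius_def by (intro INF_lower) (simp add: stops_at_def)
    also have "\<dots> \<le> enat r"
      using k by simp
    finally show False
      using less by simp
  qed
next
  assume *: "\<forall>k\<le>r. \<not> stops_at \<A> \<sigma> x v k"
  have "enat (Suc r) \<le> coding_radius \<A> \<sigma> x v"
    unfolding coding_radius_def
    using * by (intro INF_greatest) (auto simp: stops_at_def not_le[symmetric] Suc_le_eq intro: ccontr)
  then show "enat r < coding_radius \<A> \<sigma> x v"
    by (metis Suc_ile_eq)
qed

lemma coding_radius_eq_infinity: "coding_radius \<A> \<sigma> x v = \<infinity> \<longleftrightarrow> (\<nexists>r. stops_at \<A> \<sigma> x v r)"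
  by (metis coding_radius_greater less_enatE not_less_iff_gr_or_eq order_refl not_infinity_eq)

lemma coding_radius_eq_Least:
  assumes "stops_at \<A> \<sigma> x v r"
  shows "coding_radius \<A> \<sigma> x v = enat (LEAST r. stops_at \<A> \<sigma> x v r)"
proof (rule antisym)
  have "stops_at \<A> \<sigma> x v (LEAST r. stops_at \<A> \<sigma> x v r)"
    using assms by (rule LeastI)
  then show "coding_radius \<A> \<sigma> x v \<le> enat (LEAST r. stops_at \<A> \<sigma> x v r)"
    unfolding coding_radius_def by (intro INF_lower) (simp add: stops_at_def)
  show "enat (LEAST r. stops_at \<A> \<sigma> x v r) \<le> coding_radius \<A> \<sigma> x v"
    unfolding coding_radius_def by (intro INF_greatest) (auto simp: stops_at_def intro: Least_le)
qed

lemma local_output_eq_Least: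
  assumes "stops_at \<A> \<sigma> x v r"
  shows "local_output \<A> \<sigma> x v =
    out_fun \<A> (LEAST r. stops_at \<A> \<sigma> x v r) (view (\<lambda>u. (\<sigma> u, x u)) v (LEAST r. stops_at \<A> \<sigma> x v r))"
  by (simp add: local_output_def coding_radius_eq_Least[OF assms] Let_def)

section \<open>Unions of partial maps\<close>

lemma map_Union_SomeD:
  assumes "map_Union M a = Some b"
  shows "\<exists>m\<in>M. m a = Some b"
proof -
  have "\<exists>!b. \<exists>m\<in>M. m a = Some b" "b = (THE b. \<exists>m\<in>M. m a = Some b)"
    using assms by (auto simp: map_Union_def split: if_splits)
  then show ?thesis
    using theI'[of "\<lambda>b. \<exists>m\<in>M. m a = Some b"] by blast
qed

text \<open>A value of \<open>map_Union M\<close> is attained by some member, and that member lies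
  below \<open>f\<close>.\<close>

lemma map_Union_le:
  assumes "\<And>m. m \<in> M \<Longrightarrow> m \<subseteq>\<^sub>m f"
  shows "map_Union M \<subseteq>\<^sub>m f"
  unfolding map_le_def
proof
  fix a assume "a \<in> dom (map_Union M)"
  then obtain b where b: "map_Union M a = Some b"
    by blast
  then obtain m where "m \<in> M" "m a = Some b"
    using map_Union_SomeD by fast
  then show "map_Union M a = f a"
    using assms[of m] b by (auto simp: map_le_def dom_def)
qed

lemma dom_map_Union: "dom (map_Union M) \<subseteq> (\<Union>m\<in>M. dom m)"
  by (auto dest!: map_Union_SomeD)

lemma ran_map_Union: "ran (map_Union M) \<subseteq> (\<Union>m\<in>M. ran m)"
  by (auto simp: ran_def dest!: map_Union_SomeD)

section \<open>From local algorithms to toast algorithms\<close>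

text \<open>A vertex is coloured in the first piece that contains the ball which it has to explore.\<close>

definition local_toast :: "('d::finite, 'i, 'o) local_algorithm \<Rightarrow> ('d, 'i, 'o) toast_algorithm" where
  "local_toast \<A> A \<sigma> x c = (\<lambda>v.
     if c v = None \<and> v \<in> A \<and> (\<exists>r. grid_ball v r \<subseteq> A \<and> stops_at \<A> \<sigma> x v r)
     then Some (local_output \<A> \<sigma> x v) else c v)"

lemma stops_at_translate:
  assumes "\<And>u. u \<in> grid_ball v r \<Longrightarrow> \<sigma>' (g + u) = \<sigma> u \<and> x' (g + u) = x u"
  shows "stops_at \<A> \<sigma>' x' (g + v) r \<longleftrightarrow> stops_at \<A> \<sigma> x v r"
  unfolding stops_at_def using assms
  by (subst view_translate[of v r _ _ "\<lambda>u. (\<sigma> u, x u)"]) auto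

text \<open>Agreement on one ball at whose radius the algorithm stops is enough: the least stopping
  radius is no larger, so both it and its view are determined inside that ball.\<close>

lemma local_output_translate:
  assumes "stops_at \<A> \<sigma> x v r"
    and eq: "\<And>u. u \<in> grid_ball v r \<Longrightarrow> \<sigma>' (g + u) = \<sigma> u \<and> x' (g + u) = x u"
  shows "local_output \<A> \<sigma>' x' (g + v) = local_output \<A> \<sigma> x v"
proof -
  have eq': "stops_at \<A> \<sigma>' x' (g + v) k \<longleftrightarrow> stops_at \<A> \<sigma> x v k" if "k \<le> r" for k
    using grid_ball_mono[OF that] eq by (intro stops_at_translate) blast
  let ?L = "LEAST r. stops_at \<A> \<sigma> x v r"
  have L: "?L \<le> r"
    using assms(1) by (rule Least_le)
  have "(LEAST r. stops_at \<A> \<sigma>' x' (g + v) r) = ?L"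
  proof (rule Least_equality)
    show "stops_at \<A> \<sigma>' x' (g + v) ?L"
      using eq'[OF L] assms(1) by (auto intro: LeastI)
    show "?L \<le> k" if "stops_at \<A> \<sigma>' x' (g + v) k" for k
      using that eq'[of k] L by (cases "k \<le> r") (auto intro: Least_le)
  qed
  moreover have "view (\<lambda>u. (\<sigma>' u, x' u)) (g + v) ?L = view (\<lambda>u. (\<sigma> u, x u)) v ?L"
    using grid_ball_mono[OF L] eq by (intro view_translate) auto
  moreover have "stops_at \<A> \<sigma>' x' (g + v) r"
    using eq' assms(1) by simp
  ultimately show ?thesis
    using assms(1) by (simp add: local_output_eq_Least)
qed

lemma local_output_cong:
  assumes "stops_at \<A> \<sigma> x v r"
    and "\<And>u. u \<in> grid_ball v r \<Longrightarrow> \<sigma>' u = \<sigma> u \<and> x' u = x u"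
  shows "local_output \<A> \<sigma>' x' v = local_output \<A> \<sigma> x v"
  using local_output_translate[of \<A> \<sigma> x v r \<sigma>' 0 x'] assms by simp

lemma view_in_space:
  assumes "\<And>u. u \<in> grid_ball v r \<Longrightarrow> \<sigma> u \<in> I" "\<And>u. u \<in> grid_ball v r \<Longrightarrow> x u \<in> {0..1}"
  shows "view (\<lambda>u. (\<sigma> u, x u)) v r \<in> space (nbhd_space I r)"
  using assms by (force simp: view_def nbhd_space_def space_PiM space_pair_measure grid_ball_translate_0)

lemma out_fun_in:
  assumes "is_local_algorithm \<P> \<A>" "stops_at \<A> \<sigma> x v r"
  shows "out_fun \<A> r (view (\<lambda>u. (\<sigma> u, x u)) v r) \<in> out_labels \<P>"
proof -
  have "stops \<A> r \<in> sets (nbhd_space (in_labels \<P>) r)"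
    and "out_fun \<A> r \<in> restrict_space (nbhd_space (in_labels \<P>) r) (stops \<A> r) \<rightarrow>\<^sub>M count_space (out_labels \<P>)"
    using assms(1) by (auto simp: is_local_algorithm_def)
  then have "out_fun \<A> r y \<in> out_labels \<P>" if "y \<in> stops \<A> r" for y
    using measurable_space[of "out_fun \<A> r" _ "count_space (out_labels \<P>)" y] that sets.sets_into_space[of "stops \<A> r"]
    by (auto simp: space_restrict_space)
  then show ?thesis
    using assms(2) by (simp add: stops_at_def)
qed

lemma local_output_in:
  assumes "is_local_algorithm \<P> \<A>" "stops_at \<A> \<sigma> x v r"
  shows "local_output \<A> \<sigma> x v \<in> out_labels \<P>"
  unfolding local_output_eq_Least[OF assms(2)]
  using assms(1) by (rule out_fun_in) (rule LeastI, rule assms(2))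

lemma sets_stops_at:
  assumes "is_local_algorithm \<P> \<A>" "grid_ball v r \<subseteq> A" "\<And>u. u \<in> grid_ball v r \<Longrightarrow> \<sigma> u \<in> in_labels \<P>"
  shows "{x \<in> space (PiM A (\<lambda>_. unit_uniform)). stops_at \<A> \<sigma> x v r} \<in> sets (PiM A (\<lambda>_. unit_uniform))"
proof -
  have "stops \<A> r \<in> sets (nbhd_space (in_labels \<P>) r)"
    using assms(1) by (auto simp: is_local_algorithm_def)
  from measurable_sets[OF measurable_view[OF assms(3,2)] this]
  show ?thesis
    by (simp add: stops_at_def vimage_def Int_def conj_commute)
qed

lemma sets_out_fun:
  assumes "is_local_algorithm \<P> \<A>" "grid_ball v r \<subseteq> A" "\<And>u. u \<in> grid_ball v r \<Longrightarrow> \<sigma> u \<in> in_labels \<P>"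
  shows "{x \<in> space (PiM A (\<lambda>_. unit_uniform)). stops_at \<A> \<sigma> x v r \<and>
      out_fun \<A> r (view (\<lambda>u. (\<sigma> u, x u)) v r) = b} \<in> sets (PiM A (\<lambda>_. unit_uniform))"
proof -
  let ?N = "nbhd_space (in_labels \<P>) r"
  have stops: "stops \<A> r \<in> sets ?N"
    and out: "out_fun \<A> r \<in> restrict_space ?N (stops \<A> r) \<rightarrow>\<^sub>M count_space (out_labels \<P>)"
    using assms(1) by (auto simp: is_local_algorithm_def)
  have "out_fun \<A> r -` ({b} \<inter> out_labels \<P>) \<inter> space (restrict_space ?N (stops \<A> r)) \<in> sets (restrict_space ?N (stops \<A> r))"
    using out by (rule measurable_sets) auto
  then have "out_fun \<A> r -` ({b} \<inter> out_labels \<P>) \<inter> stops \<A> r \<in> sets ?N"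
    using stops sets.sets_into_space[OF stops]
    by (subst (asm) sets_restrict_space_iff) (auto simp: space_restrict_space Int_absorb2 Int_absorb1)
  from measurable_sets[OF measurable_view[OF assms(3,2)] this]
  have "{x \<in> space (PiM A (\<lambda>_. unit_uniform)). stops_at \<A> \<sigma> x v r \<and>
      out_fun \<A> r (view (\<lambda>u. (\<sigma> u, x u)) v r) \<in> {b} \<inter> out_labels \<P>} \<in> sets (PiM A (\<lambda>_. unit_uniform))"
    by (simp add: stops_at_def vimage_def Int_def conj_commute conj_left_commute)
  moreover have "(out_fun \<A> r (view (\<lambda>u. (\<sigma> u, x u)) v r) \<in> {b} \<inter> out_labels \<P>) =
      (out_fun \<A> r (view (\<lambda>u. (\<sigma> u, x u)) v r) = b)" if "stops_at \<A> \<sigma> x v r" for x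
    using out_fun_in[OF assms(1) that] by auto
  ultimately show ?thesis
    by (simp cong: conj_cong)
qed

text \<open>The event is split by the first stopping radius, a countable union. The ball of that
  radius lies in \<open>A\<close> since it is contained in the given one, so every part reads only
  labels of \<open>A\<close>.\<close>

lemma sets_local_output:
  assumes "is_local_algorithm \<P> \<A>" "\<And>u. u \<in> A \<Longrightarrow> \<sigma> u \<in> in_labels \<P>"
  shows "{x \<in> space (PiM A (\<lambda>_. unit_uniform)). (\<exists>r. grid_ball v r \<subseteq> A \<and> stops_at \<A> \<sigma> x v r) \<and>
      local_output \<A> \<sigma> x v = b} \<in> sets (PiM A (\<lambda>_. unit_uniform))"
    (is "{x \<in> space ?M. ?P x} \<in> sets ?M")
proof -
  let ?first = "\<lambda>r x. stops_at \<A> \<sigma> x v r \<and> (\<forall>k<r. \<not> stops_at \<A> \<sigma> x v k)"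
  have "?P x \<longleftrightarrow> (\<exists>r. grid_ball v r \<subseteq> A \<and> ?first r x \<and> out_fun \<A> r (view (\<lambda>u. (\<sigma> u, x u)) v r) = b)"
    (is "?lhs \<longleftrightarrow> ?rhs") for x
  proof -
    have least: "(LEAST r. stops_at \<A> \<sigma> x v r) = r" if "?first r x" for r
      using that by (intro Least_equality) (auto simp: not_less[symmetric])
    have first: "?first (LEAST r. stops_at \<A> \<sigma> x v r) x" if "stops_at \<A> \<sigma> x v r" for r
      using that by (auto intro: LeastI dest: not_less_Least)
    have ball: "grid_ball v (LEAST r. stops_at \<A> \<sigma> x v r) \<subseteq> A"
      if "stops_at \<A> \<sigma> x v r" "grid_ball v r \<subseteq> A" for r
      using grid_ball_mono[OF Least_le, of "stops_at \<A> \<sigma> x v" r v] that by blast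
    show ?thesis
    proof
      assume *: ?lhs
      then obtain r where r: "stops_at \<A> \<sigma> x v r" "grid_ball v r \<subseteq> A"
        by blast
      have "out_fun \<A> (LEAST r. stops_at \<A> \<sigma> x v r)
          (view (\<lambda>u. (\<sigma> u, x u)) v (LEAST r. stops_at \<A> \<sigma> x v r)) = b"
        using local_output_eq_Least[OF r(1)] conjunct2[OF *] by (rule trans[OF sym])
      with first[OF r(1)] ball[OF r] show ?rhs
        by blast
    next
      assume ?rhs
      then obtain r where r: "grid_ball v r \<subseteq> A" "?first r x"
          "out_fun \<A> r (view (\<lambda>u. (\<sigma> u, x u)) v r) = b"
        by blast
      then have "local_output \<A> \<sigma> x v = b"
        using least[OF r(2)] local_output_eq_Least[of \<A> \<sigma> x v r] by simp
      with r show ?lhs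
        by blast
    qed
  qed
  then have "{x \<in> space ?M. ?P x} = (\<Union>r\<in>{r. grid_ball v r \<subseteq> A}. {x \<in> space ?M. stops_at \<A> \<sigma> x v r \<and>
      out_fun \<A> r (view (\<lambda>u. (\<sigma> u, x u)) v r) = b} \<inter> {x \<in> space ?M. \<forall>k\<in>{..<r}. \<not> stops_at \<A> \<sigma> x v k})"
    by auto
  also have "\<dots> \<in> sets ?M"
  proof (intro sets.countable_UN'' sets.Int)
    fix r assume r: "r \<in> {r. grid_ball v r \<subseteq> A}"
    show "{x \<in> space ?M. stops_at \<A> \<sigma> x v r \<and> out_fun \<A> r (view (\<lambda>u. (\<sigma> u, x u)) v r) = b} \<in> sets ?M"
      using r assms by (intro sets_out_fun) auto
    show "{x \<in> space ?M. \<forall>k\<in>{..<r}. \<not> stops_at \<A> \<sigma> x v k} \<in> sets ?M"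
    proof (intro sets.sets_Collect_finite_All sets.sets_Collect_neg)
      fix k assume "k \<in> {..<r}"
      then have "grid_ball v k \<subseteq> A"
        using r grid_ball_mono[of k r v] by auto
      then show "{x \<in> space ?M. stops_at \<A> \<sigma> x v k} \<in> sets ?M"
        using assms by (intro sets_stops_at) auto
    qed auto
  qed auto
  finally show ?thesis .
qed

lemma is_toast_algorithm_local_toast:
  assumes lcl: "is_lcl \<P>" and alg: "is_local_algorithm \<P> \<A>"
  shows "is_toast_algorithm \<P> (local_toast \<A>)"
  unfolding is_toast_algorithm_def
proof (intro conjI allI impI ballI)
  fix A \<sigma> c x
  assume "toast_input \<P> A \<sigma> c"
  then have dom: "dom c \<subseteq> A" and ran: "ran c \<subseteq> out_labels \<P>"
    by (auto simp: toast_input_def)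
  show "c \<subseteq>\<^sub>m local_toast \<A> A \<sigma> x c"
    by (auto simp: map_le_def local_toast_def)
  show "dom (local_toast \<A> A \<sigma> x c) \<subseteq> A"
    using dom by (auto simp: local_toast_def dom_def subset_iff split: if_splits)
  show "ran (local_toast \<A> A \<sigma> x c) \<subseteq> out_labels \<P>"
    using ran local_output_in[OF alg]
    by (auto simp: local_toast_def ran_def split: if_splits)
next
  fix A \<sigma> and c :: "int ^ 'a \<rightharpoonup> 'c"
  assume inp: "toast_input \<P> A \<sigma> c"
  then have dom: "dom c \<subseteq> A" and ran: "ran c \<subseteq> out_labels \<P>" and fin: "finite A"
    and \<sigma>: "\<And>u. u \<in> A \<Longrightarrow> \<sigma> u \<in> in_labels \<P>"
    by (auto simp: toast_input_def)
  show "(\<lambda>x. local_toast \<A> A \<sigma> x c) \<in> PiM A (\<lambda>_. unit_uniform) \<rightarrow>\<^sub>M count_space UNIV"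
  proof (rule measurable_finite_map[where A = A and O' = "out_labels \<P>"])
    show "finite (out_labels \<P>)"
      using lcl by (simp add: is_lcl_def)
    show "dom (local_toast \<A> A \<sigma> x c) \<subseteq> A" for x
      using dom by (auto simp: local_toast_def dom_def subset_iff split: if_splits)
    show "ran (local_toast \<A> A \<sigma> x c) \<subseteq> out_labels \<P>" for x
      using ran local_output_in[OF alg]
      by (auto simp: local_toast_def ran_def split: if_splits)
    fix v b assume v: "v \<in> A"
    show "{x \<in> space (PiM A (\<lambda>_. unit_uniform)). local_toast \<A> A \<sigma> x c v = Some b}
        \<in> sets (PiM A (\<lambda>_. unit_uniform))"
    proof (cases "c v")
      case None
      then have "local_toast \<A> A \<sigma> x c v = Some b \<longleftrightarrow>
          (\<exists>r. grid_ball v r \<subseteq> A \<and> stops_at \<A> \<sigma> x v r) \<and> local_output \<A> \<sigma> x v = b" for x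
        using v by (auto simp: local_toast_def)
      then show ?thesis
        using sets_local_output[OF alg \<sigma>] by simp
    next
      case (Some b')
      then have "local_toast \<A> A \<sigma> x c v = Some b'" for x
        by (simp add: local_toast_def)
      then show ?thesis by (cases "b = b'") auto
    qed
  qed (rule fin)
next
  fix A \<sigma> c B \<sigma>' and c' :: "int ^ 'a \<rightharpoonup> 'c" and \<phi> and x x' :: "int ^ 'a \<Rightarrow> real" and a
  assume inp: "toast_input \<P> A \<sigma> c \<and> toast_input \<P> B \<sigma>' c' \<and> grid_iso \<phi> A B"
    and eq: "\<forall>a\<in>A. \<sigma>' (\<phi> a) = \<sigma> a \<and> x' (\<phi> a) = x a \<and> c' (\<phi> a) = c a" and a: "a \<in> A"
  \<comment> \<open>Isomorphisms of connected sets are translations, which reduces invariance to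
    \<open>stops_at_translate\<close> and \<open>local_output_translate\<close>.\<close>
  then obtain g where g: "\<And>a. a \<in> A \<Longrightarrow> \<phi> a = g + a"
    using grid_iso_translation[of \<phi> A B] by (auto simp: toast_input_def)
  have B: "B = (+) g ` A"
    using inp g by (auto simp: grid_iso_def bij_betw_def)
  have ball: "grid_ball (g + a) r \<subseteq> B \<longleftrightarrow> grid_ball a r \<subseteq> A" for r
    unfolding B grid_ball_image[of "g + a"] grid_ball_image[of a]
    by (auto simp: add.assoc image_iff subset_iff)
  have eq': "\<sigma>' (g + u) = \<sigma> u \<and> x' (g + u) = x u" if "u \<in> grid_ball a r" "grid_ball a r \<subseteq> A" for u r
  proof -
    have "u \<in> A"
      using that by blast
    then show ?thesis
      using bspec[OF eq, of u] g[of u] by simp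
  qed
  have stops: "stops_at \<A> \<sigma>' x' (g + a) r \<longleftrightarrow> stops_at \<A> \<sigma> x a r" if "grid_ball a r \<subseteq> A" for r
    using that eq' by (intro stops_at_translate)
  have "c' (g + a) = c a" "g + a \<in> B"
    using a g eq B by auto
  moreover have "local_output \<A> \<sigma>' x' (g + a) = local_output \<A> \<sigma> x a"
    if "grid_ball a r \<subseteq> A" "stops_at \<A> \<sigma> x a r" for r
    using that eq' by (intro local_output_translate[of _ _ _ _ r]) auto
  ultimately show "local_toast \<A> B \<sigma>' x' c' (\<phi> a) = local_toast \<A> A \<sigma> x c a"
    using a g[OF a] ball stops by (auto simp: local_toast_def)
qed

text \<open>All pieces write values of one total function, so they cannot contradict each other,
  nested or not. A vertex is coloured only when its ball lies in \<open>D\<close>, where the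
  restricted labels are the true ones.\<close>

lemma toast_output_local_toast_le:
  "finite D \<Longrightarrow> toast_output (local_toast \<A>) \<sigma> x \<D> D \<subseteq>\<^sub>m (\<lambda>v. Some (local_output \<A> \<sigma> x v))"
proof (induction D rule: finite_psubset_induct)
  case (psubset D)
  have "map_Union (toast_output (local_toast \<A>) \<sigma> x \<D> ` {E \<in> \<D>. E \<subset> D \<and> finite D})
      \<subseteq>\<^sub>m (\<lambda>v. Some (local_output \<A> \<sigma> x v))" (is "?c \<subseteq>\<^sub>m _")
    using psubset.IH by (intro map_Union_le) blast
  then have c: "?c v = Some b \<Longrightarrow> b = local_output \<A> \<sigma> x v" for v b
    by (force simp: map_le_def dom_def)
  have "local_output \<A> (restrict \<sigma> D) (restrict x D) v = local_output \<A> \<sigma> x v"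
    if "grid_ball v r \<subseteq> D" "stops_at \<A> (restrict \<sigma> D) (restrict x D) v r" for v r
    using that by (intro local_output_cong[symmetric, of _ _ _ _ r]) auto
  with c show ?case
    unfolding toast_output.simps[of _ _ _ _ D]
    by (auto simp: map_le_def local_toast_def split: if_splits)
qed

text \<open>The vertex is coloured now or was coloured by a smaller piece; in both cases
  \<open>toast_output_local_toast_le\<close> fixes the value.\<close>

lemma toast_output_local_toast:
  assumes "finite D" "grid_ball v r \<subseteq> D" "stops_at \<A> \<sigma> x v r"
  shows "toast_output (local_toast \<A>) \<sigma> x \<D> D v = Some (local_output \<A> \<sigma> x v)"
proof -
  have "stops_at \<A> (restrict \<sigma> D) (restrict x D) v r"
    using assms by (subst stops_at_cong[of v r _ \<sigma> _ x]) auto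
  moreover have "v \<in> D"
    using assms(2) center_in_grid_ball by blast
  ultimately have "v \<in> dom (toast_output (local_toast \<A>) \<sigma> x \<D> D)"
    using assms(2) unfolding toast_output.simps[of _ _ _ _ D] by (auto simp: local_toast_def)
  then show ?thesis
    using toast_output_local_toast_le[OF assms(1)] by (force simp: map_le_def)
qed

lemma ffiid_imp_lazy_rtoast:
  assumes "\<P> \<in> ffiid"
  shows "\<P> \<in> lazy_rtoast"
proof -
  obtain \<A> where lcl: "is_lcl \<P>" and alg: "is_local_algorithm \<P> \<A>" and solves: "local_solves \<P> \<A>"
    using assms by (auto simp: ffiid_def)
  \<comment> \<open>Any positive separation could be taken in place of 1, since
    \<open>toast_piece_contains_ball\<close> holds for every \<open>q\<close>.\<close>
  have "AE x in random_labels. \<forall>\<D>. is_toast 1 \<D> \<longrightarrow>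
      (\<exists>\<tau>. toast_result (local_toast \<A>) \<sigma> x \<D> = {(v, \<tau> v) |v. True} \<and> is_coloring \<P> \<sigma> \<tau>)"
    if "range \<sigma> \<subseteq> in_labels \<P>" for \<sigma>
  proof -
    have "AE x in random_labels. (\<forall>v. coding_radius \<A> \<sigma> x v \<noteq> \<infinity>) \<and> is_coloring \<P> \<sigma> (local_output \<A> \<sigma> x)"
      using solves that by (simp add: local_solves_def)
    then show ?thesis
    proof (rule AE_mp, intro AE_I2 impI allI)
      fix x and \<D> :: "(int ^ 'a) set set"
      assume x: "(\<forall>v. coding_radius \<A> \<sigma> x v \<noteq> \<infinity>) \<and> is_coloring \<P> \<sigma> (local_output \<A> \<sigma> x)"
        and toast: "is_toast 1 \<D>"
      have "toast_result (local_toast \<A>) \<sigma> x \<D> = {(v, local_output \<A> \<sigma> x v) |v. True}"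
      proof (intro equalityI subsetI)
        fix p assume "p \<in> toast_result (local_toast \<A>) \<sigma> x \<D>"
        then obtain D v b where "D \<in> \<D>" "p = (v, b)" "toast_output (local_toast \<A>) \<sigma> x \<D> D v = Some b"
          by (auto simp: toast_result_def Map.graph_def)
        moreover from this have "finite D"
          using toast by (auto simp: is_toast_def)
        ultimately show "p \<in> {(v, local_output \<A> \<sigma> x v) |v. True}"
          using toast_output_local_toast_le[of D \<A> \<sigma> x \<D>] by (force simp: map_le_def dom_def)
      next
        fix p assume "p \<in> {(v, local_output \<A> \<sigma> x v) |v. True}"
        then obtain v where p: "p = (v, local_output \<A> \<sigma> x v)"
          by blast
        obtain r where r: "stops_at \<A> \<sigma> x v r"
          using x by (auto simp: coding_radius_eq_infinity)
        obtain D where D: "D \<in> \<D>" "grid_ball v r \<subseteq> D"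
          using toast_piece_contains_ball[OF toast] by blast
        then have "finite D"
          using toast by (auto simp: is_toast_def)
        from toast_output_local_toast[OF this D(2) r]
        show "p \<in> toast_result (local_toast \<A>) \<sigma> x \<D>"
          using D(1) p by (auto simp: toast_result_def Map.graph_def)
      qed
      with x show "\<exists>\<tau>. toast_result (local_toast \<A>) \<sigma> x \<D> = {(v, \<tau> v) |v. True} \<and> is_coloring \<P> \<sigma> \<tau>"
        by blast
    qed
  qed
  then show ?thesis
    unfolding lazy_rtoast_def using lcl is_toast_algorithm_local_toast[OF lcl alg] zero_less_one by blast
qed

section \<open>Equivariance, locality and measurability of toast outputs\<close>

text \<open>The two families are compared only strictly below \<open>D\<close>; thereby visible
  pieces can stand in for the whole toast.\<close>

lemma toast_output_cong:
  assumes "finite D" "\<And>u. u \<in> D \<Longrightarrow> \<sigma> u = \<sigma>' u \<and> x u = x' u" "\<And>E. E \<subset> D \<Longrightarrow> E \<in> \<D> \<longleftrightarrow> E \<in> \<D>'"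
  shows "toast_output \<A> \<sigma> x \<D> D = toast_output \<A> \<sigma>' x' \<D>' D"
  using assms
proof (induction D rule: finite_psubset_induct)
  case (psubset D)
  have "toast_output \<A> \<sigma> x \<D> E = toast_output \<A> \<sigma>' x' \<D>' E" if "E \<subset> D" for E
    using psubset.prems that by (intro psubset.IH) auto
  then have "toast_output \<A> \<sigma> x \<D> ` {E \<in> \<D>. E \<subset> D \<and> finite D} =
      toast_output \<A> \<sigma>' x' \<D>' ` {E \<in> \<D>'. E \<subset> D \<and> finite D}"
    using psubset.prems(2) by (intro image_cong) auto
  moreover have "restrict \<sigma> D = restrict \<sigma>' D" "restrict x D = restrict x' D"
    using psubset.prems(1) by (auto simp: fun_eq_iff restrict_def)
  ultimately show ?case
    unfolding toast_output.simps[of _ _ _ _ D] by simp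
qed

text \<open>Turns the unique existence in \<open>map_Union\<close> into a Boolean combination over
  \<open>B\<close>, which is finite where this is applied, so that measurability passes
  through.\<close>

lemma ex1_the_iff:
  assumes "\<And>b. Q b \<Longrightarrow> b \<in> B"
  shows "(\<exists>!b. Q b) \<and> (THE b. Q b) = b \<longleftrightarrow> Q b \<and> (\<forall>b'\<in>B - {b}. \<not> Q b')"
proof
  assume *: "(\<exists>!b. Q b) \<and> (THE b. Q b) = b"
  then have "Q b"
    using theI'[of Q] by auto
  with * show "Q b \<and> (\<forall>b'\<in>B - {b}. \<not> Q b')"
    by blast
next
  assume "Q b \<and> (\<forall>b'\<in>B - {b}. \<not> Q b')"
  then have "Q b" "\<And>b'. Q b' \<Longrightarrow> b' = b"
    using assms by blast+
  then show "(\<exists>!b. Q b) \<and> (THE b. Q b) = b"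
    by (intro conjI ex1I[of Q b] the_equality)
qed

locale toast_alg =
  fixes \<P> :: "('d::finite, 'i, 'o) lcl" and \<A> :: "('d, 'i, 'o) toast_algorithm"
  assumes lcl: "is_lcl \<P>" and alg: "is_toast_algorithm \<P> \<A>"
begin

text \<open>The specification constrains a toast algorithm only on legal inputs; these conditions
  keep the whole recursion below \<open>D\<close> among them.\<close>

definition valid_input :: "(int ^ 'd \<Rightarrow> 'i) \<Rightarrow> (int ^ 'd \<Rightarrow> real) \<Rightarrow> (int ^ 'd) set set \<Rightarrow> (int ^ 'd) set \<Rightarrow> bool" where
  "valid_input \<sigma> x \<D> D \<longleftrightarrow> finite D \<and> grid_connected D \<and> (\<forall>E\<in>\<D>. finite E \<and> grid_connected E) \<and>
     (\<forall>u\<in>D. \<sigma> u \<in> in_labels \<P> \<and> x u \<in> {0..1})"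

definition previous :: "(int ^ 'd \<Rightarrow> 'i) \<Rightarrow> (int ^ 'd \<Rightarrow> real) \<Rightarrow> (int ^ 'd) set set \<Rightarrow> (int ^ 'd) set \<Rightarrow> (int ^ 'd \<rightharpoonup> 'o)" where
  "previous \<sigma> x \<D> D = map_Union (toast_output \<A> \<sigma> x \<D> ` {E \<in> \<D>. E \<subset> D \<and> finite D})"

lemma toast_output_eq:
  "toast_output \<A> \<sigma> x \<D> D = \<A> D (restrict \<sigma> D) (restrict x D) (previous \<sigma> x \<D> D)"
  unfolding previous_def by (rule toast_output.simps)

lemma valid_input_subset:
  "valid_input \<sigma> x \<D> D \<Longrightarrow> E \<in> \<D> \<Longrightarrow> E \<subseteq> D \<Longrightarrow> valid_input \<sigma> x \<D> E"
  by (auto simp: valid_input_def)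

text \<open>Shape of the output and legality of the input form one induction: outputs of smaller
  pieces make the input legal, and a legal input makes the output well shaped.\<close>

lemma toast_output_valid:
  assumes "valid_input \<sigma> x \<D> D"
  shows "dom (toast_output \<A> \<sigma> x \<D> D) \<subseteq> D \<and> ran (toast_output \<A> \<sigma> x \<D> D) \<subseteq> out_labels \<P> \<and>
    toast_input \<P> D (restrict \<sigma> D) (previous \<sigma> x \<D> D)"
proof -
  have "finite D"
    using assms by (simp add: valid_input_def)
  then show ?thesis
    using assms
  proof (induction D rule: finite_psubset_induct)
    case (psubset D)
    have IH: "dom m \<subseteq> D \<and> ran m \<subseteq> out_labels \<P>"
      if "m \<in> toast_output \<A> \<sigma> x \<D> ` {E \<in> \<D>. E \<subset> D \<and> finite D}" for m
      using that psubset.IH psubset.prems valid_input_subset by blast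
    have "dom (previous \<sigma> x \<D> D) \<subseteq> D" "ran (previous \<sigma> x \<D> D) \<subseteq> out_labels \<P>"
      unfolding previous_def using IH
      by (intro order_trans[OF dom_map_Union] order_trans[OF ran_map_Union]; blast)+
    then have inp: "toast_input \<P> D (restrict \<sigma> D) (previous \<sigma> x \<D> D)"
      using psubset.prems by (auto simp: toast_input_def valid_input_def)
    moreover have "restrict x D \<in> D \<rightarrow>\<^sub>E {0..1}"
      using psubset.prems by (auto simp: valid_input_def)
    ultimately show ?case
      using alg unfolding is_toast_algorithm_def toast_output_eq by blast
  qed
qed

lemma toast_output_None: "valid_input \<sigma> x \<D> D \<Longrightarrow> a \<notin> D \<Longrightarrow> toast_output \<A> \<sigma> x \<D> D a = None"
  using toast_output_valid by blast

lemma map_Union_cong: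
  assumes "\<And>b. (\<exists>m\<in>M. m a = Some b) \<longleftrightarrow> (\<exists>m\<in>M'. m a' = Some b)"
  shows "map_Union M a = map_Union M' a'"
  using assms by (simp add: map_Union_def)

lemma toast_output_translate:
  assumes "valid_input \<sigma> x \<D> D" "\<And>u. u \<in> D \<Longrightarrow> \<sigma>' (g + u) = \<sigma> u \<and> x' (g + u) = x u"
  shows "toast_output \<A> \<sigma>' x' ((`) ((+) g) ` \<D>) ((+) g ` D) (g + a) = toast_output \<A> \<sigma> x \<D> D a"
proof -
  have "finite D"
    using assms by (simp add: valid_input_def)
  then show ?thesis
    using assms
  proof (induction D arbitrary: a rule: finite_psubset_induct)
    case (psubset D)
    let ?\<D>' = "(`) ((+) g) ` \<D>" and ?D' = "(+) g ` D"
    have valid': "valid_input \<sigma>' x' ?\<D>' ?D'"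
      using psubset.prems by (auto simp: valid_input_def grid_connected_translate)
    have below: "{E \<in> ?\<D>'. E \<subset> ?D' \<and> finite ?D'} = (`) ((+) g) ` {E \<in> \<D>. E \<subset> D \<and> finite D}"
    proof -
      have "(+) g ` E \<subset> ?D' \<longleftrightarrow> E \<subset> D" for E
        by (simp add: psubset_eq inj_image_subset_iff inj_image_eq_iff)
      moreover have "{E \<in> ?\<D>'. E \<subset> ?D'} = (`) ((+) g) ` {E \<in> \<D>. (+) g ` E \<subset> ?D'}"
        by blast
      ultimately show ?thesis
        using psubset.hyps by simp
    qed
    have IH: "toast_output \<A> \<sigma>' x' ?\<D>' ((+) g ` E) (g + b) = toast_output \<A> \<sigma> x \<D> E b"
      if "E \<in> \<D>" "E \<subset> D" for E b
      using that psubset.prems valid_input_subset[OF psubset.prems(1)] by (intro psubset.IH) auto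
    have prev: "previous \<sigma>' x' ?\<D>' ?D' (g + b) = previous \<sigma> x \<D> D b" for b
      unfolding previous_def below using IH by (intro map_Union_cong) auto
    show ?case
    \<comment> \<open>Isomorphism invariance speaks about vertices of \<open>D\<close> only;
      elsewhere both outputs are undefined.\<close>
    proof (cases "a \<in> D")
      case False
      then have "g + a \<notin> ?D'" by auto
      then show ?thesis
        using False toast_output_None[OF valid'] toast_output_None[OF psubset.prems(1)] by simp
    next
      case True
      have "toast_input \<P> D (restrict \<sigma> D) (previous \<sigma> x \<D> D)"
          "toast_input \<P> ?D' (restrict \<sigma>' ?D') (previous \<sigma>' x' ?\<D>' ?D')"
        using toast_output_valid[OF valid'] toast_output_valid[OF psubset.prems(1)] by auto
      moreover have "restrict x D \<in> D \<rightarrow>\<^sub>E {0..1}" "restrict x' ?D' \<in> ?D' \<rightarrow>\<^sub>E {0..1}"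
        using psubset.prems(1) valid' by (auto simp: valid_input_def)
      moreover have "\<forall>a\<in>D. restrict \<sigma>' ?D' (g + a) = restrict \<sigma> D a \<and> restrict x' ?D' (g + a) = restrict x D a \<and>
          previous \<sigma>' x' ?\<D>' ?D' (g + a) = previous \<sigma> x \<D> D a"
        using psubset.prems(2) prev by auto
      ultimately have "\<forall>a\<in>D. \<A> ?D' (restrict \<sigma>' ?D') (restrict x' ?D') (previous \<sigma>' x' ?\<D>' ?D') (g + a) =
          \<A> D (restrict \<sigma> D) (restrict x D) (previous \<sigma> x \<D> D) a"
        using alg grid_iso_translate[of g D] unfolding is_toast_algorithm_def by blast
      then show ?thesis
        using True by (simp add: toast_output_eq)
    qed
  qed
qed

text \<open>The partial map handed to the algorithm varies with \<open>x\<close> but takes finitely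
  many values, so it suffices to treat each value as a constant. The family is fixed here; its
  dependence on the labels is dealt with in \<open>sets_candidates\<close>.\<close>

lemma measurable_toast_output:
  assumes fam: "\<And>E. E \<in> \<D> \<Longrightarrow> finite E \<and> grid_connected E"
    and D: "finite D" "grid_connected D" "D \<subseteq> S" and \<sigma>: "\<And>u. u \<in> D \<Longrightarrow> \<sigma> u \<in> in_labels \<P>"
  shows "(\<lambda>x. toast_output \<A> \<sigma> x \<D> D) \<in> PiM S (\<lambda>_. unit_uniform) \<rightarrow>\<^sub>M count_space UNIV"
  using D \<sigma>
proof (induction D rule: finite_psubset_induct)
  case (psubset D)
  let ?M = "PiM S (\<lambda>_. unit_uniform)"
  let ?I = "\<Union>B\<in>Pow D. {m. dom m = B \<and> ran m \<subseteq> out_labels \<P>}"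
  have out: "finite (out_labels \<P>)"
    using lcl by (simp add: is_lcl_def)
  have valid: "valid_input \<sigma> x \<D> D" if "x \<in> space ?M" for x
    using that psubset.prems psubset.hyps fam by (auto simp: valid_input_def space_PiM)
  note inp = toast_output_valid[OF valid]
  have prev: "dom (previous \<sigma> x \<D> D) \<subseteq> D" "ran (previous \<sigma> x \<D> D) \<subseteq> out_labels \<P>" if "x \<in> space ?M" for x
    using inp[OF that] by (auto simp: toast_input_def)
  have "(\<lambda>x. previous \<sigma> x \<D> D) \<in> ?M \<rightarrow>\<^sub>M count_space UNIV"
  proof (rule measurable_finite_map[OF psubset.hyps out prev])
    fix v b assume b: "b \<in> out_labels \<P>"
    let ?E = "{E \<in> \<D>. E \<subset> D \<and> finite D}"
    have finE: "finite ?E"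
      by (rule finite_subset[of _ "Pow D"]) (use psubset.hyps in auto)
    have Q: "{x \<in> space ?M. \<exists>E\<in>?E. toast_output \<A> \<sigma> x \<D> E v = Some b'} \<in> sets ?M" for b'
    proof (rule sets.sets_Collect_finite_Ex[OF _ finE])
      fix E assume E: "E \<in> ?E"
      then have "(\<lambda>x. toast_output \<A> \<sigma> x \<D> E) \<in> ?M \<rightarrow>\<^sub>M count_space UNIV"
        using psubset.prems fam by (intro psubset.IH) auto
      from measurable_sets[OF this, of "{m. m v = Some b'}"]
      show "{x \<in> space ?M. toast_output \<A> \<sigma> x \<D> E v = Some b'} \<in> sets ?M"
        by (simp add: vimage_def Int_def conj_commute)
    qed
    have "previous \<sigma> x \<D> D v = Some b \<longleftrightarrow> (\<exists>E\<in>?E. toast_output \<A> \<sigma> x \<D> E v = Some b) \<and>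
        (\<forall>b'\<in>out_labels \<P> - {b}. \<not> (\<exists>E\<in>?E. toast_output \<A> \<sigma> x \<D> E v = Some b'))"
      if x: "x \<in> space ?M" for x
    proof -
      let ?Q = "\<lambda>b. \<exists>m\<in>toast_output \<A> \<sigma> x \<D> ` ?E. m v = Some b"
      have "b' \<in> out_labels \<P>" if "?Q b'" for b'
      proof -
        obtain E where "E \<in> ?E" "toast_output \<A> \<sigma> x \<D> E v = Some b'"
          using \<open>?Q b'\<close> by blast
        then show ?thesis
          using toast_output_valid[OF valid_input_subset[OF valid[OF x]], of E] by (auto intro: ranI)
      qed
      then have ex1: "(\<exists>!b. ?Q b) \<and> (THE b. ?Q b) = b \<longleftrightarrow> ?Q b \<and> (\<forall>b'\<in>out_labels \<P> - {b}. \<not> ?Q b')"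
        by (rule ex1_the_iff)
      have "previous \<sigma> x \<D> D v = Some b \<longleftrightarrow> (\<exists>!b. ?Q b) \<and> (THE b. ?Q b) = b"
        unfolding previous_def map_Union_def by (auto simp del: bex_simps)
      then show ?thesis
        unfolding ex1 by simp
    qed
    then have "{x \<in> space ?M. previous \<sigma> x \<D> D v = Some b} =
      {x \<in> space ?M. (\<exists>E\<in>?E. toast_output \<A> \<sigma> x \<D> E v = Some b) \<and>
        (\<forall>b'\<in>out_labels \<P> - {b}. \<not> (\<exists>E\<in>?E. toast_output \<A> \<sigma> x \<D> E v = Some b'))}"
      by blast
    also have "\<dots> \<in> sets ?M"
      using out by (intro sets.sets_Collect_conj sets.sets_Collect_finite_All sets.sets_Collect_neg Q) auto
    finally show "{x \<in> space ?M. previous \<sigma> x \<D> D v = Some b} \<in> sets ?M" .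
  qed
  then have "(\<lambda>x. previous \<sigma> x \<D> D) \<in> ?M \<rightarrow>\<^sub>M restrict_space (count_space UNIV) ?I"
    using prev by (intro measurable_restrict_space2) auto
  then have prev_meas: "(\<lambda>x. previous \<sigma> x \<D> D) \<in> ?M \<rightarrow>\<^sub>M count_space ?I"
    by (simp add: restrict_count_space)
  have "finite ?I"
    using psubset.hyps out by (auto intro!: finite_set_of_finite_maps intro: finite_subset)
  then have "countable ?I"
    by (rule countable_finite)
  have "(\<lambda>x. \<A> D (restrict \<sigma> D) (restrict x D) c) \<in> ?M \<rightarrow>\<^sub>M count_space UNIV" if "c \<in> ?I" for c
  proof -
    have "toast_input \<P> D (restrict \<sigma> D) c"
      using that psubset.prems psubset.hyps by (auto simp: toast_input_def)
    then have "(\<lambda>x. \<A> D (restrict \<sigma> D) x c) \<in> PiM D (\<lambda>_. unit_uniform) \<rightarrow>\<^sub>M count_space UNIV"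
      using alg unfolding is_toast_algorithm_def by blast
    then show ?thesis
      by (rule measurable_compose[rotated]) (rule measurable_restrict_subset, rule psubset.prems)
  qed
  from measurable_compose_countable'[OF this prev_meas \<open>countable ?I\<close>]
  show ?case
    by (simp add: toast_output_eq)
qed

end

section \<open>From toast algorithms to local algorithms\<close>

text \<open>One label is compared with the thresholds of all levels, so the toast uses no randomness
  besides the labels already present. Isolation is part of the definition and makes every labelling
  yield sparse centers.\<close>

definition marked_centers :: "(nat \<Rightarrow> nat) \<Rightarrow> (nat \<Rightarrow> real) \<Rightarrow> (int ^ 'd::finite \<Rightarrow> real) \<Rightarrow> (nat \<times> (int ^ 'd)) set" where
  "marked_centers r p x = {(n, v). x v < p n \<and> (\<forall>w\<in>cube v (5 * r n). x w < p n \<longrightarrow> w = v)}"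

locale iid_toast =
  fixes q :: nat and r :: "nat \<Rightarrow> nat" and p :: "nat \<Rightarrow> real"
  assumes r_0: "2 * q + 2 \<le> r 0" and r_Suc: "7 * r n \<le> r (Suc n)"
begin

lemma sparse_centers_marked: "sparse_centers q r (marked_centers r p x)"
proof
  show "v = w" if "(n, v) \<in> marked_centers r p x" "(n, w) \<in> marked_centers r p x" "w \<in> cube v (5 * r n)"
    for n and v w :: "int ^ 'a"
    using that by (auto simp: marked_centers_def)
qed (use r_0 r_Suc in auto)

definition toast :: "(int ^ 'd::finite \<Rightarrow> real) \<Rightarrow> (int ^ 'd) set set" where
  "toast x = pieces q r (marked_centers r p x)"

definition local_toast_pieces :: "(int ^ 'd::finite) set \<Rightarrow> (int ^ 'd \<Rightarrow> real) \<Rightarrow> (int ^ 'd) set set" where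
  "local_toast_pieces S x = pieces q r (confined r (marked_centers r p x) S)"

lemma local_toast_pieces_cong:
  assumes "\<And>u. u \<in> S \<Longrightarrow> x u = x' u"
  shows "local_toast_pieces S x = local_toast_pieces S x'"
proof -
  have "(n, v) \<in> marked_centers r p x \<longleftrightarrow> (n, v) \<in> marked_centers r p x'" if "cube v (5 * r n) \<subseteq> S" for n v
  proof -
    have "x w = x' w" if "w \<in> cube v (5 * r n)" for w
      using assms that \<open>cube v (5 * r n) \<subseteq> S\<close> by blast
    then show ?thesis
      by (simp add: marked_centers_def)
  qed
  then have "confined r (marked_centers r p x) S = confined r (marked_centers r p x') S"
    by (auto simp: confined_def)
  then show ?thesis
    by (simp add: local_toast_pieces_def)
qed

lemma local_toast_pieces_translate:
  "local_toast_pieces ((+) g ` S) x = (`) ((+) g) ` local_toast_pieces S (\<lambda>u. x (g + u))"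
proof -
  have "(n, g + v) \<in> marked_centers r p x \<longleftrightarrow> (n, v) \<in> marked_centers r p (\<lambda>u. x (g + u))" for n v
    by (simp add: marked_centers_def cube_image)
  moreover have "cube (g + v) k \<subseteq> (+) g ` S \<longleftrightarrow> cube v k \<subseteq> S" for v k
    by (simp add: cube_image inj_image_subset_iff)
  ultimately have *: "(n, g + v) \<in> confined r (marked_centers r p x) ((+) g ` S) \<longleftrightarrow>
      (n, v) \<in> confined r (marked_centers r p (\<lambda>u. x (g + u))) S" for n v
    by (simp add: confined_def)
  have "(n, w) \<in> confined r (marked_centers r p x) ((+) g ` S) \<longleftrightarrow>
      (n, w) \<in> translate_centers g (confined r (marked_centers r p (\<lambda>u. x (g + u))) S)" for n w
    using *[of n "w - g"] by (force simp: translate_centers_def)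
  then have "confined r (marked_centers r p x) ((+) g ` S) =
      translate_centers g (confined r (marked_centers r p (\<lambda>u. x (g + u))) S)"
    by auto
  then show ?thesis
    by (simp add: local_toast_pieces_def pieces_translate)
qed

lemma local_toast_pieces_subset: "D \<in> local_toast_pieces S x \<Longrightarrow> D \<subseteq> S"
  unfolding local_toast_pieces_def
  by (rule sparse_centers.Union_pieces_confined_subset[OF sparse_centers_marked])

lemma local_toast_pieces_toast: "local_toast_pieces S x \<subseteq> toast x"
  unfolding local_toast_pieces_def toast_def
  by (rule sparse_centers.pieces_confined_subset[OF sparse_centers_marked])

lemma toast_finite_connected: "D \<in> toast x \<Longrightarrow> finite D \<and> grid_connected D"
  using sparse_centers.finite_piece[OF sparse_centers_marked]
    sparse_centers.grid_connected_pieces[OF sparse_centers_marked]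
  by (auto simp: toast_def pieces_def)

lemma local_toast_pieces_finite_connected:
  "D \<in> local_toast_pieces S x \<Longrightarrow> finite D \<and> grid_connected D"
  using local_toast_pieces_toast toast_finite_connected by blast

lemma local_toast_pieces_downward:
  "D \<in> local_toast_pieces S x \<Longrightarrow> E \<in> toast x \<Longrightarrow> E \<subset> D \<Longrightarrow> E \<in> local_toast_pieces S x"
  unfolding local_toast_pieces_def toast_def
  by (rule sparse_centers.pieces_confined_downward[OF sparse_centers_marked])

text \<open>The test cube of the center is finite, so a growing ball around \<open>v\<close>
  eventually contains it. This is what makes coding radii finite.\<close>

lemma toast_piece_local:
  assumes "D \<in> toast x"
  shows "\<exists>R. D \<in> local_toast_pieces (grid_ball v R) x"
proof -
  obtain n w where D: "D = piece q r (marked_centers r p x) n w" "(n, w) \<in> marked_centers r p x"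
    using assms by (auto simp: toast_def pieces_def)
  obtain R where "cube w (5 * r n) \<subseteq> grid_ball v R"
    using finite_subset_grid_ball[OF finite_cube] by blast
  with D show ?thesis
    unfolding local_toast_pieces_def sparse_centers.pieces_confined[OF sparse_centers_marked] by blast
qed

lemma less_r: "n < r n"
proof (induction n)
  case (Suc n)
  then show ?case using r_Suc[of n] by linarith
qed (use r_0 in auto)

text \<open>A center of level \<open>n\<close> needs a cube of more than \<open>n\<close> vertices
  inside \<open>S\<close>, which bounds the level by \<open>card S\<close>.\<close>

lemma finite_confined_centers:
  fixes S :: "(int ^ 'd::finite) set"
  assumes "finite S"
  shows "finite {(n, v). cube v (5 * r n) \<subseteq> S}"
proof (rule finite_subset)
  show "{(n, v). cube v (5 * r n) \<subseteq> S} \<subseteq> {..card S} \<times> S"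
  proof safe
    fix n and v :: "int ^ 'd" assume sub: "cube v (5 * r n) \<subseteq> S"
    then show "v \<in> S"
      using cube_refl by blast
    have "n \<le> 2 * (5 * r n) + 1"
      using less_r[of n] by simp
    also have "\<dots> \<le> (2 * (5 * r n) + 1) ^ CARD('d)"
      by (rule self_le_power) auto
    also have "\<dots> \<le> card S"
      using card_mono[OF assms sub] by (simp add: card_cube)
    finally show "n \<le> card S" .
  qed
qed (use assms in auto)

lemma measurable_local_toast_pieces:
  fixes S :: "(int ^ 'd::finite) set"
  assumes "finite S"
  shows "local_toast_pieces S \<in> PiM S (\<lambda>_. unit_uniform) \<rightarrow>\<^sub>M count_space UNIV"
proof (rule measurable_finite_pattern[OF finite_confined_centers[OF assms], where
      P = "\<lambda>a x. a \<in> marked_centers r p x" and g = "pieces q r"])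
  let ?M = "PiM S (\<lambda>_. unit_uniform)"
  fix a :: "nat \<times> (int ^ 'd)" assume "a \<in> {(n, v). cube v (5 * r n) \<subseteq> S}"
  then obtain n v where a: "a = (n, v)" "cube v (5 * r n) \<subseteq> S"
    by blast
  have mark: "{x \<in> space ?M. x u < p n} \<in> sets ?M" if "u \<in> S" for u
  proof -
    have "(\<lambda>x. x u) \<in> ?M \<rightarrow>\<^sub>M unit_uniform"
      using that by (rule measurable_component_singleton)
    then have "(\<lambda>x. x u) -` {y \<in> space unit_uniform. y < p n} \<inter> space ?M \<in> sets ?M"
      using unit_uniform_less by (rule measurable_sets)
    also have "(\<lambda>x. x u) -` {y \<in> space unit_uniform. y < p n} \<inter> space ?M = {x \<in> space ?M. x u < p n}"
      using that by (auto simp: space_PiM)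
    finally show ?thesis .
  qed
  have "{x \<in> space ?M. x v < p n \<and> (\<forall>w\<in>cube v (5 * r n) - {v}. \<not> x w < p n)} \<in> sets ?M"
    using a(2) cube_refl[of v "5 * r n"]
    by (intro sets.sets_Collect_conj sets.sets_Collect_finite_All sets.sets_Collect_neg mark) auto
  also have "{x \<in> space ?M. x v < p n \<and> (\<forall>w\<in>cube v (5 * r n) - {v}. \<not> x w < p n)} =
      {x \<in> space ?M. a \<in> marked_centers r p x}"
    by (auto simp: a marked_centers_def)
  finally show "{x \<in> space ?M. a \<in> marked_centers r p x} \<in> sets ?M" .
next
  fix x
  show "local_toast_pieces S x = pieces q r {a \<in> {(n, v). cube v (5 * r n) \<subseteq> S}. a \<in> marked_centers r p x}"
    unfolding local_toast_pieces_def confined_def by (rule arg_cong[of _ _ "pieces q r"]) auto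
qed

end

section \<open>The local algorithm that evaluates visible pieces\<close>

locale toast_to_local = toast_alg \<P> \<A> + iid_toast q r p
  for \<P> :: "('d::finite, 'i, 'o) lcl" and \<A> :: "('d, 'i, 'o) toast_algorithm" and q r p
begin

text \<open>A set rather than a value, since visible pieces may disagree at the origin on a null set
  of labellings.\<close>

definition candidates :: "nat \<Rightarrow> (int ^ 'd \<Rightarrow> 'i \<times> real) \<Rightarrow> 'o set" where
  "candidates R y = {b. \<exists>D\<in>local_toast_pieces (grid_ball 0 R) (snd \<circ> y).
     toast_output \<A> (fst \<circ> y) (snd \<circ> y) (local_toast_pieces (grid_ball 0 R) (snd \<circ> y)) D 0 = Some b}"

text \<open>The choice by \<open>SOME\<close> is harmless: whenever \<open>toast_result\<close> is a
  total function, every candidate equals its value.\<close>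

definition local_of_toast :: "('d, 'i, 'o) local_algorithm" where
  "local_of_toast = \<lparr>stops = \<lambda>R. {y \<in> space (nbhd_space (in_labels \<P>) R). candidates R y \<noteq> {}},
     out_fun = \<lambda>R y. SOME b. b \<in> candidates R y\<rparr>"

text \<open>Translating by \<open>v\<close> moves the computation from the rooted view to the ball
  around \<open>v\<close>; after that the visible pieces may be replaced by the full toast.\<close>

lemma candidates_view:
  assumes "\<And>u. u \<in> grid_ball v R \<Longrightarrow> \<sigma> u \<in> in_labels \<P> \<and> x u \<in> {0..1}"
  shows "candidates R (view (\<lambda>u. (\<sigma> u, x u)) v R) =
    {b. \<exists>D\<in>local_toast_pieces (grid_ball v R) x. toast_output \<A> \<sigma> x (toast x) D v = Some b}"
proof -
  define y where "y = view (\<lambda>u. (\<sigma> u, x u)) v R"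
  define F where "F = local_toast_pieces (grid_ball 0 R) (\<lambda>u. x (v + u))"
  have y: "(fst \<circ> y) u = \<sigma> (v + u)" "(snd \<circ> y) u = x (v + u)" if "u \<in> grid_ball 0 R" for u
    using that by (auto simp: y_def view_def)
  have F: "local_toast_pieces (grid_ball 0 R) (snd \<circ> y) = F"
    unfolding F_def using y by (intro local_toast_pieces_cong)
  have Fv: "local_toast_pieces (grid_ball v R) x = (`) ((+) v) ` F"
    unfolding F_def grid_ball_image[of v] by (rule local_toast_pieces_translate)
  have out: "toast_output \<A> \<sigma> x (toast x) ((+) v ` D) v = toast_output \<A> (fst \<circ> y) (snd \<circ> y) F D 0"
    if D: "D \<in> F" for D
  proof -
    have sub: "D \<subseteq> grid_ball 0 R"
      using D local_toast_pieces_subset by (auto simp: F_def)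
    have "valid_input (fst \<circ> y) (snd \<circ> y) F D"
      unfolding valid_input_def
    proof (intro conjI ballI)
      show "finite D" "grid_connected D"
        using D local_toast_pieces_finite_connected by (auto simp: F_def)
      show "finite E" "grid_connected E" if "E \<in> F" for E
        using that local_toast_pieces_finite_connected by (auto simp: F_def)
      show "(fst \<circ> y) u \<in> in_labels \<P>" "(snd \<circ> y) u \<in> {0..1}" if "u \<in> D" for u
      proof -
        have u: "u \<in> grid_ball 0 R"
          using that sub by blast
        then have "v + u \<in> grid_ball v R"
          by (simp add: grid_ball_translate_0)
        then show "(fst \<circ> y) u \<in> in_labels \<P>" "(snd \<circ> y) u \<in> {0..1}"
          using assms y[OF u] by auto
      qed
    qed
    then have "toast_output \<A> \<sigma> x ((`) ((+) v) ` F) ((+) v ` D) (v + 0) = toast_output \<A> (fst \<circ> y) (snd \<circ> y) F D 0"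
      using sub y by (intro toast_output_translate) auto
    \<comment> \<open>Only pieces strictly inside the given one enter the recursion, and these are
      visible by \<open>local_toast_pieces_downward\<close>.\<close>
    moreover have "toast_output \<A> \<sigma> x ((`) ((+) v) ` F) ((+) v ` D) = toast_output \<A> \<sigma> x (toast x) ((+) v ` D)"
    proof (rule toast_output_cong)
      have D': "(+) v ` D \<in> local_toast_pieces (grid_ball v R) x"
        using D Fv by blast
      then show "finite ((+) v ` D)"
        using local_toast_pieces_finite_connected by blast
      show "E \<in> (`) ((+) v) ` F \<longleftrightarrow> E \<in> toast x" if "E \<subset> (+) v ` D" for E
        using local_toast_pieces_downward[OF D' _ that] local_toast_pieces_toast
        unfolding Fv[symmetric] by blast
    qed simp
    ultimately show ?thesis by simp
  qed
  show ?thesis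
    unfolding candidates_def y_def[symmetric] F Fv using out by auto
qed

lemma stops_at_local_of_toast:
  assumes "\<And>u. u \<in> grid_ball v R \<Longrightarrow> \<sigma> u \<in> in_labels \<P> \<and> x u \<in> {0..1}"
  shows "stops_at local_of_toast \<sigma> x v R \<longleftrightarrow>
    (\<exists>D\<in>local_toast_pieces (grid_ball v R) x. \<exists>b. toast_output \<A> \<sigma> x (toast x) D v = Some b)"
  using candidates_view[OF assms] view_in_space[of v R \<sigma> "in_labels \<P>" x] assms
  by (auto simp: stops_at_def local_of_toast_def)

text \<open>Some piece colours \<open>v\<close> and becomes visible at a finite radius, so
  exploration ends. Visible pieces belong to the toast and their values to
  \<open>toast_result\<close>, so at the stopping radius \<open>\<tau> v\<close> is the only
  candidate.\<close>

lemma local_output_correct: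
  assumes "range \<sigma> \<subseteq> in_labels \<P>" "\<And>u. x u \<in> {0..1}"
    and res: "toast_result \<A> \<sigma> x (toast x) = {(v, \<tau> v) |v. True}"
  shows "coding_radius local_of_toast \<sigma> x v \<noteq> \<infinity> \<and> local_output local_of_toast \<sigma> x v = \<tau> v"
proof -
  have \<tau>: "b = \<tau> w" if "D \<in> toast x" "toast_output \<A> \<sigma> x (toast x) D w = Some b" for D w b
  proof -
    have "(w, b) \<in> toast_result \<A> \<sigma> x (toast x)"
      using that by (auto simp: toast_result_def Map.graph_def)
    then show ?thesis
      by (simp add: res)
  qed
  have "(v, \<tau> v) \<in> toast_result \<A> \<sigma> x (toast x)"
    by (simp add: res)
  then obtain D where D: "D \<in> toast x" "toast_output \<A> \<sigma> x (toast x) D v = Some (\<tau> v)"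
    by (auto simp: toast_result_def Map.graph_def)
  obtain R where "D \<in> local_toast_pieces (grid_ball v R) x"
    using toast_piece_local[OF D(1)] by blast
  then have stop: "stops_at local_of_toast \<sigma> x v R"
    using assms D(2) by (subst stops_at_local_of_toast) auto
  define L where "L = (LEAST r. stops_at local_of_toast \<sigma> x v r)"
  have "stops_at local_of_toast \<sigma> x v L"
    unfolding L_def using stop by (rule LeastI)
  then have "candidates L (view (\<lambda>u. (\<sigma> u, x u)) v L) \<noteq> {}"
    by (simp add: stops_at_def local_of_toast_def)
  moreover have "candidates L (view (\<lambda>u. (\<sigma> u, x u)) v L) \<subseteq> {\<tau> v}"
    using assms candidates_view[of v L \<sigma> x] \<tau> local_toast_pieces_toast by blast
  ultimately have "candidates L (view (\<lambda>u. (\<sigma> u, x u)) v L) = {\<tau> v}"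
    by blast
  then have "local_output local_of_toast \<sigma> x v = \<tau> v"
    unfolding local_output_eq_Least[OF stop] L_def[symmetric] by (simp add: local_of_toast_def)
  then show ?thesis
    using stop by (auto simp: coding_radius_eq_infinity)
qed

lemma candidates_subset:
  assumes y: "y \<in> space (nbhd_space (in_labels \<P>) R)"
  shows "candidates R y \<subseteq> out_labels \<P>"
proof
  fix b assume "b \<in> candidates R y"
  then obtain D where D: "D \<in> local_toast_pieces (grid_ball 0 R) (snd \<circ> y)"
      "toast_output \<A> (fst \<circ> y) (snd \<circ> y) (local_toast_pieces (grid_ball 0 R) (snd \<circ> y)) D 0 = Some b"
    by (auto simp: candidates_def)
  have "y u \<in> in_labels \<P> \<times> {0..1}" if "u \<in> D" for u
    using that local_toast_pieces_subset[OF D(1)] y by (auto simp: nbhd_space_def space_PiM space_pair_measure)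
  then have "fst (y u) \<in> in_labels \<P> \<and> snd (y u) \<in> {0..1}" if "u \<in> D" for u
    using that by (metis mem_Times_iff)
  then have "valid_input (fst \<circ> y) (snd \<circ> y) (local_toast_pieces (grid_ball 0 R) (snd \<circ> y)) D"
    unfolding valid_input_def using D(1) local_toast_pieces_finite_connected by auto
  from toast_output_valid[OF this] D(2) show "b \<in> out_labels \<P>"
    by (auto intro: ranI)
qed

text \<open>The visible family and the input labels in the ball take finitely many values. Once both
  are fixed, only the real labels vary and \<open>measurable_toast_output\<close> applies.\<close>

lemma sets_candidates:
  "{y \<in> space (nbhd_space (in_labels \<P>) R). b \<in> candidates R y} \<in> sets (nbhd_space (in_labels \<P>) R)"
proof -
  let ?N = "nbhd_space (in_labels \<P>) R" and ?S = "grid_ball 0 R :: (int ^ 'd) set"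
  let ?x = "\<lambda>y. \<lambda>u\<in>?S. snd (y u)"
  define \<F> where "\<F> = {\<D>. \<D> \<subseteq> Pow ?S \<and> (\<forall>D\<in>\<D>. finite D \<and> grid_connected D)}"
  have fin\<F>: "finite \<F>"
    by (rule finite_subset[of _ "Pow (Pow ?S)"]) (auto simp: \<F>_def)
  have fin\<Sigma>: "finite (?S \<rightarrow>\<^sub>E in_labels \<P>)"
    using lcl by (intro finite_PiE) (auto simp: is_lcl_def)
  have comp: "(\<lambda>y. y u) \<in> ?N \<rightarrow>\<^sub>M count_space (in_labels \<P>) \<Otimes>\<^sub>M unit_uniform" if "u \<in> ?S" for u
    unfolding nbhd_space_def using that by (rule measurable_component_singleton)
  have x: "?x \<in> ?N \<rightarrow>\<^sub>M PiM ?S (\<lambda>_. unit_uniform)"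
    by (intro measurable_restrict measurable_compose[OF comp measurable_snd])
  have fam: "{y \<in> space ?N. local_toast_pieces ?S (?x y) = \<D>} \<in> sets ?N" for \<D>
    using measurable_sets[OF measurable_compose[OF x measurable_local_toast_pieces], of "{\<D>}"]
    by (simp add: vimage_def Int_def conj_commute)
  have lab: "{y \<in> space ?N. \<forall>u\<in>?S. fst (y u) = \<sigma> u} \<in> sets ?N" if "\<sigma> \<in> ?S \<rightarrow>\<^sub>E in_labels \<P>" for \<sigma>
  proof (rule sets.sets_Collect_finite_All[OF _ finite_grid_ball])
    fix u assume u: "u \<in> ?S"
    then have "\<sigma> u \<in> in_labels \<P>"
      using that by auto
    with measurable_sets[OF measurable_compose[OF comp[OF u] measurable_fst], of "{\<sigma> u}"]
    show "{y \<in> space ?N. fst (y u) = \<sigma> u} \<in> sets ?N"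
      by (simp add: vimage_def Int_def conj_commute)
  qed
  have out: "{y \<in> space ?N. toast_output \<A> \<sigma> (?x y) \<D> D 0 = Some b} \<in> sets ?N"
    if "\<sigma> \<in> ?S \<rightarrow>\<^sub>E in_labels \<P>" "\<D> \<in> \<F>" "D \<in> \<D>" for \<sigma> \<D> D
  proof -
    have "(\<lambda>x. toast_output \<A> \<sigma> x \<D> D) \<in> PiM ?S (\<lambda>_. unit_uniform) \<rightarrow>\<^sub>M count_space UNIV"
      using that by (intro measurable_toast_output) (auto simp: \<F>_def)
    from measurable_sets[OF measurable_compose[OF x this], of "{m. m 0 = Some b}"]
    show ?thesis
      by (simp add: vimage_def Int_def conj_commute)
  qed
  have "b \<in> candidates R y \<longleftrightarrow> (\<exists>\<D>\<in>\<F>. \<exists>\<sigma>\<in>?S \<rightarrow>\<^sub>E in_labels \<P>. \<exists>D\<in>\<D>. local_toast_pieces ?S (?x y) = \<D> \<and>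
      (\<forall>u\<in>?S. fst (y u) = \<sigma> u) \<and> toast_output \<A> \<sigma> (?x y) \<D> D 0 = Some b)"
    if y: "y \<in> space ?N" for y
  proof -
    let ?\<D> = "local_toast_pieces ?S (?x y)"
    have fam_eq: "local_toast_pieces ?S (snd \<circ> y) = ?\<D>"
      by (rule local_toast_pieces_cong) simp
    have mem: "?\<D> \<in> \<F>"
      using local_toast_pieces_subset[of _ ?S "?x y"] local_toast_pieces_finite_connected[of _ ?S "?x y"]
      unfolding \<F>_def by blast
    have out_eq: "toast_output \<A> (fst \<circ> y) (snd \<circ> y) ?\<D> D 0 = toast_output \<A> \<sigma> (?x y) ?\<D> D 0"
      if "D \<in> ?\<D>" "\<forall>u\<in>?S. fst (y u) = \<sigma> u" for D \<sigma>
    proof -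
      have "D \<subseteq> ?S" "finite D"
        using that(1) mem by (auto simp: \<F>_def)
      then show ?thesis
        using that(2) by (subst toast_output_cong[of D "fst \<circ> y" \<sigma> "snd \<circ> y" "?x y"]) auto
    qed
    have "y u \<in> in_labels \<P> \<times> {0..1}" if "u \<in> ?S" for u
      using that y by (auto simp: nbhd_space_def space_PiM space_pair_measure)
    then have lab: "(\<lambda>u\<in>?S. fst (y u)) \<in> ?S \<rightarrow>\<^sub>E in_labels \<P>"
      by (auto simp: mem_Times_iff)
    show ?thesis
    proof
      assume "b \<in> candidates R y"
      then obtain D where D: "D \<in> ?\<D>" "toast_output \<A> (fst \<circ> y) (snd \<circ> y) ?\<D> D 0 = Some b"
        by (auto simp: candidates_def fam_eq)
      then have "toast_output \<A> (\<lambda>u\<in>?S. fst (y u)) (?x y) ?\<D> D 0 = Some b"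
        using out_eq[of D "\<lambda>u\<in>?S. fst (y u)"] by simp
      then show "\<exists>\<D>\<in>\<F>. \<exists>\<sigma>\<in>?S \<rightarrow>\<^sub>E in_labels \<P>. \<exists>D\<in>\<D>. ?\<D> = \<D> \<and>
          (\<forall>u\<in>?S. fst (y u) = \<sigma> u) \<and> toast_output \<A> \<sigma> (?x y) \<D> D 0 = Some b"
        by (intro bexI[OF _ mem] bexI[OF _ lab] bexI[OF _ D(1)]) simp
    next
      assume "\<exists>\<D>\<in>\<F>. \<exists>\<sigma>\<in>?S \<rightarrow>\<^sub>E in_labels \<P>. \<exists>D\<in>\<D>. ?\<D> = \<D> \<and>
          (\<forall>u\<in>?S. fst (y u) = \<sigma> u) \<and> toast_output \<A> \<sigma> (?x y) \<D> D 0 = Some b"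
      then obtain \<sigma> D where D: "D \<in> ?\<D>" "\<forall>u\<in>?S. fst (y u) = \<sigma> u"
          and "toast_output \<A> \<sigma> (?x y) ?\<D> D 0 = Some b"
        by blast
      then have "toast_output \<A> (fst \<circ> y) (snd \<circ> y) ?\<D> D 0 = Some b"
        using out_eq[OF D] by simp
      with D(1) show "b \<in> candidates R y"
        unfolding candidates_def fam_eq by blast
    qed
  qed
  then have "{y \<in> space ?N. b \<in> candidates R y} =
    {y \<in> space ?N. \<exists>\<D>\<in>\<F>. \<exists>\<sigma>\<in>?S \<rightarrow>\<^sub>E in_labels \<P>. \<exists>D\<in>\<D>. local_toast_pieces ?S (?x y) = \<D> \<and>
      (\<forall>u\<in>?S. fst (y u) = \<sigma> u) \<and> toast_output \<A> \<sigma> (?x y) \<D> D 0 = Some b}"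
    by blast
  also have "\<dots> \<in> sets ?N"
  proof (intro sets.sets_Collect_finite_Ex[OF _ fin\<F>] sets.sets_Collect_finite_Ex[OF _ fin\<Sigma>])
    fix \<D> \<sigma> assume *: "\<D> \<in> \<F>" "\<sigma> \<in> ?S \<rightarrow>\<^sub>E in_labels \<P>"
    then have "finite \<D>"
      by (intro finite_subset[of \<D> "Pow ?S"]) (auto simp: \<F>_def)
    then show "{y \<in> space ?N. \<exists>D\<in>\<D>. local_toast_pieces ?S (?x y) = \<D> \<and>
        (\<forall>u\<in>?S. fst (y u) = \<sigma> u) \<and> toast_output \<A> \<sigma> (?x y) \<D> D 0 = Some b} \<in> sets ?N"
      using * by (intro sets.sets_Collect_finite_Ex sets.sets_Collect_conj fam lab out) auto
  qed
  finally show ?thesis .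
qed

lemma measurable_candidates: "candidates R \<in> nbhd_space (in_labels \<P>) R \<rightarrow>\<^sub>M count_space UNIV"
proof (rule measurable_finite_pattern[where F = "out_labels \<P>" and P = "\<lambda>b y. b \<in> candidates R y" and g = id])
  show "finite (out_labels \<P>)"
    using lcl by (simp add: is_lcl_def)
  show "candidates R y = id {a \<in> out_labels \<P>. a \<in> candidates R y}"
    if "y \<in> space (nbhd_space (in_labels \<P>) R)" for y
    using candidates_subset[OF that] by auto
qed (rule sets_candidates)

lemma is_local_algorithm_local_of_toast: "is_local_algorithm \<P> local_of_toast"
  unfolding is_local_algorithm_def
proof (intro allI conjI)
  fix R
  let ?N = "nbhd_space (in_labels \<P>) R"
  show "stops local_of_toast R \<in> sets ?N"
    using measurable_sets[OF measurable_candidates, of "- {{}}" R]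
    by (simp add: local_of_toast_def vimage_def Int_def conj_commute)
  have "(\<lambda>y. SOME b. b \<in> candidates R y) \<in> ?N \<rightarrow>\<^sub>M count_space UNIV"
    by (rule measurable_compose[OF measurable_candidates]) simp
  then have "out_fun local_of_toast R \<in> restrict_space ?N (stops local_of_toast R) \<rightarrow>\<^sub>M count_space UNIV"
    by (simp add: local_of_toast_def measurable_restrict_space1)
  moreover have "out_fun local_of_toast R y \<in> out_labels \<P>"
    if "y \<in> space (restrict_space ?N (stops local_of_toast R))" for y
  proof -
    have "y \<in> space ?N" "candidates R y \<noteq> {}"
      using that by (auto simp: space_restrict_space local_of_toast_def)
    then show ?thesis
      using candidates_subset[of y R] some_in_eq[of "candidates R y"] by (auto simp: local_of_toast_def)
  qed
  ultimately have "out_fun local_of_toast R \<in> restrict_space ?N (stops local_of_toast R) \<rightarrow>\<^sub>M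
      restrict_space (count_space UNIV) (out_labels \<P>)"
    by (intro measurable_restrict_space2) auto
  then show "out_fun local_of_toast R \<in> restrict_space ?N (stops local_of_toast R) \<rightarrow>\<^sub>M count_space (out_labels \<P>)"
    by (simp add: restrict_count_space)
qed

end

section \<open>Random toasts\<close>

text \<open>The 25 keeps \<open>target\<close> clear of the inner cube, whose radius
  \<open>6 * toast_scale q n\<close> is 24 times \<open>half_scale q n\<close>. The factor
  \<open>2 ^ n\<close> makes the probabilities of \<open>inner_mark\<close> summable.\<close>

primrec half_scale :: "nat \<Rightarrow> nat \<Rightarrow> nat" where
  "half_scale q 0 = q + 1"
| "half_scale q (Suc n) = 25 * 2 ^ n * half_scale q n"

text \<open>Three of the four parts cover the distance from \<open>g\<close> to a vertex of
  \<open>target\<close>; the fourth lets the cube around that vertex contain \<open>cube g n\<close>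
  as well.\<close>

definition toast_scale :: "nat \<Rightarrow> nat \<Rightarrow> nat" where
  "toast_scale q n = 4 * half_scale q n"

text \<open>Chosen so that a cube of radius \<open>6 * toast_scale q n\<close> carries half a mark
  on average. The 6 is 5 for the isolation test and 1 for the offset of the center from
  \<open>g\<close>.\<close>

definition mark_prob :: "nat \<Rightarrow> nat \<Rightarrow> nat \<Rightarrow> real" where
  "mark_prob d q n = 1 / (2 * (2 * (6 * real (toast_scale q n)) + 1) ^ d)"

lemma half_scale_Suc_ge: "25 * half_scale q n \<le> half_scale q (Suc n)"
  by (simp add: mult_le_mono)

lemma half_scale_pos: "0 < half_scale q n"
  by (induction n) auto

declare half_scale.simps(2) [simp del]

lemma iid_toast_scale: "iid_toast q (toast_scale q)"
proof
  show "2 * q + 2 \<le> toast_scale q 0"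
    by (simp add: toast_scale_def)
  show "7 * toast_scale q n \<le> toast_scale q (Suc n)" for n
    using half_scale_Suc_ge[of q n] by (simp add: toast_scale_def)
qed

lemma toast_scale_mono: "m \<le> n \<Longrightarrow> toast_scale q m \<le> toast_scale q n"
proof (rule lift_Suc_mono_le[of "toast_scale q"])
  show "toast_scale q k \<le> toast_scale q (Suc k)" for k
    using half_scale_Suc_ge[of q k] by (simp add: toast_scale_def)
qed

lemma less_half_scale: "n < half_scale q (Suc n)"
proof (induction n)
  case 0
  then show ?case using half_scale_pos[of q "Suc 0"] by simp
next
  case (Suc n)
  then show ?case using half_scale_Suc_ge[of q "Suc n"] by linarith
qed

lemma card_scale_cube:
  "real (card (cube (g :: int ^ 'd::finite) (6 * toast_scale q n))) = 1 / (2 * mark_prob CARD('d) q n)"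
  by (simp add: card_cube mark_prob_def add.commute)

lemma mark_prob_pos: "0 < mark_prob d q n"
  by (simp add: mark_prob_def add_nonneg_pos)

lemma mark_prob_le: "mark_prob d q n \<le> 1 / 2"
proof -
  have "1 \<le> (2 * (6 * real (toast_scale q n)) + 1) ^ d"
    by (rule one_le_power) simp
  then show ?thesis
    by (simp add: mark_prob_def field_simps)
qed

section \<open>Marks and their independence\<close>

definition mark :: "nat \<Rightarrow> nat \<Rightarrow> int ^ 'd::finite \<Rightarrow> (int ^ 'd \<Rightarrow> real) \<Rightarrow> bool" where
  "mark q n v x \<longleftrightarrow> x v < mark_prob CARD('d) q n"

interpretation labels: prob_space "random_labels :: (int ^ 'd::finite \<Rightarrow> real) measure"
  by (rule prob_space_random_labels)

lemma measurable_label: "(\<lambda>x. x v) \<in> random_labels \<rightarrow>\<^sub>M unit_uniform"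
  unfolding random_labels_def by (rule measurable_component_singleton) simp

lemma sets_mark: "{x \<in> space random_labels. mark q n v x} \<in> sets random_labels"
proof -
  have "(\<lambda>x. x v) -` {y \<in> space unit_uniform. y < mark_prob CARD('a) q n} \<inter> space random_labels \<in> sets random_labels"
    using measurable_label unit_uniform_less by (rule measurable_sets)
  also have "(\<lambda>x. x v) -` {y \<in> space unit_uniform. y < mark_prob CARD('a) q n} \<inter> space random_labels =
      {x \<in> space random_labels. mark q n v x}"
    by (auto simp: space_random_labels mark_def)
  finally show ?thesis .
qed

lemma prob_mark:
  fixes v :: "int ^ 'd::finite"
  shows "labels.prob {x \<in> space random_labels. mark q n v x} = mark_prob CARD('d) q n"
proof -
  let ?p = "mark_prob CARD('d) q n"
  have "distr random_labels unit_uniform (\<lambda>x. x v) = unit_uniform"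
    unfolding random_labels_def using prob_space_unit_uniform by (intro distr_PiM_component) auto
  then have "?p = measure (distr random_labels unit_uniform (\<lambda>x. x v)) {y \<in> space unit_uniform. y < ?p}"
    using mark_prob_pos[of "CARD('d)" q n] mark_prob_le[of "CARD('d)" q n]
    by (simp only: measure_unit_uniform_less)
  also have "\<dots> = labels.prob ((\<lambda>x. x v) -` {y \<in> space unit_uniform. y < ?p} \<inter> space random_labels)"
    using measurable_label unit_uniform_less by (rule measure_distr)
  also have "(\<lambda>x. x v) -` {y \<in> space unit_uniform. y < ?p} \<inter> space random_labels =
      {x \<in> space random_labels. mark q n v x}"
    by (auto simp: space_random_labels mark_def)
  finally show ?thesis by simp
qed

lemma indep_labels:
  "labels.indep_vars (\<lambda>_. unit_uniform) (\<lambda>v x. x v) (UNIV :: (int ^ 'd::finite) set)"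
proof (subst labels.indep_vars_iff_distr_eq_PiM)
  have "distr random_labels unit_uniform (\<lambda>x. x v) = unit_uniform" for v :: "int ^ 'd"
    unfolding random_labels_def using prob_space_unit_uniform by (intro distr_PiM_component) auto
  then show "distr random_labels (Pi\<^sub>M UNIV (\<lambda>_. unit_uniform)) (\<lambda>x. \<lambda>i\<in>UNIV. x i) =
      Pi\<^sub>M UNIV (\<lambda>i::int ^ 'd. distr random_labels unit_uniform (\<lambda>x. x i))"
    by (simp add: random_labels_def[symmetric] restrict_def)
qed (use measurable_label in auto)

text \<open>
  The shells of different levels are disjoint, so what happens in them is independent; the vertices in
  the inner cube are handled by Borel--Cantelli.
\<close>

definition shell :: "nat \<Rightarrow> int ^ 'd::finite \<Rightarrow> nat \<Rightarrow> (int ^ 'd) set" where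
  "shell q g n = cube g (6 * toast_scale q (Suc n)) - cube g (6 * toast_scale q n)"

text \<open>
  Taken off-center, so that it misses the inner cube of the shell, but near enough to \<open>g\<close> for a piece
  around any of its vertices to contain \<open>g\<close>.
\<close>

definition target :: "nat \<Rightarrow> int ^ 'd::finite \<Rightarrow> nat \<Rightarrow> (int ^ 'd) set" where
  "target q g n = cube (g + (\<chi> i. 2 * int (half_scale q (Suc n)))) (half_scale q (Suc n))"

text \<open>Uniqueness is asked within the shell only, so that the event reads no labels elsewhere;
  the inner cube is left to \<open>inner_mark\<close>.\<close>

definition unique_mark :: "nat \<Rightarrow> int ^ 'd::finite \<Rightarrow> nat \<Rightarrow> int ^ 'd \<Rightarrow> (int ^ 'd \<Rightarrow> real) \<Rightarrow> bool" where
  "unique_mark q g n v x \<longleftrightarrow> mark q (Suc n) v x \<and> (\<forall>w\<in>shell q g n - {v}. \<not> mark q (Suc n) w x)"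

lemma target_subset_cube: "target q g n \<subseteq> cube g (3 * half_scale q (Suc n))"
proof
  fix v assume v: "v \<in> target q g n"
  show "v \<in> cube g (3 * half_scale q (Suc n))"
    unfolding cube_def
  proof (intro CollectI allI)
    fix i
    have "\<bar>v $ i - (g $ i + 2 * int (half_scale q (Suc n)))\<bar> \<le> int (half_scale q (Suc n))"
      using v by (auto simp: target_def cube_def)
    then show "\<bar>v $ i - g $ i\<bar> \<le> int (3 * half_scale q (Suc n))"
      by linarith
  qed
qed

lemma target_subset_shell: "target q g n \<subseteq> shell q g n"
proof
  fix v assume v: "v \<in> target q g n"
  have "v \<in> cube g (6 * toast_scale q (Suc n))"
    using v target_subset_cube[of q g n] cube_mono[of "3 * half_scale q (Suc n)" "6 * toast_scale q (Suc n)" g]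
    by (auto simp: toast_scale_def)
  moreover have "v \<notin> cube g (6 * toast_scale q n)"
  proof
    \<comment> \<open>Any coordinate excludes \<open>v\<close>: it differs from that of
      \<open>g\<close> by at least \<open>half_scale q (Suc n)\<close>, hence by more than 24 times
      \<open>half_scale q n\<close>.\<close>
    fix i
    assume "v \<in> cube g (6 * toast_scale q n)"
    then have "\<bar>v $ i - g $ i\<bar> \<le> int (24 * half_scale q n)"
      by (auto simp: cube_def toast_scale_def)
    moreover have "\<bar>v $ i - (g $ i + 2 * int (half_scale q (Suc n)))\<bar> \<le> int (half_scale q (Suc n))"
      using v by (auto simp: target_def cube_def)
    ultimately show False
      using half_scale_Suc_ge[of q n] half_scale_pos[of q n] by linarith
  qed
  ultimately show "v \<in> shell q g n"
    by (simp add: shell_def)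
qed

lemma finite_target: "finite (target q g n)"
  by (simp add: target_def)

lemma finite_shell: "finite (shell q g n)"
  by (simp add: shell_def)

lemma disjoint_shells: "disjoint_family (shell q g)"
proof -
  have "shell q g m \<inter> shell q g n = {}" if "m < n" for m n
  proof -
    have "6 * toast_scale q (Suc m) \<le> 6 * toast_scale q n"
      using toast_scale_mono[of "Suc m" n q] that by simp
    from cube_mono[OF this, of g] show ?thesis
      by (auto simp: shell_def)
  qed
  then show ?thesis
    unfolding disjoint_family_on_def by (metis Int_commute linorder_neqE_nat)
qed

lemma sets_unique_mark: "{x \<in> space random_labels. unique_mark q g n v x} \<in> sets random_labels"
  unfolding unique_mark_def using finite_shell
  by (intro sets.sets_Collect_conj sets.sets_Collect_finite_All sets.sets_Collect_neg sets_mark) auto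

text \<open>By independence the probability is \<open>p * (1 - p) ^ k\<close>, where
  \<open>k\<close> is at most the cardinality \<open>1 / (2 * p)\<close> of the outer cube.
  Bernoulli's inequality bounds the power below by \<open>1 - k * p\<close>, which is at least
  1/2.\<close>

lemma prob_unique_mark:
  fixes g :: "int ^ 'd::finite"
  assumes v: "v \<in> shell q g n"
  shows "mark_prob CARD('d) q (Suc n) / 2 \<le> labels.prob {x \<in> space random_labels. unique_mark q g n v x}"
proof -
  let ?p = "mark_prob CARD('d) q (Suc n)" and ?S = "shell q g n"
  define P where "P w y \<longleftrightarrow> (if w = v then y < ?p else \<not> y < ?p)" for w and y :: real
  have "labels.indep_events (\<lambda>w. {x \<in> space random_labels. P w (x w)}) UNIV"
  proof (rule labels.indep_eventsI_indep_vars[OF indep_labels])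
    show "{y \<in> space unit_uniform. P w y} \<in> sets unit_uniform" for w
      unfolding P_def using unit_uniform_less[of ?p] sets.sets_Collect_neg[OF unit_uniform_less[of ?p]]
      by (cases "w = v") (simp_all only: if_True if_False simp_thms)
  qed
  then have "labels.prob (\<Inter>w\<in>?S. {x \<in> space random_labels. P w (x w)}) =
      (\<Prod>w\<in>?S. labels.prob {x \<in> space random_labels. P w (x w)})"
    using v finite_shell[of q g n] unfolding labels.indep_events_def by blast
  also have "(\<Inter>w\<in>?S. {x \<in> space random_labels. P w (x w)}) = {x \<in> space random_labels. unique_mark q g n v x}"
    using v by (auto simp: P_def unique_mark_def mark_def split: if_splits)
  also have "(\<Prod>w\<in>?S. labels.prob {x \<in> space random_labels. P w (x w)}) =
      labels.prob {x \<in> space random_labels. P v (x v)} *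
      (\<Prod>w\<in>?S - {v}. labels.prob {x \<in> space random_labels. P w (x w)})"
    using finite_shell v by (rule prod.remove)
  also have "labels.prob {x \<in> space random_labels. P v (x v)} = ?p"
    using prob_mark[of q "Suc n" v] by (simp add: P_def mark_def)
  also have "(\<Prod>w\<in>?S - {v}. labels.prob {x \<in> space random_labels. P w (x w)}) = (\<Prod>w\<in>?S - {v}. 1 - ?p)"
  proof (rule prod.cong[OF refl])
    fix w assume "w \<in> ?S - {v}"
    then have "{x \<in> space random_labels. P w (x w)} = {x \<in> space random_labels. \<not> mark q (Suc n) w x}"
      by (auto simp: P_def mark_def)
    then show "labels.prob {x \<in> space random_labels. P w (x w)} = 1 - ?p"
      using labels.prob_neg[OF sets_mark[of q "Suc n" w]] prob_mark[of q "Suc n" w] by simp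
  qed
  finally have eq: "labels.prob {x \<in> space random_labels. unique_mark q g n v x} = ?p * (1 - ?p) ^ card (?S - {v})"
    by simp
  have "card (?S - {v}) \<le> card (cube g (6 * toast_scale q (Suc n)))"
    by (rule card_mono) (auto simp: shell_def)
  then have "real (card (?S - {v})) * ?p \<le> real (card (cube g (6 * toast_scale q (Suc n)))) * ?p"
    using mark_prob_pos[of "CARD('d)" q "Suc n"] by (intro mult_right_mono) auto
  also have "\<dots> = 1 / 2"
    using mark_prob_pos[of "CARD('d)" q "Suc n"] unfolding card_scale_cube by simp
  finally have "1 / 2 \<le> 1 + real (card (?S - {v})) * (- ?p)"
    by simp
  also have "\<dots> \<le> (1 + (- ?p)) ^ card (?S - {v})"
    using mark_prob_le[of "CARD('d)" q "Suc n"] by (intro Bernoulli_inequality) simp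
  finally have "?p * (1 / 2) \<le> ?p * (1 - ?p) ^ card (?S - {v})"
    using mark_prob_pos[of "CARD('d)" q "Suc n"] by (intro mult_left_mono) auto
  then show ?thesis
    using eq by simp
qed

definition hit :: "nat \<Rightarrow> int ^ 'd::finite \<Rightarrow> nat \<Rightarrow> (int ^ 'd \<Rightarrow> real) \<Rightarrow> bool" where
  "hit q g n x \<longleftrightarrow> (\<exists>v\<in>target q g n. unique_mark q g n v x)"

lemma sets_hit: "{x \<in> space random_labels. hit q g n x} \<in> sets random_labels"
  unfolding hit_def by (intro sets.sets_Collect_finite_Ex sets_unique_mark) (simp add: target_def)

text \<open>Unique marks at different vertices exclude each other, so the probabilities add up. With
  \<open>h = half_scale q (Suc n)\<close> the outer cube and the target have side lengths
  \<open>48 * h + 1\<close> and \<open>2 * h + 1\<close>; their ratio is at most 24, whatever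
  \<open>n\<close> is.\<close>

lemma prob_hit:
  fixes g :: "int ^ 'd::finite"
  shows "1 / (4 * 24 ^ CARD('d)) \<le> labels.prob {x \<in> space random_labels. hit q g n x}"
proof -
  let ?p = "mark_prob CARD('d) q (Suc n)" and ?h = "half_scale q (Suc n)"
  have disj: "disjoint_family_on (\<lambda>v. {x \<in> space random_labels. unique_mark q g n v x}) (target q g n)"
    using target_subset_shell[of q g n] unfolding disjoint_family_on_def unique_mark_def by blast
  have "(2 * (6 * real (toast_scale q (Suc n))) + 1) ^ CARD('d) \<le> (24 * (2 * real ?h + 1)) ^ CARD('d)"
    by (intro power_mono) (auto simp: toast_scale_def)
  also have "\<dots> = 24 ^ CARD('d) * real (card (target q g n))"
    unfolding power_mult_distrib target_def card_cube by (simp add: add.commute)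
  finally have *: "(2 * (6 * real (toast_scale q (Suc n))) + 1) ^ CARD('d) \<le> 24 ^ CARD('d) * real (card (target q g n))" .
  have "0 < (2 * (6 * real (toast_scale q (Suc n))) + 1) ^ CARD('d)"
    by (rule zero_less_power) simp
  with * have "1 / (4 * 24 ^ CARD('d)) \<le> real (card (target q g n)) * (?p / 2)"
    unfolding mark_prob_def by (simp add: field_simps)
  also have "\<dots> = (\<Sum>v\<in>target q g n. ?p / 2)"
    by simp
  also have "\<dots> \<le> (\<Sum>v\<in>target q g n. labels.prob {x \<in> space random_labels. unique_mark q g n v x})"
    using target_subset_shell by (intro sum_mono prob_unique_mark) blast
  also have "\<dots> = labels.prob (\<Union>v\<in>target q g n. {x \<in> space random_labels. unique_mark q g n v x})"
    using disj sets_unique_mark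
    by (intro labels.finite_measure_finite_Union[symmetric]) (auto simp: target_def)
  also have "(\<Union>v\<in>target q g n. {x \<in> space random_labels. unique_mark q g n v x}) =
      {x \<in> space random_labels. hit q g n x}"
    by (auto simp: hit_def)
  finally show ?thesis .
qed

text \<open>\<open>hit\<close> is unchanged when the labelling is restricted to its shell, and
  restrictions of independent labels to disjoint index sets are independent.\<close>

lemma indep_hits: "labels.indep_events (\<lambda>n. {x \<in> space random_labels. hit q g n x}) UNIV"
proof -
  let ?M = "\<lambda>n. Pi\<^sub>M (shell q g n) (\<lambda>_. unit_uniform)"
  have "labels.indep_vars ?M (\<lambda>n x. restrict x (shell q g n)) UNIV"
    by (rule labels.indep_vars_restrict[OF indep_labels _ disjoint_shells]) simp
  moreover have "{x \<in> space (?M n). hit q g n x} \<in> sets (?M n)" for n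
  proof -
    have mark: "{x \<in> space (?M n). mark q (Suc n) w x} \<in> sets (?M n)" if w: "w \<in> shell q g n" for w
    proof -
      let ?B = "{y \<in> space unit_uniform. y < mark_prob CARD('a) q (Suc n)}"
      have "(\<lambda>x. x w) \<in> ?M n \<rightarrow>\<^sub>M unit_uniform"
        using w by (rule measurable_component_singleton)
      then have "(\<lambda>x. x w) -` ?B \<inter> space (?M n) \<in> sets (?M n)"
        using unit_uniform_less by (rule measurable_sets)
      also have "(\<lambda>x. x w) -` ?B \<inter> space (?M n) = {x \<in> space (?M n). mark q (Suc n) w x}"
        using w by (auto simp: space_PiM mark_def)
      finally show ?thesis .
    qed
    show ?thesis
      unfolding hit_def unique_mark_def using finite_shell subsetD[OF target_subset_shell]
      by (intro sets.sets_Collect_finite_Ex sets.sets_Collect_conj sets.sets_Collect_finite_All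
          sets.sets_Collect_neg mark) (auto simp: finite_target)
  qed
  ultimately have "labels.indep_events (\<lambda>n. {x \<in> space random_labels. hit q g n (restrict x (shell q g n))}) UNIV"
    by (rule labels.indep_eventsI_indep_vars)
  moreover have "hit q g n (restrict x (shell q g n)) \<longleftrightarrow> hit q g n x" for n x
    using target_subset_shell[of q g n] by (auto simp: hit_def unique_mark_def mark_def)
  ultimately show ?thesis by simp
qed

text \<open>By continuity from above the limsup event inherits the uniform lower bound of
  \<open>prob_hit\<close>; being positive, its probability is 1 by the 0-1 law.\<close>

lemma AE_infinitely_many_hits: "AE x in random_labels. infinite {n. hit q g n x}"
proof -
  let ?F = "\<lambda>n. {x \<in> space random_labels. hit q g n x}"
  let ?U = "\<lambda>n. \<Union>m\<in>{n..}. ?F m"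
  have U: "?U n \<in> sets random_labels" for n
    using sets_hit by (intro sets.countable_UN) auto
  have "decseq ?U"
    unfolding decseq_def by (intro allI impI UN_mono) auto
  then have "(\<lambda>n. labels.prob (?U n)) \<longlonglongrightarrow> labels.prob (\<Inter>n. ?U n)"
    using U by (intro labels.finite_Lim_measure_decseq) auto
  moreover have "1 / (4 * 24 ^ CARD('a)) \<le> labels.prob (?U n)" for n
  proof -
    have "1 / (4 * 24 ^ CARD('a)) \<le> labels.prob (?F n)"
      by (rule prob_hit)
    also have "\<dots> \<le> labels.prob (?U n)"
      using U by (intro labels.finite_measure_mono) auto
    finally show ?thesis .
  qed
  ultimately have "1 / (4 * 24 ^ CARD('a)) \<le> labels.prob (\<Inter>n. ?U n)"
    by (intro LIMSEQ_le_const) auto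
  moreover have "(0::real) < 1 / (4 * 24 ^ CARD('a))"
    by simp
  ultimately have "labels.prob (\<Inter>n. ?U n) = 1"
    using labels.borel_0_1_law[OF indep_hits, of q g] by linarith
  moreover have "(\<Inter>n. ?U n) \<in> sets random_labels"
    using U by (intro sets.countable_INT) auto
  ultimately have "AE x in random_labels. x \<in> (\<Inter>n. ?U n)"
    by (simp only: labels.prob_eq_1)
  then show ?thesis
    by (rule AE_mp) (auto simp: infinite_nat_iff_unbounded_le)
qed

section \<open>Marks in the inner cubes\<close>

definition inner_mark :: "nat \<Rightarrow> int ^ 'd::finite \<Rightarrow> nat \<Rightarrow> (int ^ 'd \<Rightarrow> real) \<Rightarrow> bool" where
  "inner_mark q g n x \<longleftrightarrow> (\<exists>w\<in>cube g (6 * toast_scale q n). mark q (Suc n) w x)"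

lemma sets_inner_mark: "{x \<in> space random_labels. inner_mark q g n x} \<in> sets random_labels"
  unfolding inner_mark_def by (intro sets.sets_Collect_finite_Ex sets_mark) simp

text \<open>A union bound compares the cubes of two consecutive levels, and the factor
  \<open>2 ^ n\<close> in the growth of the scales supplies the decay.\<close>

lemma prob_inner_mark: "labels.prob {x \<in> space random_labels. inner_mark q g n x} \<le> (1 / 2) ^ n"
  for g :: "int ^ 'd::finite"
proof -
  let ?d = "CARD('d)"
  let ?a = "2 * (6 * real (toast_scale q n)) + 1" and ?b = "2 * (6 * real (toast_scale q (Suc n))) + 1"
  have "{x \<in> space random_labels. inner_mark q g n x} =
      (\<Union>w\<in>cube g (6 * toast_scale q n). {x \<in> space random_labels. mark q (Suc n) w x})"
    by (auto simp: inner_mark_def)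
  also have "labels.prob \<dots> \<le>
      (\<Sum>w\<in>cube g (6 * toast_scale q n). labels.prob {x \<in> space random_labels. mark q (Suc n) w x})"
    using sets_mark by (intro labels.finite_measure_subadditive_finite) auto
  also have "\<dots> = real (card (cube g (6 * toast_scale q n))) * mark_prob ?d q (Suc n)"
    by (simp add: prob_mark)
  also have "\<dots> = ?a ^ ?d * (1 / (2 * ?b ^ ?d))"
    by (simp add: card_cube mark_prob_def add.commute)
  also have "\<dots> \<le> (1 / 2) ^ n"
  proof -
    \<comment> \<open>As the dimension is at least 1, the factor \<open>2 ^ n\<close> may be
      enlarged to a full power and compared side length by side length.\<close>
    have "2 ^ n * ?a ^ ?d \<le> (2 ^ n) ^ ?d * ?a ^ ?d"
      by (intro mult_right_mono self_le_power) auto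
    also have "\<dots> = (2 ^ n * ?a) ^ ?d"
      by (simp add: power_mult_distrib)
    also have "\<dots> \<le> ?b ^ ?d"
    proof (intro power_mono)
      have "(1::real) \<le> real (half_scale q n)"
        using half_scale_pos[of q n] by simp
      then have "2 ^ n * (1::real) \<le> 2 ^ n * real (half_scale q n)"
        by (intro mult_left_mono) auto
      moreover have "?b = 1200 * (2 ^ n * real (half_scale q n)) + 1"
          "2 ^ n * ?a = 48 * (2 ^ n * real (half_scale q n)) + 2 ^ n"
        by (simp_all add: toast_scale_def half_scale.simps(2) algebra_simps)
      ultimately show "2 ^ n * ?a \<le> ?b"
        by linarith
    qed simp
    finally have "2 ^ n * ?a ^ ?d \<le> ?b ^ ?d" .
    moreover have pos: "0 < ?b ^ ?d"
      by (rule zero_less_power) simp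
    ultimately have "2 ^ n * ?a ^ ?d \<le> 2 * ?b ^ ?d"
      by linarith
    with pos show ?thesis
      by (simp add: field_simps)
  qed
  finally show ?thesis .
qed

lemma AE_finitely_many_inner_marks:
  "AE x in random_labels. eventually (\<lambda>n. \<not> inner_mark q g n x) sequentially"
proof -
  have "summable (\<lambda>n. labels.prob {x \<in> space random_labels. inner_mark q g n x})"
  proof (rule summable_comparison_test)
    show "\<exists>N. \<forall>n\<ge>N. norm (labels.prob {x \<in> space random_labels. inner_mark q g n x}) \<le> (1 / 2) ^ n"
      using prob_inner_mark by auto
    show "summable (\<lambda>n. (1 / 2 :: real) ^ n)"
      by (rule summable_geometric) simp
  qed
  then have "AE x in random_labels. eventually
      (\<lambda>n. x \<in> space random_labels - {x \<in> space random_labels. inner_mark q g n x}) sequentially"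
    using sets_inner_mark by (intro borel_cantelli_AE1) (auto simp: labels.emeasure_eq_measure)
  then show ?thesis
    by (rule AE_mp) (auto elim: eventually_mono)
qed

text \<open>The test cube of \<open>v\<close> reaches \<open>3 * h + 5 * (4 * h)\<close> from
  \<open>g\<close>, less than the outer radius \<open>24 * h\<close>, where
  \<open>h = half_scale q (Suc n)\<close>. A competing mark would thus lie in the shell or in the
  inner cube, and both are ruled out.\<close>

lemma hit_center:
  fixes g :: "int ^ 'd::finite"
  assumes "hit q g n x" "\<not> inner_mark q g n x"
  shows "\<exists>v. (Suc n, v) \<in> marked_centers (toast_scale q) (mark_prob CARD('d) q) x \<and>
    cube g n \<subseteq> cube v (toast_scale q (Suc n))"
proof -
  obtain v where v: "v \<in> target q g n" "unique_mark q g n v x"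
    using assms by (auto simp: hit_def)
  have vg: "v \<in> cube g (3 * half_scale q (Suc n))"
    using v target_subset_cube by blast
  have "w = v" if "w \<in> cube v (5 * toast_scale q (Suc n))" "mark q (Suc n) w x" for w
  proof -
    have "w \<in> cube g (6 * toast_scale q (Suc n))"
      using vg that(1) by (rule cube_trans) (simp add: toast_scale_def)
    then show ?thesis
      using v(2) assms(2) that(2) by (auto simp: unique_mark_def inner_mark_def shell_def)
  qed
  then have "(Suc n, v) \<in> marked_centers (toast_scale q) (mark_prob CARD('d) q) x"
    using v by (auto simp: marked_centers_def unique_mark_def mark_def)
  moreover have "cube g n \<subseteq> cube v (toast_scale q (Suc n))"
  proof
    fix w assume "w \<in> cube g n"
    moreover have "g \<in> cube v (3 * half_scale q (Suc n))"
      using vg by (simp add: cube_sym)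
    moreover have "3 * half_scale q (Suc n) + n \<le> toast_scale q (Suc n)"
      using less_half_scale[of n q] by (simp add: toast_scale_def)
    ultimately show "w \<in> cube v (toast_scale q (Suc n))"
      using cube_trans by blast
  qed
  ultimately show ?thesis by blast
qed

section \<open>Almost sure covering\<close>

lemma in_some_cube: "\<exists>k. h \<in> cube g k"
proof -
  have "h \<in> grid_ball g (grid_dist g h)"
    by (simp add: grid_ball_def)
  then show ?thesis
    using grid_ball_subset_cube by blast
qed

lemma countable_grid: "countable (UNIV :: (int ^ 'd::finite) set)"
proof -
  have "h \<in> (\<Union>k. cube (0 :: int ^ 'd) k)" for h
    using in_some_cube[of h 0] by blast
  then have "UNIV \<subseteq> (\<Union>k. cube (0 :: int ^ 'd) k)"
    by blast
  then show ?thesis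
    by (rule countable_subset) (auto simp: countable_finite)
qed

text \<open>Separation, finiteness and connectedness hold for every labelling; only covering needs
  probability. For each of the countably many \<open>g\<close>, cubes around \<open>g\<close> of
  arbitrarily large radius lie in pieces, and these cubes catch every \<open>h\<close>.\<close>

lemma AE_is_toast:
  "AE x in (random_labels :: (int ^ 'd::finite \<Rightarrow> real) measure).
     is_toast q (iid_toast.toast q (toast_scale q) (mark_prob CARD('d) q) x)"
proof -
  have "AE x in random_labels. \<forall>g\<in>UNIV::(int ^ 'd) set. infinite {n. hit q g n x} \<and>
      eventually (\<lambda>n. \<not> inner_mark q g n x) sequentially"
    unfolding AE_ball_countable[OF countable_grid]
    using AE_infinitely_many_hits AE_finitely_many_inner_marks by (auto intro: AE_conjI)
  then show ?thesis
  proof (rule AE_mp, intro AE_I2 impI)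
    fix x :: "int ^ 'd \<Rightarrow> real"
    assume x: "\<forall>g\<in>UNIV. infinite {n. hit q g n x} \<and> eventually (\<lambda>n. \<not> inner_mark q g n x) sequentially"
    interpret iid_toast q "toast_scale q" "mark_prob CARD('d) q"
      by (rule iid_toast_scale)
    show "is_toast q (toast x)"
      unfolding toast_def
    proof (rule sparse_centers.is_toast_pieces[OF sparse_centers_marked])
      fix g h :: "int ^ 'd"
      obtain k where k: "h \<in> cube g k"
        using in_some_cube by blast
      obtain N where N: "\<And>n. N \<le> n \<Longrightarrow> \<not> inner_mark q g n x"
        using x by (auto simp: eventually_sequentially)
      have "infinite {n. hit q g n x}"
        using x by blast
      then obtain n where n: "max k N \<le> n" "hit q g n x"
        unfolding infinite_nat_iff_unbounded_le by blast
      then obtain v where v: "(Suc n, v) \<in> marked_centers (toast_scale q) (mark_prob CARD('d) q) x"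
          "cube g n \<subseteq> cube v (toast_scale q (Suc n))"
        using hit_center N by fastforce
      moreover have "h \<in> cube g n"
        using k n cube_mono[of k n g] by auto
      ultimately show "\<exists>n v. (n, v) \<in> marked_centers (toast_scale q) (mark_prob CARD('d) q) x \<and>
          g \<in> cube v (toast_scale q n) \<and> h \<in> cube v (toast_scale q n)"
        using cube_refl by blast
    qed
  qed
qed

section \<open>Uniform tail bounds by compactness\<close>

definition runs_beyond ::
    "('d::finite, 'i, 'o) local_algorithm \<Rightarrow> (int ^ 'd \<Rightarrow> 'i) \<Rightarrow> int ^ 'd \<Rightarrow> nat \<Rightarrow> (int ^ 'd \<Rightarrow> real) set" where
  "runs_beyond \<A> \<sigma> v r = {x \<in> space random_labels. \<forall>k\<le>r. \<not> stops_at \<A> \<sigma> x v k}"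

lemma sets_runs_beyond:
  assumes "is_local_algorithm \<P> \<A>" "\<And>u. u \<in> grid_ball v r \<Longrightarrow> \<sigma> u \<in> in_labels \<P>"
  shows "runs_beyond \<A> \<sigma> v r \<in> sets random_labels"
proof -
  have "{x \<in> space random_labels. stops_at \<A> \<sigma> x v k} \<in> sets random_labels" if "k \<le> r" for k
    unfolding random_labels_def
    by (rule sets_stops_at[OF assms(1) subset_UNIV]) (use assms(2) grid_ball_mono[OF that, of v] in blast)
  then have "{x \<in> space random_labels. \<forall>k\<in>{..r}. \<not> stops_at \<A> \<sigma> x v k} \<in> sets random_labels"
    by (intro sets.sets_Collect_finite_All sets.sets_Collect_neg) simp_all
  then show ?thesis
    unfolding runs_beyond_def Ball_def atMost_iff .
qed

lemma runs_beyond_cong: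
  assumes "\<And>u. u \<in> grid_ball v r \<Longrightarrow> \<sigma> u = \<sigma>' u"
  shows "runs_beyond \<A> \<sigma> v r = runs_beyond \<A> \<sigma>' v r"
proof -
  have "stops_at \<A> \<sigma> x v k \<longleftrightarrow> stops_at \<A> \<sigma>' x v k" if "k \<le> r" for x k
    using assms grid_ball_mono[OF that, of v] by (intro stops_at_cong) auto
  then show ?thesis
    by (auto simp: runs_beyond_def)
qed

section \<open>Translation invariance of tail probabilities\<close>

lemma distr_shift_random_labels:
  "distr random_labels random_labels (\<lambda>x u. x (v + u)) = (random_labels :: (int ^ 'd::finite \<Rightarrow> real) measure)"
proof -
  have "distr (Pi\<^sub>M UNIV (\<lambda>_::int ^ 'd. unit_uniform)) (Pi\<^sub>M UNIV (\<lambda>_. unit_uniform)) (\<lambda>x. \<lambda>u\<in>UNIV. x (v + u)) =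
      Pi\<^sub>M UNIV (\<lambda>_. unit_uniform)"
    by (rule distr_PiM_reindex) (auto simp: prob_space_unit_uniform inj_on_def)
  then show ?thesis
    by (simp add: random_labels_def restrict_def)
qed

text \<open>Shifting preserves the law of the labels, so a bound at the origin that is uniform over
  inputs holds at every vertex.\<close>

lemma emeasure_runs_beyond_translate:
  assumes alg: "is_local_algorithm \<P> \<A>" and \<sigma>: "\<And>u. u \<in> grid_ball v r \<Longrightarrow> \<sigma> u \<in> in_labels \<P>"
  shows "emeasure random_labels (runs_beyond \<A> \<sigma> v r) =
    emeasure random_labels (runs_beyond \<A> (\<lambda>u. \<sigma> (v + u)) 0 r)"
proof -
  let ?S = "\<lambda>x u. x (v + u)" and ?B = "runs_beyond \<A> (\<lambda>u. \<sigma> (v + u)) 0 r"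
  have "?B \<in> sets random_labels"
    using alg by (rule sets_runs_beyond) (simp add: \<sigma> grid_ball_translate_0)
  moreover have "?S \<in> random_labels \<rightarrow>\<^sub>M random_labels"
  proof -
    have "(\<lambda>x. \<lambda>u\<in>UNIV. x (v + u)) \<in> random_labels \<rightarrow>\<^sub>M PiM UNIV (\<lambda>_. unit_uniform)"
      by (rule measurable_restrict) (rule measurable_label)
    then show ?thesis
      by (simp add: random_labels_def[symmetric] restrict_def)
  qed
  ultimately have "emeasure (distr random_labels random_labels ?S) ?B =
      emeasure random_labels (?S -` ?B \<inter> space random_labels)"
    by (intro emeasure_distr)
  moreover have "stops_at \<A> \<sigma> x v k \<longleftrightarrow> stops_at \<A> (\<lambda>u. \<sigma> (v + u)) (\<lambda>u. x (v + u)) 0 k" for x k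
    using stops_at_translate[of 0 k \<sigma> v "\<lambda>u. \<sigma> (v + u)" x "\<lambda>u. x (v + u)"] by simp
  then have "?S -` ?B \<inter> space random_labels = runs_beyond \<A> \<sigma> v r"
    by (auto simp: runs_beyond_def space_random_labels)
  ultimately show ?thesis
    by (simp add: distr_shift_random_labels)
qed

text \<open>Around each point violating \<open>P\<close> the cylinder that fixes the coordinates in
  \<open>J\<close> still violates \<open>P\<close>, so the complement is open.\<close>

lemma closedin_finite_determined:
  assumes "finite J" and dep: "\<And>\<sigma> \<sigma>'. (\<And>u. u \<in> J \<Longrightarrow> \<sigma> u = \<sigma>' u) \<Longrightarrow> P \<sigma> \<longleftrightarrow> P \<sigma>'"
  shows "closedin (product_topology (\<lambda>_. discrete_topology I) UNIV) {\<sigma> \<in> UNIV \<rightarrow>\<^sub>E I. P \<sigma>}"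
proof -
  let ?X = "product_topology (\<lambda>_. discrete_topology I) UNIV"
  have top: "topspace ?X = (UNIV \<rightarrow>\<^sub>E I)"
    by simp
  have "openin ?X {\<sigma> \<in> UNIV \<rightarrow>\<^sub>E I. \<not> P \<sigma>}"
  proof (subst openin_subopen, intro ballI)
    fix \<sigma> assume \<sigma>: "\<sigma> \<in> {\<sigma> \<in> UNIV \<rightarrow>\<^sub>E I. \<not> P \<sigma>}"
    define T where "T = PiE UNIV (\<lambda>u. if u \<in> J then {\<sigma> u} else I)"
    have "openin ?X T"
      unfolding T_def openin_PiE_gen
    proof (intro disjI2 conjI ballI)
      show "finite {i \<in> UNIV. (if i \<in> J then {\<sigma> i} else I) \<noteq> topspace (discrete_topology I)}"
        by (rule finite_subset[OF _ assms(1)]) auto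
      show "openin (discrete_topology I) (if i \<in> J then {\<sigma> i} else I)" for i
        using \<sigma> by auto
    qed
    moreover have "\<sigma> \<in> T"
      using \<sigma> by (auto simp: T_def)
    moreover have "T \<subseteq> {\<sigma> \<in> UNIV \<rightarrow>\<^sub>E I. \<not> P \<sigma>}"
    proof
      fix \<sigma>' assume \<sigma>': "\<sigma>' \<in> T"
      have val: "\<sigma>' u \<in> (if u \<in> J then {\<sigma> u} else I)" for u
        using \<sigma>' unfolding T_def by (rule PiE_mem) simp
      then have "\<sigma>' u = \<sigma> u" if "u \<in> J" for u
        using val[of u] that by simp
      then have "\<not> P \<sigma>'"
        using dep[of \<sigma>' \<sigma>] \<sigma> by simp
      moreover have "\<sigma>' u \<in> I" for u
        using val[of u] \<sigma> by (auto split: if_splits)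
      ultimately show "\<sigma>' \<in> {\<sigma> \<in> UNIV \<rightarrow>\<^sub>E I. \<not> P \<sigma>}"
        by auto
    qed
    ultimately show "\<exists>T. openin ?X T \<and> \<sigma> \<in> T \<and> T \<subseteq> {\<sigma> \<in> UNIV \<rightarrow>\<^sub>E I. \<not> P \<sigma>}"
      by blast
  qed
  moreover have "topspace ?X - {\<sigma> \<in> UNIV \<rightarrow>\<^sub>E I. P \<sigma>} = {\<sigma> \<in> UNIV \<rightarrow>\<^sub>E I. \<not> P \<sigma>}"
    unfolding top by blast
  ultimately show ?thesis
    unfolding closedin_def top by auto
qed

text \<open>Otherwise the inputs with tail above \<open>\<epsilon>\<close> form a decreasing
  sequence of nonempty closed sets in a compact space. For an input common to all of them,
  continuity from above gives probability at least \<open>\<epsilon>\<close> that exploration never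
  ends.\<close>

lemma uniform_tail_bound:
  fixes \<P> :: "('d::finite, 'i, 'o) lcl"
  assumes lcl: "is_lcl \<P>" and alg: "is_local_algorithm \<P> \<A>"
    and fin: "\<And>\<sigma>. range \<sigma> \<subseteq> in_labels \<P> \<Longrightarrow> AE x in random_labels. coding_radius \<A> \<sigma> x 0 \<noteq> \<infinity>"
    and \<epsilon>: "0 < \<epsilon>"
  shows "\<exists>r. \<forall>\<sigma>. (\<forall>u\<in>grid_ball 0 r. \<sigma> u \<in> in_labels \<P>) \<longrightarrow>
    emeasure random_labels (runs_beyond \<A> \<sigma> 0 r) \<le> ennreal \<epsilon>"
proof (rule ccontr)
  let ?I = "in_labels \<P>"
  define big where "big r \<sigma> \<longleftrightarrow> ennreal \<epsilon> < emeasure random_labels (runs_beyond \<A> \<sigma> 0 r)" for r \<sigma>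
  define K where "K r = {\<sigma> \<in> UNIV \<rightarrow>\<^sub>E ?I. big r \<sigma>}" for r
  assume "\<not> ?thesis"
  then have ex: "\<exists>\<sigma>. (\<forall>u\<in>grid_ball 0 r. \<sigma> u \<in> ?I) \<and> big r \<sigma>" for r
    by (auto simp: big_def not_le)
  have big_cong: "big r \<sigma> \<longleftrightarrow> big r \<sigma>'" if "\<And>u. u \<in> grid_ball 0 r \<Longrightarrow> \<sigma> u = \<sigma>' u" for r \<sigma> \<sigma>'
    unfolding big_def using runs_beyond_cong[of 0 r \<sigma> \<sigma>' \<A>] that by simp
  have "K r \<noteq> {}" for r
  proof -
    obtain \<sigma> where \<sigma>: "\<forall>u\<in>grid_ball 0 r. \<sigma> u \<in> ?I" "big r \<sigma>"
      using ex by blast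
    \<comment> \<open>The label at the origin serves as default outside the ball: it is legal
      because every ball contains its center.\<close>
    define \<sigma>' where "\<sigma>' u = (if u \<in> grid_ball 0 r then \<sigma> u else \<sigma> 0)" for u
    have "\<sigma>' \<in> UNIV \<rightarrow>\<^sub>E ?I"
      using \<sigma>(1) by (auto simp: \<sigma>'_def)
    moreover have "big r \<sigma>'"
      using \<sigma>(2) big_cong[of r \<sigma> \<sigma>'] by (simp add: \<sigma>'_def)
    ultimately show ?thesis
      by (auto simp: K_def)
  qed
  moreover have "closedin (product_topology (\<lambda>_. discrete_topology ?I) UNIV) (K r)" for r
    unfolding K_def by (rule closedin_finite_determined[OF finite_grid_ball[of 0 r]]) (rule big_cong)
  moreover have "compact_space (product_topology (\<lambda>_::int ^ 'd. discrete_topology ?I) UNIV)"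
    using lcl by (auto simp: compact_space_product_topology compact_space_discrete_topology is_lcl_def)
  moreover have "decseq K"
    unfolding decseq_Suc_iff
  proof
    fix r
    have "big r \<sigma>" if "\<sigma> \<in> UNIV \<rightarrow>\<^sub>E ?I" "big (Suc r) \<sigma>" for \<sigma>
    proof -
      have "emeasure random_labels (runs_beyond \<A> \<sigma> 0 (Suc r)) \<le> emeasure random_labels (runs_beyond \<A> \<sigma> 0 r)"
        using alg by (intro emeasure_mono sets_runs_beyond[of \<P>]) (use that in \<open>auto simp: runs_beyond_def\<close>)
      then show ?thesis
        using that(2) unfolding big_def by (rule less_le_trans[rotated])
    qed
    then show "K (Suc r) \<subseteq> K r"
      by (auto simp: K_def)
  qed
  ultimately have "(\<Inter>r. K r) \<noteq> {}"
    by (intro compact_space_imp_nest) auto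
  then obtain \<sigma> where \<sigma>: "\<And>r. \<sigma> \<in> K r"
    by blast
  then have range: "range \<sigma> \<subseteq> ?I"
    by (auto simp: K_def)
  have meas: "runs_beyond \<A> \<sigma> 0 r \<in> sets random_labels" for r
    using alg range by (intro sets_runs_beyond[of \<P>]) auto
  interpret prob_space "random_labels :: (int ^ 'd \<Rightarrow> real) measure"
    by (rule prob_space_random_labels)
  have "(\<lambda>r. emeasure random_labels (runs_beyond \<A> \<sigma> 0 r)) \<longlonglongrightarrow> emeasure random_labels (\<Inter>r. runs_beyond \<A> \<sigma> 0 r)"
  proof (rule Lim_emeasure_decseq)
    show "decseq (runs_beyond \<A> \<sigma> 0)"
      unfolding decseq_def runs_beyond_def by (auto intro: order_trans)
  qed (use meas in auto)
  moreover have "ennreal \<epsilon> \<le> emeasure random_labels (runs_beyond \<A> \<sigma> 0 r)" for r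
    using \<sigma>[of r] by (auto simp: K_def big_def)
  ultimately have "ennreal \<epsilon> \<le> emeasure random_labels (\<Inter>r. runs_beyond \<A> \<sigma> 0 r)"
    by (intro LIMSEQ_le_const) auto
  moreover have "emeasure random_labels (\<Inter>r. runs_beyond \<A> \<sigma> 0 r) = 0"
  proof -
    have "AE x in random_labels. x \<notin> (\<Inter>r. runs_beyond \<A> \<sigma> 0 r)"
      using fin[OF range] by (rule AE_mp) (auto simp: coding_radius_eq_infinity runs_beyond_def)
    moreover have meas_Inter: "(\<Inter>r. runs_beyond \<A> \<sigma> 0 r) \<in> sets random_labels"
      using meas by (intro sets.countable_INT) auto
    moreover have "{x \<in> space random_labels. \<not> x \<notin> (\<Inter>r. runs_beyond \<A> \<sigma> 0 r)} =
        (\<Inter>r. runs_beyond \<A> \<sigma> 0 r)"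
      using sets.sets_into_space[OF meas_Inter] by blast
    ultimately show ?thesis
      by (simp only: AE_iff_measurable)
  qed
  ultimately show False
    using \<epsilon> by (simp add: ennreal_eq_0_iff)
qed

lemma ex_uniform_complexity:
  fixes \<P> :: "('d::finite, 'i, 'o) lcl"
  assumes lcl: "is_lcl \<P>" and alg: "is_local_algorithm \<P> \<A>"
    and fin: "\<And>\<sigma>. range \<sigma> \<subseteq> in_labels \<P> \<Longrightarrow> AE x in random_labels. coding_radius \<A> \<sigma> x 0 \<noteq> \<infinity>"
  shows "\<exists>t. has_uniform_complexity \<P> \<A> t"
proof -
  have "\<exists>r. 0 < \<epsilon> \<longrightarrow> (\<forall>v. tail_prob \<P> \<A> v r \<le> ennreal \<epsilon>)" for \<epsilon>
  proof (cases "0 < \<epsilon>")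
    case True
    obtain r where r: "\<And>\<sigma>. (\<forall>u\<in>grid_ball 0 r. \<sigma> u \<in> in_labels \<P>) \<Longrightarrow>
        emeasure random_labels (runs_beyond \<A> \<sigma> 0 r) \<le> ennreal \<epsilon>"
      using uniform_tail_bound[OF lcl alg fin True] by blast
    have "tail_prob \<P> \<A> v r \<le> ennreal \<epsilon>" for v
      unfolding tail_prob_def
    proof (rule SUP_least)
      fix \<sigma> assume "\<sigma> \<in> grid_ball v r \<rightarrow>\<^sub>E in_labels \<P>"
      then have \<sigma>: "\<sigma> u \<in> in_labels \<P>" if "u \<in> grid_ball v r" for u
        using that by auto
      have "emeasure random_labels (runs_beyond \<A> \<sigma> v r) =
          emeasure random_labels (runs_beyond \<A> (\<lambda>u. \<sigma> (v + u)) 0 r)"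
        using alg \<sigma> by (rule emeasure_runs_beyond_translate)
      also have "\<dots> \<le> ennreal \<epsilon>"
        by (rule r) (simp add: \<sigma> grid_ball_translate_0)
      finally show "emeasure random_labels {x \<in> space random_labels. enat r < coding_radius \<A> \<sigma> x v} \<le> ennreal \<epsilon>"
        by (simp add: runs_beyond_def coding_radius_greater)
    qed
    then show ?thesis by blast
  qed simp
  then obtain t where "\<And>\<epsilon>. 0 < \<epsilon> \<Longrightarrow> \<forall>v. tail_prob \<P> \<A> v (t \<epsilon>) \<le> ennreal \<epsilon>"
    by metis
  \<comment> \<open>The bound holds for every positive \<open>\<epsilon>\<close>, so the threshold 1
    is an arbitrary choice.\<close>
  then show ?thesis
    unfolding has_uniform_complexity_def by (intro exI[of _ t] exI[of _ 1]) auto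
qed

lemma lazy_rtoast_imp_ffiid:
  fixes \<P> :: "('d::finite, 'i, 'o) lcl"
  assumes "\<P> \<in> lazy_rtoast"
  shows "\<P> \<in> ffiid"
proof -
  obtain q and \<A> :: "('d, 'i, 'o) toast_algorithm" where lcl: "is_lcl \<P>" and alg: "is_toast_algorithm \<P> \<A>"
    and solves: "\<And>\<sigma>. range \<sigma> \<subseteq> in_labels \<P> \<Longrightarrow> AE x in random_labels. \<forall>\<D>. is_toast q \<D> \<longrightarrow>
      (\<exists>\<tau>. toast_result \<A> \<sigma> x \<D> = {(v, \<tau> v) |v. True} \<and> is_coloring \<P> \<sigma> \<tau>)"
    using assms by (auto simp: lazy_rtoast_def)
  interpret toast_to_local \<P> \<A> q "toast_scale q" "mark_prob CARD('d) q"
  proof -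
    interpret iid_toast q "toast_scale q" "mark_prob CARD('d) q"
      by (rule iid_toast_scale)
    show "toast_to_local \<P> \<A> q (toast_scale q)"
      by unfold_locales (fact lcl alg)+
  qed
  have correct: "AE x in random_labels. (\<forall>v. coding_radius local_of_toast \<sigma> x v \<noteq> \<infinity>) \<and>
      is_coloring \<P> \<sigma> (local_output local_of_toast \<sigma> x)"
    if \<sigma>: "range \<sigma> \<subseteq> in_labels \<P>" for \<sigma>
    using solves[OF \<sigma>] AE_is_toast[of q] AE_space
  proof eventually_elim
    case (elim x)
    then obtain \<tau> where \<tau>: "toast_result \<A> \<sigma> x (toast x) = {(v, \<tau> v) |v. True}" "is_coloring \<P> \<sigma> \<tau>"
      by blast
    have "x u \<in> {0..1}" for u
      using elim by (auto simp: space_random_labels)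
    note out = local_output_correct[OF \<sigma> this \<tau>(1)]
    then have "local_output local_of_toast \<sigma> x = \<tau>"
      by auto
    with out \<tau>(2) show ?case by simp
  qed
  then have "local_solves \<P> local_of_toast"
    by (simp add: local_solves_def)
  moreover have "\<exists>t. has_uniform_complexity \<P> local_of_toast t"
  proof (rule ex_uniform_complexity[OF lcl is_local_algorithm_local_of_toast])
    fix \<sigma> :: "int ^ 'd \<Rightarrow> 'i" assume "range \<sigma> \<subseteq> in_labels \<P>"
    from correct[OF this] show "AE x in random_labels. coding_radius local_of_toast \<sigma> x 0 \<noteq> \<infinity>"
      by (rule AE_mp) auto
  qed
  ultimately show ?thesis
    unfolding ffiid_def using lcl is_local_algorithm_local_of_toast by blast
qed

theorem theorem4p7:
  fixes \<P> :: "('d::finite, 'i, 'o) lcl"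
  assumes "is_lcl \<P>"
  shows "\<P> \<in> lazy_rtoast \<longleftrightarrow> \<P> \<in> ffiid"
  using lazy_rtoast_imp_ffiid ffiid_imp_lazy_rtoast by blast

end
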